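(* Let $m\le n$, let $U$ be a convex open subset of $\mathbb{R}^m$, and let $f:U\to\mathbb{R}^n$ be continuous and tame. Let $\delta>0$ and suppose that $\operatorname{dist}(\mathrm{co}(f),\Sigma)\ge\delta$, i.e. every $A\in\mathrm{co}(f)$ has distance at least $\delta$ from the set $\Sigma$ of singular linear maps. Then $$|f(x')-f(x)|\ge\delta|x'-x|\qquad\text{for all } x,x'\in U.$$ In particular $f$ is injective. If moreover $m=n$, then $f(U)$ is open, $f:U\to f(U)$ is a homeomorphism, and $f^{-1}$ satisfies the Lipschitz condition with constant $\delta^{-1}$.
   Context: $M(m,n)$ denotes the space of linear maps $\mathbb{R}^m\to\mathbb{R}^n$ (identified with matrices), with the operator norm induced by the Euclidean norms $|\cdot|$. For $m\le n$, $\Sigma\subset M(m,n)$ is the set of singular (i.e. non-injective, rank $<m$) maps. $B(f)$ is the set of points of $U$ where $f$ is not differentiable, and $\mathrm{co}(f)$ is the convex hull in $M(m,n)$ of the set $\mathcal{D}(f)=\{df(x):x\in U\setminus B(f)\}$. A continuous map is tame if its graph (a subset of $\mathbb{R}^{m+n}$) is subanalytic or is definable in some o-minimal structure on $(\mathbb{R},+,\cdot,<)$. *)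

theory Defs
  imports "HOL-Analysis.Analysis"
begin

section \<open>Coordinates\<close>

text \<open>
  Subanalytic sets and o-minimal structures involve all the spaces \<open>\<real>\<^sup>k\<close> at once, so they are
  formulated for the library's \<^const>\<open>Euclidean_space\<close>, whose points are the sequences vanishing
  from index \<open>k\<close> on.
\<close>

abbreviation Rn :: "nat \<Rightarrow> (nat \<Rightarrow> real) set" where
  "Rn k \<equiv> topspace (Euclidean_space k)"

definition truncate :: "nat \<Rightarrow> (nat \<Rightarrow> real) \<Rightarrow> nat \<Rightarrow> real" where
  "truncate k x = (\<lambda>i. if i < k then x i else 0)"

text \<open>
  An index type \<open>'m\<close> carries no order; \<open>from_nat_into UNIV\<close> is a fixed bijection from
  \<open>{..<CARD('m)}\<close> onto it.  Both notions of tameness below are invariant under permutations of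
  the coordinates, so the choice is immaterial.
\<close>

definition graph_in_Rn :: "(real^'m \<Rightarrow> real^'n) \<Rightarrow> (real^'m) set \<Rightarrow> (nat \<Rightarrow> real) set" where
  "graph_in_Rn f U =
    (\<lambda>x i. if i < CARD('m) then x $ from_nat_into UNIV i
           else if i < CARD('m) + CARD('n) then f x $ from_nat_into UNIV (i - CARD('m))
           else 0) ` U"

section \<open>Subanalytic sets\<close>

text \<open>Real analyticity: local expansion in an absolutely convergent power series, indexed by the
  multi-indices \<open>\<alpha> \<in> \<nat>\<^sup>k\<close>.\<close>

definition real_analytic_on :: "nat \<Rightarrow> (nat \<Rightarrow> real) set \<Rightarrow> ((nat \<Rightarrow> real) \<Rightarrow> real) \<Rightarrow> bool" where
  "real_analytic_on k V g \<longleftrightarrow>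
    (\<forall>a\<in>V. \<exists>r>0. \<exists>c :: (nat \<Rightarrow> nat) \<Rightarrow> real. \<forall>x\<in>V. (\<forall>i<k. \<bar>x i - a i\<bar> < r) \<longrightarrow>
      ((\<lambda>\<alpha>. c \<alpha> * (\<Prod>i<k. (x i - a i) ^ \<alpha> i)) has_sum g x) {\<alpha>. \<forall>i\<ge>k. \<alpha> i = 0})"

text \<open>Each pair \<open>(P, Q)\<close> below is one system of equations \<open>p = 0\<close> and inequalities \<open>q > 0\<close>.\<close>

definition semianalytic :: "nat \<Rightarrow> (nat \<Rightarrow> real) set \<Rightarrow> bool" where
  "semianalytic k A \<longleftrightarrow> A \<subseteq> Rn k \<and>
    (\<forall>a\<in>Rn k. \<exists>V. openin (Euclidean_space k) V \<and> a \<in> V \<and>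
      (\<exists>F. finite F \<and>
        (\<forall>(P, Q)\<in>F. finite P \<and> finite Q \<and> (\<forall>g\<in>P \<union> Q. real_analytic_on k V g)) \<and>
        A \<inter> V = (\<Union>(P, Q)\<in>F. {x\<in>V. (\<forall>p\<in>P. p x = 0) \<and> (\<forall>q\<in>Q. q x > 0)})))"

definition subanalytic :: "nat \<Rightarrow> (nat \<Rightarrow> real) set \<Rightarrow> bool" where
  "subanalytic k X \<longleftrightarrow> X \<subseteq> Rn k \<and>
    (\<forall>a\<in>Rn k. \<exists>V. openin (Euclidean_space k) V \<and> a \<in> V \<and>
      (\<exists>l A K. semianalytic (k + l) A \<and> compactin (Euclidean_space (k + l)) K \<and> A \<subseteq> K \<and>
        X \<inter> V = truncate k ` A))"

section \<open>O-minimal structures on the real field\<close>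

text \<open>
  \<open>S k\<close> is the collection of definable subsets of \<open>\<real>\<^sup>k\<close>, parameters being allowed.  In
  \<open>o_minimal\<close>, arbitrary intervals of \<open>\<real>\<close>, including degenerate ones, are admitted; their finite
  unions are the finite unions of points and open intervals.
\<close>

locale o_minimal_structure =
  fixes S :: "nat \<Rightarrow> (nat \<Rightarrow> real) set set"
  assumes subset: "A \<in> S k \<Longrightarrow> A \<subseteq> Rn k"
    and empty: "{} \<in> S k"
    and union: "A \<in> S k \<Longrightarrow> B \<in> S k \<Longrightarrow> A \<union> B \<in> S k"
    and complement: "A \<in> S k \<Longrightarrow> Rn k - A \<in> S k"
    and times_line: "A \<in> S k \<Longrightarrow> {x \<in> Rn (Suc k). truncate k x \<in> A} \<in> S (Suc k)"
    and line_times: "A \<in> S k \<Longrightarrow> {x \<in> Rn (Suc k). (\<lambda>i. x (Suc i)) \<in> A} \<in> S (Suc k)"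
    and diagonal: "{x \<in> Rn (Suc k). x 0 = x k} \<in> S (Suc k)"
    and projection: "A \<in> S (Suc k) \<Longrightarrow> truncate k ` A \<in> S k"
    and less: "{x \<in> Rn 2. x 0 < x 1} \<in> S 2"
    and add: "{x \<in> Rn 3. x 2 = x 0 + x 1} \<in> S 3"
    and mult: "{x \<in> Rn 3. x 2 = x 0 * x 1} \<in> S 3"
    and o_minimal: "A \<in> S 1 \<longleftrightarrow> A \<subseteq> Rn 1 \<and>
          (\<exists>F. finite F \<and> (\<forall>I\<in>F. is_interval I) \<and> (\<lambda>x. x 0) ` A = \<Union>F)"

definition tame :: "(real^'m \<Rightarrow> real^'n) \<Rightarrow> (real^'m) set \<Rightarrow> bool" where
  "tame f U \<longleftrightarrow>
    subanalytic (CARD('m) + CARD('n)) (graph_in_Rn f U) \<or>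
    (\<exists>S. o_minimal_structure S \<and> graph_in_Rn f U \<in> S (CARD('m) + CARD('n)))"

section \<open>Singular maps and the convex hull of the derivatives\<close>

text \<open>\<open>M(m,n)\<close> is the type of bounded linear functions, whose norm is the operator norm.\<close>

definition singular_maps :: "((real^'m) \<Rightarrow>\<^sub>L (real^'n)) set" where
  "singular_maps = {A. \<not> inj (blinfun_apply A)}"

definition nondiff_points :: "(real^'m \<Rightarrow> real^'n) \<Rightarrow> (real^'m) set \<Rightarrow> (real^'m) set" where
  "nondiff_points f U = {x\<in>U. \<not> f differentiable (at x)}"

definition derivatives :: "(real^'m \<Rightarrow> real^'n) \<Rightarrow> (real^'m) set \<Rightarrow> ((real^'m) \<Rightarrow>\<^sub>L (real^'n)) set" where
  "derivatives f U = (\<lambda>x. Blinfun (frechet_derivative f (at x))) ` (U - nondiff_points f U)"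

definition co :: "(real^'m \<Rightarrow> real^'n) \<Rightarrow> (real^'m) set \<Rightarrow> ((real^'m) \<Rightarrow>\<^sub>L (real^'n)) set" where
  "co f U = convex hull derivatives f U"

end

theory Submission
  imports Defs
begin

text \<open>
  For a fixed vector \<open>v = x' - x\<close>, the vectors \<open>A v\<close> with \<open>A \<in> co f U\<close> form a convex set of vectors of
  norm at least \<open>\<delta> \<bar>v\<bar>\<close>, so there is a unit vector \<open>w\<close> with \<open>w \<bullet> A v \<ge> \<delta> \<bar>v\<bar>\<close> for all of them.  It
  remains to integrate \<open>w \<bullet> f\<close> along the segment from \<open>x\<close> to \<open>x'\<close>, and by continuity along a generic
  segment nearby.  Tameness is used only through the functions \<open>g t = w \<bullet> f (x + t v)\<close> of one
  variable.  In the o-minimal case, \<open>g s - g t - c (s - t)\<close> has a constant sign for \<open>s\<close> slightly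
  larger than \<open>t\<close>.  In the subanalytic case, \<open>g\<close> is \<open>C\<^sup>1\<close> off a countable set.  In both cases
  (by Baire category in the former) \<open>g\<close> is nearly affine on some subinterval of any given
  interval, and \<open>g\<close> increases as soon as it increases locally on a dense open set.  By Baire
  category again, \<open>f\<close> is then differentiable on a dense set and nearly affine near the points of an
  open dense set, which generic lines meet in a dense set.

  The subanalytic case amounts to the following: if \<open>y = g \<circ> \<tau>\<close> on an analytic set \<open>{p = 0}\<close>, where
  \<open>p\<close>, \<open>\<tau>\<close>, \<open>y\<close> are analytic, then \<open>g\<close> is \<open>C\<^sup>1\<close> near all but countably many values of \<open>\<tau>\<close>.
  This goes by induction on the number of variables, one of which the implicit function theorem
  eliminates on each of the countably many hypersurfaces on which a derivative of \<open>p\<close> or of \<open>\<tau>\<close>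
  vanishes to first order.  Analyticity of the substituted functions is controlled by majorants.
\<close>

section \<open>Majorants\<close>

text \<open>A bound on derivatives cannot be integrated merely because they exist on a large set:
  with the Cantor function k, the function t/2 - k t increases locally on a dense open set and still
  falls from 0 to -1/2. Tameness has to exclude this on lines; it does so through the closed set of
  parameters without local increase, on which a sign becomes uniform by Baire, or which a countable
  set of values cannot obstruct. Moreover the points of differentiability are only known to be
  dense, and a given line may miss all of them. Near affinity up to a fixed error is the remedy: it
  is an open condition, so generic lines meet it, and it ties its linear map to every derivative of
  f in the same ball, on the line or not. The direction w must be common to all derivatives. A bound
  |A v| \<ge> \<delta> |v| for each derivative separately would allow f (x + t v) to turn around;
  this is why the hypothesis concerns the convex hull. Majorants serve because substituting an
  implicit function turns partial derivatives into vector fields, whose iterates are then dominated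
  by a single operator on series in one variable.\<close>

definition cube :: "nat set \<Rightarrow> (nat \<Rightarrow> real) \<Rightarrow> real \<Rightarrow> (nat \<Rightarrow> real) set" where
  "cube I a r = {x. (\<forall>i\<in>I. \<bar>x i - a i\<bar> < r) \<and> (\<forall>i. i \<notin> I \<longrightarrow> x i = a i)}"

text \<open>Openness only along the coordinate lines in I, which is all that partial derivatives
  see. A cube freezes the coordinates outside I at those of its centre, so it is in general not open
  in the space of sequences; in exchange, the elimination of a variable just shrinks I.\<close>

definition coord_open :: "nat set \<Rightarrow> (nat \<Rightarrow> real) set \<Rightarrow> bool" where
  "coord_open I Q \<longleftrightarrow> (\<forall>x\<in>Q. \<forall>i\<in>I. \<forall>\<^sub>F t in nhds (x i). x(i := t) \<in> Q)"

text \<open>\<open>deriv\<close> is total, hence the separate assertion \<open>has_pd\<close>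
  wherever existence matters.\<close>

definition pd :: "nat \<Rightarrow> ((nat \<Rightarrow> real) \<Rightarrow> real) \<Rightarrow> (nat \<Rightarrow> real) \<Rightarrow> real" where
  "pd i F x = deriv (\<lambda>t. F (x(i := t))) (x i)"

abbreviation has_pd :: "nat \<Rightarrow> ((nat \<Rightarrow> real) \<Rightarrow> real) \<Rightarrow> real \<Rightarrow> (nat \<Rightarrow> real) \<Rightarrow> bool" where
  "has_pd i F d x \<equiv> ((\<lambda>t. F (x(i := t))) has_real_derivative d) (at (x i))"

text \<open>
  Up to order \<open>n\<close>, the iterated partial derivatives of \<open>F\<close> are dominated on \<open>Q\<close> by the
  derivatives at \<open>0\<close> of the power series \<open>a\<close>.
\<close>

primrec maj :: "nat set \<Rightarrow> (nat \<Rightarrow> real) set \<Rightarrow> nat \<Rightarrow> real fps \<Rightarrow> ((nat \<Rightarrow> real) \<Rightarrow> real) \<Rightarrow> bool" where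
  "maj I Q 0 a F \<longleftrightarrow> (\<forall>x\<in>Q. \<bar>F x\<bar> \<le> fps_nth a 0)"
| "maj I Q (Suc n) a F \<longleftrightarrow> (\<forall>x\<in>Q. \<bar>F x\<bar> \<le> fps_nth a 0) \<and>
     (\<forall>i\<in>I. (\<forall>x\<in>Q. has_pd i F (pd i F x) x) \<and> maj I Q n (fps_deriv a) (pd i F))"

section \<open>Arithmetic of majorants\<close>

lemma has_pd_imp_pd: "has_pd i F d x \<Longrightarrow> pd i F x = d"
  unfolding pd_def by (rule DERIV_imp_deriv)

lemma coord_open_cube [simp]: "coord_open I (cube I a r)"
  unfolding coord_open_def
proof (intro ballI)
  fix x i assume x: "x \<in> cube I a r" and i: "i \<in> I"
  have "\<forall>\<^sub>F t in nhds (x i). t \<in> {a i - r<..<a i + r}"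
  proof (rule eventually_nhds_in_open)
    have "\<bar>x i - a i\<bar> < r" using x i by (simp add: cube_def)
    then show "x i \<in> {a i - r<..<a i + r}" by (auto simp: abs_less_iff)
  qed auto
  then show "\<forall>\<^sub>F t in nhds (x i). x(i := t) \<in> cube I a r"
    by eventually_elim (use x i in \<open>auto simp: cube_def\<close>)
qed

lemma coord_open_eventually_at:
  assumes "coord_open I Q" "x \<in> Q" "i \<in> I"
  shows "\<forall>\<^sub>F t in nhds (x i). x(i := t) \<in> Q"
  using assms by (auto simp: coord_open_def)

lemma has_pd_cong:
  assumes "coord_open I Q" "x \<in> Q" "i \<in> I" "\<And>y. y \<in> Q \<Longrightarrow> F y = G y"
  shows "has_pd i F d x \<longleftrightarrow> has_pd i G d x"
  by (rule DERIV_cong_ev[OF refl _ refl])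
     (use coord_open_eventually_at[OF assms(1-3)] assms(4) in \<open>auto elim!: eventually_mono\<close>)

lemma pd_cong:
  assumes "coord_open I Q" "x \<in> Q" "i \<in> I" "\<And>y. y \<in> Q \<Longrightarrow> F y = G y"
  shows "pd i F x = pd i G x"
  unfolding pd_def
  by (rule deriv_cong_ev[OF _ refl])
     (use coord_open_eventually_at[OF assms(1-3)] assms(4) in \<open>auto elim!: eventually_mono\<close>)

text \<open>F and G may differ off Q. Since Q is open along coordinate lines, equality on Q passes
  to all iterated partial derivatives.\<close>

lemma maj_cong:
  assumes "coord_open I Q" "\<And>y. y \<in> Q \<Longrightarrow> F y = G y" "maj I Q n a F"
  shows "maj I Q n a G"
  using assms(2,3)
proof (induction n arbitrary: F G a)
  case (Suc n)
  have "has_pd i G (pd i G x) x" if "i \<in> I" "x \<in> Q" for i x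
  proof -
    have "pd i F x = pd i G x" "has_pd i F (pd i F x) x"
      using Suc.prems that by (auto intro: pd_cong[OF assms(1)])
    then show ?thesis using has_pd_cong[OF assms(1) that(2,1), of F G, OF Suc.prems(1)] by metis
  qed
  moreover have "maj I Q n (fps_deriv a) (pd i G)" if "i \<in> I" for i
    using Suc.IH[of "pd i F" "pd i G" "fps_deriv a"] Suc.prems pd_cong[OF assms(1) _ that Suc.prems(1)] that
    by auto
  ultimately show ?case using Suc.prems by auto
qed auto

lemma maj_bound: "maj I Q n a F \<Longrightarrow> x \<in> Q \<Longrightarrow> \<bar>F x\<bar> \<le> fps_nth a 0"
  by (cases n) auto

lemma maj_mono:
  assumes "\<And>k. fps_nth a k \<le> fps_nth b k" "maj I Q n a F"
  shows "maj I Q n b F"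
  using assms
proof (induction n arbitrary: a b F)
  case 0
  then show ?case by simp (meson order_trans)
next
  case (Suc n)
  have "maj I Q n (fps_deriv b) (pd i F)" if "i \<in> I" for i
    by (rule Suc.IH[of "fps_deriv a"]) (use Suc.prems that in \<open>auto simp: mult_left_mono\<close>)
  then show ?case using Suc.prems by simp (meson order_trans)
qed

lemma maj_subset:
  assumes "Q' \<subseteq> Q" "I' \<subseteq> I" "maj I Q n a F"
  shows "maj I' Q' n a F"
  using assms(3) by (induction n arbitrary: a F) (use assms(1,2) in \<open>auto simp: subset_iff\<close>)

lemma maj_zero: "maj I Q n 0 (\<lambda>_. 0)"
proof (induction n)
  case (Suc n)
  have "pd i (\<lambda>_. 0) = (\<lambda>_. 0)" for i by (auto simp: pd_def)
  then show ?case using Suc by auto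
qed auto

lemma maj_const: "maj I Q n (fps_const \<bar>c\<bar>) (\<lambda>_. c)"
proof (cases n)
  case (Suc n)
  have "pd i (\<lambda>_. c) = (\<lambda>_. 0)" for i by (auto simp: pd_def)
  then show ?thesis using Suc maj_zero[of I Q] by auto
qed auto

lemma maj_coord:
  assumes "\<And>x. x \<in> Q \<Longrightarrow> \<bar>x j - s\<bar> \<le> c"
  shows "maj I Q n (fps_const c + fps_X) (\<lambda>x. x j - s)"
proof (cases n)
  case (Suc n)
  have h: "has_pd i (\<lambda>x. x j - s) (if i = j then 1 else 0) x" for i x
    by (auto intro!: derivative_eq_intros)
  then have p: "pd i (\<lambda>x. x j - s) = (\<lambda>_. if i = j then 1 else 0)" for i
    by (intro ext has_pd_imp_pd)
  have "maj I Q n 1 (\<lambda>_. if i = j then 1 else 0)" for i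
    by (rule maj_mono[OF _ maj_const]) (auto simp: fps_one_nth)
  then show ?thesis using Suc assms h by (auto simp: p)
qed (use assms in auto)

lemma maj_add:
  assumes "coord_open I Q" "maj I Q n a F" "maj I Q n b G"
  shows "maj I Q n (a + b) (\<lambda>x. F x + G x)"
  using assms(2,3)
proof (induction n arbitrary: a b F G)
  case 0
  then have "\<bar>F x + G x\<bar> \<le> fps_nth a 0 + fps_nth b 0" if "x \<in> Q" for x
    using that by (meson abs_triangle_ineq add_mono maj_bound order_trans)
  then show ?case by simp
next
  case (Suc n)
  have h: "has_pd i (\<lambda>x. F x + G x) (pd i F x + pd i G x) x" if "i \<in> I" "x \<in> Q" for i x
    using Suc.prems that by (auto intro!: derivative_eq_intros)
  have "maj I Q n (fps_deriv (a + b)) (pd i (\<lambda>x. F x + G x))" if "i \<in> I" for i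
  proof (rule maj_cong[OF assms(1)])
    show "maj I Q n (fps_deriv (a + b)) (\<lambda>x. pd i F x + pd i G x)"
      using Suc.prems that by (auto intro!: Suc.IH)
  qed (simp add: has_pd_imp_pd[OF h[OF that]])
  moreover have "\<bar>F x + G x\<bar> \<le> fps_nth (a+b) 0" if "x \<in> Q" for x
    using Suc.prems[THEN maj_bound, OF that] by simp
  ultimately show ?case using h by (auto simp: has_pd_imp_pd[OF h])
qed

lemma maj_Suc_imp: "maj I Q (Suc n) a F \<Longrightarrow> maj I Q n a F"
  by (induction n arbitrary: a F) auto

lemma maj_mult_bound:
  assumes "maj I Q n a F" "maj I Q m b G" "x \<in> Q"
  shows "\<bar>F x * G x\<bar> \<le> fps_nth (a * b) 0"
proof -
  have "\<bar>F x\<bar> * \<bar>G x\<bar> \<le> fps_nth a 0 * fps_nth b 0"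
    using maj_bound[OF assms(1,3)] maj_bound[OF assms(2,3)] by (intro mult_mono) linarith+
  then show ?thesis by (simp add: abs_mult)
qed

text \<open>\<open>fps_deriv\<close> and \<open>pd\<close> obey the same product rule, so induction
  on the order takes the place of multinomial estimates; the factor that is not differentiated
  enters at the lower order.\<close>

lemma maj_mult:
  assumes "coord_open I Q" "maj I Q n a F" "maj I Q n b G"
  shows "maj I Q n (a * b) (\<lambda>x. F x * G x)"
  using assms(2,3)
proof (induction n arbitrary: a b F G)
  case 0
  then show ?case using maj_mult_bound[OF 0] by simp
next
  case (Suc n)
  have h: "has_pd i (\<lambda>x. F x * G x) (pd i F x * G x + F x * pd i G x) x" if "i \<in> I" "x \<in> Q" for i x
    using Suc.prems that by (auto intro!: derivative_eq_intros)
  have "maj I Q n (fps_deriv (a * b)) (pd i (\<lambda>x. F x * G x))" if i: "i \<in> I" for i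
  proof -
    have "maj I Q n (fps_deriv a * b) (\<lambda>x. pd i F x * G x)"
      by (rule Suc.IH) (use Suc.prems i maj_Suc_imp[OF Suc.prems(2)] in auto)
    moreover have "maj I Q n (a * fps_deriv b) (\<lambda>x. F x * pd i G x)"
      by (rule Suc.IH) (use Suc.prems i maj_Suc_imp[OF Suc.prems(1)] in auto)
    ultimately have "maj I Q n (fps_deriv a * b + a * fps_deriv b) (\<lambda>x. pd i F x * G x + F x * pd i G x)"
      by (rule maj_add[OF assms(1)])
    then have "maj I Q n (fps_deriv (a * b)) (\<lambda>x. pd i F x * G x + F x * pd i G x)"
      by (simp add: add.commute)
    then show ?thesis
      by (rule maj_cong[OF assms(1), rotated]) (simp add: has_pd_imp_pd[OF h[OF i]])
  qed
  moreover have "\<bar>F x * G x\<bar> \<le> fps_nth (a*b) 0" if "x \<in> Q" for x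
    using maj_mult_bound[OF Suc.prems that] .
  ultimately show ?case using h by (auto simp: has_pd_imp_pd[OF h])
qed

text \<open>The l1 norm with weight \<rho> on series with nonnegative coefficients. It is
  submultiplicative, and a bound c for it turns \<open>maj\<close> into a Cauchy estimate:
  derivatives of order k are at most k! c / \<rho>^k. Partial sums avoid side conditions on
  summability.\<close>

definition fps_norm_le :: "real \<Rightarrow> real \<Rightarrow> real fps \<Rightarrow> bool" where
  "fps_norm_le \<rho> c a \<longleftrightarrow> (\<forall>k. fps_nth a k \<ge> 0) \<and> (\<forall>n. (\<Sum>k\<le>n. fps_nth a k * \<rho> ^ k) \<le> c)"

lemma fps_norm_leD:
  assumes "fps_norm_le \<rho> c a" "\<rho> > 0"
  shows "fps_nth a k \<ge> 0" "fps_nth a k * \<rho> ^ k \<le> c" "c \<ge> 0" "(\<Sum>k\<le>n. fps_nth a k * \<rho> ^ k) \<le> c"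
proof -
  show 0: "fps_nth a k \<ge> 0" for k
    using assms by (auto simp: fps_norm_le_def)
  show 1: "(\<Sum>k\<le>n. fps_nth a k * \<rho> ^ k) \<le> c" for n
    using assms by (auto simp: fps_norm_le_def)
  show 2: "fps_nth a k * \<rho> ^ k \<le> c" for k
    by (rule order_trans[OF member_le_sum[of k "{..k}" "\<lambda>k. fps_nth a k * \<rho> ^ k"] 1[of k]]) (use 0 assms in auto)
  show "c \<ge> 0" using 2[of 0] 0[of 0] by simp
qed

lemma fps_norm_le_mono:
  assumes "fps_norm_le \<rho> c a" "0 < \<rho>'" "\<rho>' \<le> \<rho>" "c \<le> c'"
  shows "fps_norm_le \<rho>' c' a"
  unfolding fps_norm_le_def
proof (intro conjI allI)
  fix n
  show "fps_nth a n \<ge> 0" using assms by (auto simp: fps_norm_le_def)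
  have "(\<Sum>k\<le>n. fps_nth a k * \<rho>' ^ k) \<le> (\<Sum>k\<le>n. fps_nth a k * \<rho> ^ k)"
    by (intro sum_mono mult_left_mono power_mono) (use assms in \<open>auto simp: fps_norm_le_def\<close>)
  also have "\<dots> \<le> c" using assms by (simp only: fps_norm_le_def)
  also note \<open>c \<le> c'\<close>
  finally show "(\<Sum>k\<le>n. fps_nth a k * \<rho>' ^ k) \<le> c'" .
qed

lemma fps_norm_le_const: "c \<ge> 0 \<Longrightarrow> fps_norm_le \<rho> c (fps_const c)"
  unfolding fps_norm_le_def
proof (intro conjI allI)
  fix n assume "c \<ge> 0"
  have "(\<Sum>k\<le>n. fps_nth (fps_const c) k * \<rho> ^ k) = (\<Sum>k\<le>n. if k = 0 then c else 0)"
    by (intro sum.cong) auto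
  then show "(\<Sum>k\<le>n. fps_nth (fps_const c) k * \<rho> ^ k) \<le> c" by simp
qed auto

lemma fps_norm_le_X: "\<rho> > 0 \<Longrightarrow> fps_norm_le \<rho> \<rho> fps_X"
  unfolding fps_norm_le_def
proof (intro conjI allI)
  fix n assume "\<rho> > 0"
  have "(\<Sum>k\<le>n. fps_nth fps_X k * \<rho> ^ k) = (\<Sum>k\<le>n. if k = 1 then \<rho> else 0)"
    by (intro sum.cong) auto
  then show "(\<Sum>k\<le>n. fps_nth fps_X k * \<rho> ^ k) \<le> \<rho>" using \<open>\<rho> > 0\<close> by simp
qed auto

lemma fps_norm_le_add:
  "fps_norm_le \<rho> c a \<Longrightarrow> fps_norm_le \<rho> d b \<Longrightarrow> fps_norm_le \<rho> (c + d) (a + b)"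
  by (auto simp: fps_norm_le_def distrib_right sum.distrib intro: add_mono)

text \<open>Pairs of degrees with sum at most n form a triangle inside the square of pairs of
  degrees at most n, and all terms are nonnegative.\<close>

lemma fps_mult_partial_sum_le:
  fixes a b :: "real fps"
  assumes "\<rho> \<ge> 0" "\<And>k. fps_nth a k \<ge> 0" "\<And>k. fps_nth b k \<ge> 0"
  shows "(\<Sum>k\<le>n. fps_nth (a * b) k * \<rho> ^ k) \<le>
    (\<Sum>k\<le>n. fps_nth a k * \<rho> ^ k) * (\<Sum>k\<le>n. fps_nth b k * \<rho> ^ k)"
proof -
  have "(\<Sum>k\<le>n. fps_nth (a * b) k * \<rho> ^ k) =
    (\<Sum>k\<le>n. \<Sum>i\<le>k. (fps_nth a i * \<rho> ^ i) * (fps_nth b (k - i) * \<rho> ^ (k - i)))"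
    unfolding fps_mult_nth sum_distrib_right atLeast0AtMost
  proof (intro sum.cong refl)
    fix k i :: nat assume "i \<in> {..k}"
    then have "\<rho> ^ k = \<rho> ^ i * \<rho> ^ (k - i)" by (simp flip: power_add)
    then show "fps_nth a i * fps_nth b (k - i) * \<rho> ^ k =
      fps_nth a i * \<rho> ^ i * (fps_nth b (k - i) * \<rho> ^ (k - i))" by simp
  qed
  also have "\<dots> = (\<Sum>(i, j)\<in>{(i, j). i + j \<le> n}. (fps_nth a i * \<rho> ^ i) * (fps_nth b j * \<rho> ^ j))"
    by (rule sum.triangle_reindex_eq[symmetric])
  also have "\<dots> \<le> (\<Sum>(i, j)\<in>{..n} \<times> {..n}. (fps_nth a i * \<rho> ^ i) * (fps_nth b j * \<rho> ^ j))"
    by (intro sum_mono2) (use assms in auto)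
  also have "\<dots> = (\<Sum>k\<le>n. fps_nth a k * \<rho> ^ k) * (\<Sum>k\<le>n. fps_nth b k * \<rho> ^ k)"
    by (simp add: sum_product sum.cartesian_product)
  finally show ?thesis .
qed

lemma fps_norm_le_mult:
  assumes "\<rho> > 0" "fps_norm_le \<rho> c a" "fps_norm_le \<rho> d b"
  shows "fps_norm_le \<rho> (c * d) (a * b)"
  unfolding fps_norm_le_def
proof (intro conjI allI)
  fix n
  note A = fps_norm_leD[OF assms(2,1)] and B = fps_norm_leD[OF assms(3,1)]
  show "fps_nth (a * b) n \<ge> 0" using A(1) B(1) by (auto simp: fps_mult_nth intro!: sum_nonneg)
  have "(\<Sum>k\<le>n. fps_nth (a * b) k * \<rho> ^ k) \<le>
    (\<Sum>k\<le>n. fps_nth a k * \<rho> ^ k) * (\<Sum>k\<le>n. fps_nth b k * \<rho> ^ k)"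
    using A(1) B(1) assms(1) by (intro fps_mult_partial_sum_le) auto
  also have "\<dots> \<le> c * d"
    using A(1,3,4) B(1,4) assms(1) by (intro mult_mono) (auto intro!: sum_nonneg)
  finally show "(\<Sum>k\<le>n. fps_nth (a * b) k * \<rho> ^ k) \<le> c * d" .
qed

lemma fps_norm_le_power:
  "\<rho> > 0 \<Longrightarrow> fps_norm_le \<rho> c a \<Longrightarrow> fps_norm_le \<rho> (c ^ k) (a ^ k)"
proof (induction k)
  case 0
  then show ?case using fps_norm_le_const[of 1 \<rho>] by simp
qed (auto intro: fps_norm_le_mult)

text \<open>A derivative costs part of the radius: (k + 1) \<rho>'^k (\<rho> - \<rho>') is at most
  \<rho>^(k+1) - \<rho>'^(k+1), because each of the k + 1 terms in the factorisation of this
  difference is at least \<rho>'^k.\<close>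

lemma fps_norm_le_deriv:
  assumes "fps_norm_le \<rho> c a" "0 < \<rho>'" "\<rho>' < \<rho>"
  shows "fps_norm_le \<rho>' (c / (\<rho> - \<rho>')) (fps_deriv a)"
  unfolding fps_norm_le_def
proof (intro conjI allI)
  fix n
  have A: "fps_nth a k \<ge> 0" for k using assms by (auto simp: fps_norm_le_def)
  show "fps_nth (fps_deriv a) n \<ge> 0" using A by simp
  have *: "real (Suc k) * \<rho>' ^ k * (\<rho> - \<rho>') \<le> \<rho> ^ Suc k" for k
  proof -
    have "real (Suc k) * \<rho>' ^ k * (\<rho> - \<rho>') = (\<Sum>j\<le>k. \<rho>' ^ k) * (\<rho> - \<rho>')" by simp
    also have "\<dots> \<le> (\<Sum>j\<le>k. \<rho> ^ j * \<rho>' ^ (k - j)) * (\<rho> - \<rho>')"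
    proof (intro mult_right_mono sum_mono)
      fix j assume "j \<in> {..k}"
      then have "\<rho>' ^ k = \<rho>' ^ j * \<rho>' ^ (k - j)" by (simp flip: power_add)
      then show "\<rho>' ^ k \<le> \<rho> ^ j * \<rho>' ^ (k - j)"
        using assms by (auto intro!: mult_right_mono power_mono)
    qed (use assms in auto)
    also have "\<dots> = \<rho> ^ Suc k - \<rho>' ^ Suc k"
      using diff_power_eq_sum[of \<rho> k \<rho>'] by (simp add: lessThan_Suc_atMost mult.commute)
    also have "\<dots> \<le> \<rho> ^ Suc k" using assms by simp
    finally show ?thesis .
  qed
  have "(\<Sum>k\<le>n. fps_nth (fps_deriv a) k * \<rho>' ^ k) * (\<rho> - \<rho>')
     = (\<Sum>k\<le>n. fps_nth a (Suc k) * (real (Suc k) * \<rho>' ^ k * (\<rho> - \<rho>')))"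
    unfolding sum_distrib_right by (intro sum.cong refl) (simp add: mult_ac)
  also have "\<dots> \<le> (\<Sum>k\<le>n. fps_nth a (Suc k) * \<rho> ^ Suc k)"
    by (intro sum_mono mult_left_mono * A)
  also have "\<dots> \<le> (\<Sum>k\<le>Suc n. fps_nth a k * \<rho> ^ k)"
    unfolding sum.atMost_Suc_shift[of _ n] using A[of 0] by simp
  also have "\<dots> \<le> c" using assms by (simp only: fps_norm_le_def)
  finally show "(\<Sum>k\<le>n. fps_nth (fps_deriv a) k * \<rho>' ^ k) \<le> c / (\<rho> - \<rho>')"
    using assms by (simp add: pos_le_divide_eq)
qed

section \<open>Cubes and mean value estimates\<close>

lemma fun_upd_in_cube: "x \<in> cube I z r \<Longrightarrow> i \<in> I \<Longrightarrow> \<bar>t - z i\<bar> < r \<Longrightarrow> x(i := t) \<in> cube I z r"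
  by (auto simp: cube_def)

lemma cube_mono: "r \<le> s \<Longrightarrow> cube I z r \<subseteq> cube I z s"
  by (auto simp: cube_def)

lemma center_in_cube: "r > 0 \<Longrightarrow> z \<in> cube I z r"
  by (auto simp: cube_def)

lemma cube_at_point:
  assumes "finite I" "x \<in> cube I z r"
  obtains s where "s > 0" "cube I x s \<subseteq> cube I z r"
proof -
  \<comment> \<open>The entry 1 covers an empty I.\<close>
  define s where "s = Min (insert 1 ((\<lambda>i. r - \<bar>x i - z i\<bar>) ` I))"
  have s: "s \<le> r - \<bar>x i - z i\<bar>" if "i \<in> I" for i
    unfolding s_def using assms(1) that by (intro Min_le) auto
  have "s > 0" unfolding s_def using assms by (subst Min_gr_iff) (auto simp: cube_def)
  moreover have "cube I x s \<subseteq> cube I z r"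
  proof
    fix y assume y: "y \<in> cube I x s"
    have "\<bar>y i - z i\<bar> < r" if "i \<in> I" for i
    proof -
      have "\<bar>y i - x i\<bar> < s" using y that by (auto simp: cube_def)
      then show ?thesis using s[OF that] by linarith
    qed
    then show "y \<in> cube I z r" using y assms by (auto simp: cube_def)
  qed
  ultimately show ?thesis by (rule that)
qed

lemma has_pd_line:
  assumes "maj I Q (Suc n) a F" "i \<in> I" "x(i := t) \<in> Q"
  shows "((\<lambda>s. F (x(i := s))) has_real_derivative pd i F (x(i := t))) (at t)"
proof -
  have "\<forall>y\<in>Q. has_pd i F (pd i F y) y" using assms(1,2) by simp
  from bspec[OF this assms(3)] show ?thesis by simp
qed

lemma maj_line_bound:
  assumes "maj I (cube I z r) (Suc n) a F" "i \<in> I" "x(i := s) \<in> cube I z r" "x(i := t) \<in> cube I z r"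
  shows "\<bar>F (x(i := s)) - F (x(i := t))\<bar> \<le> fps_nth a 1 * \<bar>s - t\<bar>"
proof -
  define S where "S = {z i - r<..<z i + r}"
  have st: "\<bar>s - z i\<bar> < r" "\<bar>t - z i\<bar> < r"
    using assms(2-4) by (auto simp: cube_def dest!: bspec[of _ _ i])
  have S: "x(i := y) \<in> cube I z r" if "y \<in> S" for y
  proof -
    have "\<bar>y - z i\<bar> < r" using that by (auto simp: S_def)
    then show ?thesis using fun_upd_in_cube[OF assms(3,2), of y] by simp
  qed
  have "norm (F (x(i := s)) - F (x(i := t))) \<le> fps_nth a 1 * norm (s - t)"
  proof (rule field_differentiable_bound[of S "\<lambda>s. F (x(i := s))" "\<lambda>y. pd i F (x(i := y))"])
    show "s \<in> S" "t \<in> S" using st by (auto simp: S_def abs_less_iff)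
    fix y assume y: "y \<in> S"
    show "((\<lambda>s. F (x(i := s))) has_field_derivative pd i F (x(i := y))) (at y within S)"
      by (rule has_field_derivative_at_within[OF has_pd_line[OF assms(1,2) S[OF y]]])
    have "maj I (cube I z r) n (fps_deriv a) (pd i F)" using assms(1,2) by auto
    from maj_bound[OF this S[OF y]] show "norm (pd i F (x(i := y))) \<le> fps_nth a 1" by simp
  qed (auto simp: S_def)
  then show ?thesis by simp
qed

text \<open>Pass from y to x through the hybrid points \<open>mix J\<close>, one coordinate at a
  time; the coefficient of degree 1 bounds every first partial derivative.\<close>

lemma maj_lipschitz:
  assumes "finite I" "maj I (cube I z r) (Suc n) a F" "x \<in> cube I z r" "y \<in> cube I z r"
  shows "\<bar>F x - F y\<bar> \<le> fps_nth a 1 * (\<Sum>i\<in>I. \<bar>x i - y i\<bar>)"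
proof -
  define mix where "mix J = (\<lambda>i. if i \<in> J then x i else y i)" for J
  have mix: "mix J \<in> cube I z r" for J
    using assms(3,4) by (auto simp: mix_def cube_def)
  have "\<bar>F (mix J) - F y\<bar> \<le> fps_nth a 1 * (\<Sum>i\<in>J. \<bar>x i - y i\<bar>)" if "J \<subseteq> I" for J
    using finite_subset[OF that assms(1)] that
  proof (induction J rule: finite_induct)
    case empty
    have "mix {} = y" by (auto simp: mix_def)
    then show ?case by simp
  next
    case (insert j J)
    have 1: "mix (insert j J) = (mix J)(j := x j)" by (auto simp: mix_def fun_eq_iff)
    have 2: "mix J = (mix J)(j := y j)" using insert by (auto simp: mix_def fun_eq_iff)
    have "\<bar>F ((mix J)(j := x j)) - F ((mix J)(j := y j))\<bar> \<le> fps_nth a 1 * \<bar>x j - y j\<bar>"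
      by (rule maj_line_bound[OF assms(2)]) (use insert mix[of J] mix[of "insert j J"] 1 2 in auto)
    then have "\<bar>F (mix (insert j J)) - F (mix J)\<bar> \<le> fps_nth a 1 * \<bar>x j - y j\<bar>"
      using 1 2 by metis
    then show ?case using insert by (simp add: algebra_simps)
  qed
  from this[of I] have "\<bar>F (mix I) - F y\<bar> \<le> fps_nth a 1 * (\<Sum>i\<in>I. \<bar>x i - y i\<bar>)" by simp
  moreover have "mix I = x" using assms(3,4) by (auto simp: mix_def cube_def fun_eq_iff)
  ultimately show ?thesis by simp
qed

text \<open>Analyticity on the cube, in the form of Cauchy estimates that are uniform there.\<close>

definition anl :: "nat set \<Rightarrow> (nat \<Rightarrow> real) \<Rightarrow> real \<Rightarrow> ((nat \<Rightarrow> real) \<Rightarrow> real) \<Rightarrow> bool" where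
  "anl I z r F \<longleftrightarrow> r > 0 \<and> (\<exists>\<rho>>0. \<exists>c a. fps_norm_le \<rho> c a \<and> (\<forall>n. maj I (cube I z r) n a F))"

lemma anlE:
  assumes "anl I z r F"
  obtains \<rho> c a where "r > 0" "\<rho> > 0" "fps_norm_le \<rho> c a" "\<And>n. maj I (cube I z r) n a F"
  using assms by (auto simp: anl_def)

lemma anlI:
  "r > 0 \<Longrightarrow> \<rho> > 0 \<Longrightarrow> fps_norm_le \<rho> c a \<Longrightarrow> (\<And>n. maj I (cube I z r) n a F) \<Longrightarrow> anl I z r F"
  by (auto simp: anl_def)

lemma anl_subset: "anl I z r F \<Longrightarrow> s > 0 \<Longrightarrow> cube I x s \<subseteq> cube I z r \<Longrightarrow> anl I x s F"
  by (meson anlE anlI maj_subset subset_refl)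

lemma anl_mono: "anl I z r F \<Longrightarrow> s > 0 \<Longrightarrow> s \<le> r \<Longrightarrow> anl I z s F"
  by (meson anl_subset cube_mono)

lemma anl_cong:
  assumes "anl I z r F" "\<And>x. x \<in> cube I z r \<Longrightarrow> F x = G x"
  shows "anl I z r G"
  using assms(1) by (elim anlE, intro anlI) (auto intro: maj_cong[OF coord_open_cube assms(2)])

lemma anl_const: "r > 0 \<Longrightarrow> anl I z r (\<lambda>_. c)"
  by (rule anlI[OF _ _ fps_norm_le_const maj_const, where \<rho> = 1]) auto

lemma anl_coord: 
  assumes "r > 0"
  shows "anl I z r (\<lambda>x. x j - s)"
proof (rule anlI[where \<rho> = 1])
  define c where "c = \<bar>z j - s\<bar> + r"
  show "fps_norm_le 1 (c + 1) (fps_const c + fps_X)"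
    using assms by (intro fps_norm_le_add fps_norm_le_const fps_norm_le_X) (auto simp: c_def)
  show "maj I (cube I z r) n (fps_const c + fps_X) (\<lambda>x. x j - s)" for n
  proof (rule maj_coord)
    fix x assume x: "x \<in> cube I z r"
    have "\<bar>x j - z j\<bar> \<le> r" using x assms by (cases "j \<in> I") (auto simp: cube_def intro: less_imp_le)
    then show "\<bar>x j - s\<bar> \<le> c" by (simp add: c_def)
  qed
qed (use assms in auto)

lemma anl_add:
  assumes "anl I z r F" "anl I z r G"
  shows "anl I z r (\<lambda>x. F x + G x)"
proof -
  from assms(1) obtain \<rho> c a where F: "r > 0" "\<rho> > 0" "fps_norm_le \<rho> c a" "\<And>n. maj I (cube I z r) n a F"
    by (rule anlE) blast
  from assms(2) obtain \<rho>' c' a' where G: "\<rho>' > 0" "fps_norm_le \<rho>' c' a'" "\<And>n. maj I (cube I z r) n a' G"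
    by (rule anlE) blast
  show ?thesis
  proof (rule anlI[where \<rho> = "min \<rho> \<rho>'"])
    show "fps_norm_le (min \<rho> \<rho>') (c + c') (a + a')"
      using F G by (intro fps_norm_le_add) (auto elim!: fps_norm_le_mono)
  qed (use F G in \<open>auto intro!: maj_add\<close>)
qed

lemma anl_mult:
  assumes "anl I z r F" "anl I z r G"
  shows "anl I z r (\<lambda>x. F x * G x)"
proof -
  from assms(1) obtain \<rho> c a where F: "r > 0" "\<rho> > 0" "fps_norm_le \<rho> c a" "\<And>n. maj I (cube I z r) n a F"
    by (rule anlE) blast
  from assms(2) obtain \<rho>' c' a' where G: "\<rho>' > 0" "fps_norm_le \<rho>' c' a'" "\<And>n. maj I (cube I z r) n a' G"
    by (rule anlE) blast
  show ?thesis
  proof (rule anlI[where \<rho> = "min \<rho> \<rho>'"])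
    show "fps_norm_le (min \<rho> \<rho>') (c * c') (a * a')"
      using F G by (intro fps_norm_le_mult) (auto elim!: fps_norm_le_mono)
  qed (use F G in \<open>auto intro!: maj_mult\<close>)
qed

lemma anl_uminus: "anl I z r F \<Longrightarrow> anl I z r (\<lambda>x. - F x)"
  using anl_mult[OF anl_const[of r I z "-1"], of F] by (auto elim: anlE)

lemma anl_diff: "anl I z r F \<Longrightarrow> anl I z r G \<Longrightarrow> anl I z r (\<lambda>x. F x - G x)"
  using anl_add[of I z r F "\<lambda>x. - G x"] anl_uminus[of I z r G] by simp

lemma anl_sum:
  "r > 0 \<Longrightarrow> (\<And>k. k \<in> K \<Longrightarrow> anl I z r (F k)) \<Longrightarrow> anl I z r (\<lambda>x. \<Sum>k\<in>K. F k x)"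
proof (induction K rule: infinite_finite_induct)
  case (insert k K)
  then show ?case using anl_add[of I z r "F k" "\<lambda>x. \<Sum>k\<in>K. F k x"] by auto
qed (auto intro: anl_const)

lemma anl_pd:
  assumes "anl I z r F" "i \<in> I"
  shows "anl I z r (pd i F)"
proof -
  from assms(1) obtain \<rho> c a where F: "r > 0" "\<rho> > 0" "fps_norm_le \<rho> c a" "\<And>n. maj I (cube I z r) n a F"
    by (rule anlE) blast
  show ?thesis
    by (rule anlI[OF F(1) _ fps_norm_le_deriv[OF F(3), of "\<rho> / 2"]]) 
       (use F(2) F(4)[of "Suc _"] assms(2) in auto)
qed

lemma anl_fold_pd: "anl I z r F \<Longrightarrow> set w \<subseteq> I \<Longrightarrow> anl I z r (fold pd w F)"
  by (induction w arbitrary: F) (auto intro: anl_pd)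

lemma anl_has_pd:
  assumes "anl I z r F" "i \<in> I" "x(i := t) \<in> cube I z r"
  shows "((\<lambda>s. F (x(i := s))) has_real_derivative pd i F (x(i := t))) (at t)"
  using assms(1) by (rule anlE) (use has_pd_line assms in blast)

lemma anl_lipschitz:
  assumes "finite I" "anl I z r F"
  obtains L where "L \<ge> 0" "\<And>x y. x \<in> cube I z r \<Longrightarrow> y \<in> cube I z r \<Longrightarrow>
    \<bar>F x - F y\<bar> \<le> L * (\<Sum>i\<in>I. \<bar>x i - y i\<bar>)"
proof -
  from assms(2) obtain \<rho> c a where F: "r > 0" "\<rho> > 0" "fps_norm_le \<rho> c a" "\<And>n. maj I (cube I z r) n a F"
    by (rule anlE) blast
  show ?thesis
    by (rule that[of "fps_nth a 1"]) (use maj_lipschitz[OF assms(1) F(4)] F(3) in \<open>auto simp: fps_norm_le_def\<close>)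
qed

lemma sum_abs_cube_le:
  assumes "finite I" "x \<in> cube I z r"
  shows "(\<Sum>i\<in>I. \<bar>x i - z i\<bar>) \<le> real (card I) * r"
  using assms sum_bounded_above[of I "\<lambda>i. \<bar>x i - z i\<bar>" r] by (auto simp: cube_def less_imp_le)

lemma anl_small_oscillation:
  assumes "finite I" "anl I z r F" "\<epsilon> > 0"
  obtains s where "0 < s" "s \<le> r" "\<And>x. x \<in> cube I z s \<Longrightarrow> \<bar>F x - F z\<bar> \<le> \<epsilon>"
proof -
  obtain L where L: "L \<ge> 0" "\<And>x y. x \<in> cube I z r \<Longrightarrow> y \<in> cube I z r \<Longrightarrow>
    \<bar>F x - F y\<bar> \<le> L * (\<Sum>i\<in>I. \<bar>x i - y i\<bar>)"
    using anl_lipschitz[OF assms(1,2)] by blast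
  have r: "r > 0" using assms(2) by (auto simp: anl_def)
  define s where "s = min r (\<epsilon> / (L * card I + 1))"
  have p: "L * card I + 1 > 0" using L(1) by (simp add: add_nonneg_pos)
  have s: "s > 0" "s \<le> r" using r assms(3) p by (auto simp: s_def)
  have "\<bar>F x - F z\<bar> \<le> \<epsilon>" if "x \<in> cube I z s" for x
  proof -
    have "\<bar>F x - F z\<bar> \<le> L * (\<Sum>i\<in>I. \<bar>x i - z i\<bar>)"
      using that cube_mono[OF s(2)] center_in_cube[OF r] by (intro L(2)) auto
    also have "\<dots> \<le> L * (real (card I) * s)"
      by (intro mult_left_mono sum_abs_cube_le that assms L)
    also have "\<dots> \<le> (L * card I + 1) * s" using s by (simp add: algebra_simps)
    also have "\<dots> \<le> (L * card I + 1) * (\<epsilon> / (L * card I + 1))"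
      using p by (intro mult_left_mono) (auto simp: s_def)
    also have "\<dots> = \<epsilon>" using p by simp
    finally show ?thesis .
  qed
  then show ?thesis using that s by blast
qed

text \<open>The inverse B satisfies B = 1 + e B, so a partial sum s of its norm satisfies s \<le> 1
  + s/2, whence s \<le> 2. Solving the same recursion for the coefficient of degree n, where the
  constant term of e is below 1, shows that it is nonnegative.\<close>

lemma fps_norm_le_inverse:
  assumes "\<rho> > 0" "fps_norm_le \<rho> (1/2) e"
  shows "fps_norm_le \<rho> 2 (inverse (1 - e))"
proof -
  define B where "B = inverse (1 - e)"
  have e: "fps_nth e k \<ge> 0" for k using assms by (auto simp: fps_norm_le_def)
  have "fps_nth e 0 \<le> 1/2" using fps_norm_leD(2)[OF assms(2,1), of 0] by simp
  then have e0: "fps_nth e 0 < 1" by simp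
  have "B * (1 - e) = 1" unfolding B_def using e0 by (intro inverse_mult_eq_1) auto
  then have BB: "B = 1 + e * B" by (simp add: algebra_simps)
  have nonneg: "fps_nth B n \<ge> 0" for n
  proof (induction n rule: less_induct)
    case (less n)
    have "fps_nth B n = fps_nth 1 n + (\<Sum>i=0..n. fps_nth e i * fps_nth B (n - i))"
      by (subst BB) (simp add: fps_mult_nth)
    also have "(\<Sum>i=0..n. fps_nth e i * fps_nth B (n - i)) =
      fps_nth e 0 * fps_nth B n + (\<Sum>i=1..n. fps_nth e i * fps_nth B (n - i))"
      by (simp add: sum.atLeast_Suc_atMost)
    finally have "(1 - fps_nth e 0) * fps_nth B n = fps_nth 1 n + (\<Sum>i=1..n. fps_nth e i * fps_nth B (n - i))"
      by (simp add: algebra_simps)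
    also have "\<dots> \<ge> 0"
      using e less by (intro add_nonneg_nonneg sum_nonneg mult_nonneg_nonneg) (auto simp: fps_one_nth)
    finally show ?case using e0 by (simp add: zero_le_mult_iff)
  qed
  have "(\<Sum>k\<le>n. fps_nth B k * \<rho> ^ k) \<le> 2" for n
  proof -
    define s where "s = (\<Sum>k\<le>n. fps_nth B k * \<rho> ^ k)"
    have "s \<ge> 0" unfolding s_def using nonneg assms by (intro sum_nonneg) auto
    have "s = (\<Sum>k\<le>n. (fps_nth 1 k + fps_nth (e * B) k) * \<rho> ^ k)"
      unfolding s_def by (subst BB) simp
    also have "\<dots> = (\<Sum>k\<le>n. fps_nth 1 k * \<rho> ^ k) + (\<Sum>k\<le>n. fps_nth (e * B) k * \<rho> ^ k)"
      by (simp add: distrib_right sum.distrib)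
    also have "\<dots> \<le> 1 + (\<Sum>k\<le>n. fps_nth e k * \<rho> ^ k) * s"
      unfolding s_def
      using fps_norm_leD(4)[OF fps_norm_le_const[of 1 \<rho>]] assms e nonneg
      by (intro add_mono fps_mult_partial_sum_le) auto
    also have "\<dots> \<le> 1 + (1/2) * s"
      using fps_norm_leD(4)[OF assms(2,1)] \<open>s \<ge> 0\<close> by (intro add_left_mono mult_right_mono) auto
    finally show ?thesis unfolding s_def by simp
  qed
  then show ?thesis using nonneg unfolding fps_norm_le_def B_def by auto
qed

text \<open>The hypotheses say that e majorises h / h0 - 1. The series b = 1 / (|h0| (1 - e))
  satisfies b' = b b |h0| e', which mirrors (1 / h)' = - (1 / h) (1 / h) h', so the induction on the
  order closes by the product rule for majorants.\<close>

lemma maj_inverse: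
  fixes e :: "real fps"
  assumes "coord_open I Q" "h0 \<noteq> 0" "fps_nth e 0 < 1" "\<And>x. x \<in> Q \<Longrightarrow> \<bar>h x - h0\<bar> \<le> \<bar>h0\<bar> * fps_nth e 0"
    "\<And>n i. i \<in> I \<Longrightarrow> maj I Q n (fps_const \<bar>h0\<bar> * fps_deriv e) (pd i h)"
    "\<And>x i. x \<in> Q \<Longrightarrow> i \<in> I \<Longrightarrow> has_pd i h (pd i h x) x"
  shows "maj I Q n (fps_const (1 / \<bar>h0\<bar>) * inverse (1 - e)) (\<lambda>x. 1 / h x)"
proof -
  define b where "b = fps_const (1 / \<bar>h0\<bar>) * inverse (1 - e)"
  have ne: "fps_nth (1 - e) 0 \<noteq> 0" using assms(3) by simp
  have "fps_deriv b = fps_const (1 / \<bar>h0\<bar>) * (fps_deriv e * (inverse (1 - e))\<^sup>2)"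
    unfolding b_def by (simp add: fps_inverse_deriv[OF ne])
  also have "\<dots> = (fps_const (1 / \<bar>h0\<bar>) * fps_const \<bar>h0\<bar>) *
      (fps_const (1 / \<bar>h0\<bar>) * (fps_deriv e * (inverse (1 - e))\<^sup>2))"
    using assms(2) by simp
  also have "\<dots> = b * b * (fps_const \<bar>h0\<bar> * fps_deriv e)"
    unfolding b_def power2_eq_square by (simp only: mult_ac)
  finally have db: "fps_deriv b = b * b * (fps_const \<bar>h0\<bar> * fps_deriv e)" .
  have hpos: "\<bar>h x\<bar> \<ge> \<bar>h0\<bar> * (1 - fps_nth e 0)" if "x \<in> Q" for x
    using assms(4)[OF that] by (simp add: algebra_simps abs_if split: if_splits)
  have pos: "\<bar>h0\<bar> * (1 - fps_nth e 0) > 0" using assms(2,3) by simp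
  have hne: "h x \<noteq> 0" if "x \<in> Q" for x using hpos[OF that] pos by auto
  have bound: "\<bar>1 / h x\<bar> \<le> fps_nth b 0" if "x \<in> Q" for x
  proof -
    have "\<bar>1 / h x\<bar> = 1 / \<bar>h x\<bar>" by simp
    also have "\<dots> \<le> 1 / (\<bar>h0\<bar> * (1 - fps_nth e 0))"
      using hpos[OF that] pos by (intro divide_left_mono) auto
    finally show ?thesis by (simp add: b_def fps_inverse_nth_0 divide_simps)
  qed
  have H: "has_pd i (\<lambda>x. 1 / h x) (- (1 / h x * (1 / h x) * pd i h x)) x" if "x \<in> Q" "i \<in> I" for x i
    using assms(6)[OF that] hne[OF that(1)]
    by (auto intro!: derivative_eq_intros simp: power2_eq_square divide_simps)
  have "maj I Q n b (\<lambda>x. 1 / h x)" for n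
  proof (induction n)
    case 0
    then show ?case using bound by simp
  next
    case (Suc n)
    have "maj I Q n (fps_deriv b) (pd i (\<lambda>x. 1 / h x))" if i: "i \<in> I" for i
    proof (rule maj_cong[OF assms(1)])
      have "maj I Q n (fps_const \<bar>-1\<bar> * (b * b * (fps_const \<bar>h0\<bar> * fps_deriv e)))
        (\<lambda>x. -1 * (1 / h x * (1 / h x) * pd i h x))"
        by (intro maj_mult assms(1) Suc.IH assms(5) i maj_const)
      then show "maj I Q n (fps_deriv b) (\<lambda>x. -1 * (1 / h x * (1 / h x) * pd i h x))"
        by (simp add: db)
    qed (simp add: has_pd_imp_pd[OF H[OF _ i]])
    then show ?case using bound H by (auto simp: has_pd_imp_pd[OF H])
  qed
  then show ?thesis unfolding b_def .
qed

text \<open>Shrinking the cube controls the oscillation of h, and shrinking the radius of the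
  majorant controls its higher coefficients. The oscillation bound is handed on so that h keeps its
  sign on the same cube.\<close>

lemma anl_inverse:
  assumes "finite I" "anl I z r h" "h z \<noteq> 0"
  obtains s where "0 < s" "s \<le> r" "anl I z s (\<lambda>x. 1 / h x)" "\<And>x. x \<in> cube I z s \<Longrightarrow> \<bar>h x - h z\<bar> \<le> \<bar>h z\<bar> / 4"
proof -
  from assms(2) obtain \<rho> c a where F: "r > 0" "\<rho> > 0" "fps_norm_le \<rho> c a" "\<And>n. maj I (cube I z r) n a h"
    by (rule anlE) blast
  note A = fps_norm_leD[OF F(3,2)]
  define h0 where "h0 = \<bar>h z\<bar>"
  have h0: "h0 > 0" using assms(3) by (simp add: h0_def)
  obtain s where s: "0 < s" "s \<le> r" "\<And>x. x \<in> cube I z s \<Longrightarrow> \<bar>h x - h z\<bar> \<le> h0 / 4"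
    by (rule anl_small_oscillation[OF assms(1,2), of "h0 / 4"]) (use h0 in auto)
  \<comment> \<open>Chosen so that \<sigma>^k \<le> \<rho>^k h0 / (4 (c + 1)) for k \<ge> 1; the
    coefficients of a / h0 of positive degree then total at most 1/4.\<close>
  define \<sigma> where "\<sigma> = min \<rho> (\<rho> * h0 / (4 * (c + 1)))"
  have \<sigma>: "\<sigma> > 0" "\<sigma> \<le> \<rho>" using F(2) h0 A(3) by (auto simp: \<sigma>_def)
  \<comment> \<open>The constant term is the relative oscillation 1/4 of h on the smaller cube. The
    constant term of a bounds h itself and divided by h0 would be at least 1. The norm is then at
    most 1/4 + 1/4, as the inversion requires.\<close>
  define e where "e = Abs_fps (\<lambda>k. if k = 0 then 1/4 else fps_nth a k / h0)"
  have en: "fps_norm_le \<sigma> (1/2) e"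
    unfolding fps_norm_le_def
  proof (intro conjI allI)
    fix n
    show "fps_nth e n \<ge> 0" using A(1) h0 by (simp add: e_def)
    have "(\<Sum>k\<le>n. fps_nth e k * \<sigma> ^ k) = 1/4 + (\<Sum>k\<in>{..n}-{0}. fps_nth e k * \<sigma> ^ k)"
      by (subst sum.remove[of _ 0]) (auto simp: e_def)
    also have "(\<Sum>k\<in>{..n}-{0}. fps_nth e k * \<sigma> ^ k) \<le> (\<Sum>k\<in>{..n}-{0}. fps_nth a k * \<rho> ^ k * (1 / (4 * (c + 1))))"
    proof (intro sum_mono)
      fix k assume "k \<in> {..n}-{0}"
      then have k: "k > 0" by auto
      have "\<sigma> ^ k = \<sigma> * \<sigma> ^ (k - 1)" using k by (simp flip: power_Suc)
      also have "\<dots> \<le> (\<rho> * h0 / (4 * (c + 1))) * \<rho> ^ (k - 1)"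
        using \<sigma> by (intro mult_mono power_mono) (auto simp: \<sigma>_def)
      also have "\<dots> = \<rho> ^ k * (h0 / (4 * (c + 1)))" using k by (cases k) auto
      finally have "fps_nth a k / h0 * \<sigma> ^ k \<le> fps_nth a k / h0 * (\<rho> ^ k * (h0 / (4 * (c + 1))))"
        using A(1) h0 by (intro mult_left_mono) auto
      then show "fps_nth e k * \<sigma> ^ k \<le> fps_nth a k * \<rho> ^ k * (1 / (4 * (c + 1)))"
        using k h0 by (simp add: e_def)
    qed
    also have "\<dots> \<le> (\<Sum>k\<le>n. fps_nth a k * \<rho> ^ k) * (1 / (4 * (c + 1)))"
      unfolding sum_distrib_right[symmetric]
      using A(1,3) F(2) by (intro mult_right_mono sum_mono2) auto
    also have "\<dots> \<le> c * (1 / (4 * (c + 1)))"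
      using A(3,4) by (intro mult_right_mono) auto
    also have "\<dots> \<le> 1/4" using A(3) by (simp add: divide_simps)
    finally show "(\<Sum>k\<le>n. fps_nth e k * \<sigma> ^ k) \<le> 1/2" by simp
  qed
  have d: "fps_const h0 * fps_deriv e = fps_deriv a" using h0 by (auto simp: e_def fps_eq_iff)
  have sub: "cube I z s \<subseteq> cube I z r" using s by (intro cube_mono)
  have "anl I z s (\<lambda>x. 1 / h x)"
  proof (rule anlI)
    show "fps_norm_le \<sigma> (1 / h0 * 2) (fps_const (1 / h0) * inverse (1 - e))"
      by (intro fps_norm_le_mult \<sigma> fps_norm_le_const fps_norm_le_inverse en) (use h0 in auto)
    show "maj I (cube I z s) n (fps_const (1 / h0) * inverse (1 - e)) (\<lambda>x. 1 / h x)" for n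
      unfolding h0_def
    proof (rule maj_inverse)
      show "\<bar>h x - h z\<bar> \<le> \<bar>h z\<bar> * fps_nth e 0" if "x \<in> cube I z s" for x
        using s(3)[OF that] by (simp add: e_def h0_def)
      show "maj I (cube I z s) n (fps_const \<bar>h z\<bar> * fps_deriv e) (pd i h)" if "i \<in> I" for n i
        using F(4)[of "Suc n"] that d maj_subset[OF sub subset_refl] by (auto simp: h0_def)
      show "has_pd i h (pd i h x) x" if "x \<in> cube I z s" "i \<in> I" for x i
        using F(4)[of 1] that sub by auto
    qed (use assms in \<open>auto simp: e_def\<close>)
  qed (use s \<sigma> in auto)
  then show ?thesis using that s h0_def by blast
qed

section \<open>Vanishing of all derivatives at a point\<close>

lemma fps_nth_funpow_deriv:
  "fps_nth ((fps_deriv ^^ k) (a :: real fps)) m = fact (m + k) / fact m * fps_nth a (m + k)"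
proof (induction k arbitrary: m)
  case (Suc k)
  show ?case by (simp add: Suc.IH del: of_nat_Suc)
qed auto

lemma maj_fold_pd:
  assumes "\<And>n. maj I Q n a F" "set w \<subseteq> I"
  shows "maj I Q n ((fps_deriv ^^ length w) a) (fold pd w F)"
  using assms
proof (induction w arbitrary: a F)
  case (Cons i w)
  have "maj I Q n ((fps_deriv ^^ length w) (fps_deriv a)) (fold pd w (pd i F))"
    by (rule Cons.IH) (use Cons.prems(1)[of "Suc _"] Cons.prems(2) in auto)
  then show ?case by (simp add: funpow_swap1)
qed auto

lemma maj_fold_pd_bound:
  assumes "\<And>n. maj I Q n a F" "set w \<subseteq> I" "x \<in> Q"
  shows "\<bar>fold pd w F x\<bar> \<le> fact (length w) * fps_nth a (length w)"
  using maj_bound[OF maj_fold_pd[OF assms(1,2)] assms(3)] by (simp add: fps_nth_funpow_deriv)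

text \<open>Induction on the set of coordinates in which x may differ from z, for all derivative
  words at once: the Taylor expansion along the coordinate j, started where x j is replaced by z j,
  involves the words \<open>w @ replicate m j\<close>, which vanish there by the induction
  hypothesis. Only the remainder is left, and it tends to 0.\<close>

lemma flat_analytic_zero:
  assumes "finite I" "anl I z r F" "\<And>w. set w \<subseteq> I \<Longrightarrow> fold pd w F z = 0"
  obtains s where "s > 0" "s \<le> r" "\<And>x. x \<in> cube I z s \<Longrightarrow> F x = 0"
proof -
  from assms(2) obtain \<rho> c a where F: "r > 0" "\<rho> > 0" "fps_norm_le \<rho> c a" "\<And>n. maj I (cube I z r) n a F"
    by (rule anlE) blast
  note A = fps_norm_leD[OF F(3,2)]
  \<comment> \<open>Half the radius pays for the binomial coefficient in the Taylor remainder, which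
    is at most 2^(l + n).\<close>
  define s where "s = min r (\<rho> / 2)"
  have s: "s > 0" "s \<le> r" "s \<le> \<rho> / 2" using F by (auto simp: s_def)
  have sub: "cube I z s \<subseteq> cube I z r" using s by (intro cube_mono)
  have "fold pd w F x = 0" if "J \<subseteq> I" "set w \<subseteq> I" "x \<in> cube I z s" "\<And>i. i \<notin> J \<Longrightarrow> x i = z i" for J w x
    using finite_subset[OF that(1) assms(1)] that
  proof (induction J arbitrary: w x rule: finite_induct)
    case empty
    then have "x = z" by auto
    then show ?case using assms(3) empty by simp
  next
    case (insert j J)
    have j: "j \<in> I" using insert by auto
    define l where "l = length w"
    define u where "u m t = fold pd (w @ replicate m j) F (x(j := t))" for m t
    have xj: "\<bar>x j - z j\<bar> < s" using insert.prems(3) j by (auto simp: cube_def)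
    have inC: "x(j := t) \<in> cube I z s" if "\<bar>t - z j\<bar> < s" for t
      using insert.prems(3) j that by (rule fun_upd_in_cube)
    have u0: "u m (z j) = 0" for m
      unfolding u_def
    proof (rule insert.IH)
      show "x(j := z j) \<in> cube I z s" using inC[of "z j"] s by simp
    qed (use insert.prems in auto)
    have du: "DERIV (u m) t :> u (Suc m) t" if "\<bar>t - z j\<bar> < s" for m t
    proof -
      have "anl I z r (fold pd (w @ replicate m j) F)"
        by (rule anl_fold_pd[OF assms(2)]) (use insert.prems j in auto)
      from anl_has_pd[OF this j] have "DERIV (u m) t :> pd j (fold pd (w @ replicate m j) F) (x(j := t))"
        unfolding u_def using inC[OF that] sub by blast
      moreover have "fold pd (w @ replicate (Suc m) j) F = pd j (fold pd (w @ replicate m j) F)"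
        by (simp add: funpow_swap1)
      ultimately show ?thesis unfolding u_def[of "Suc m"] by metis
    qed
    have bu: "\<bar>u m t\<bar> \<le> fact (l + m) * (c / \<rho> ^ (l + m))" if "\<bar>t - z j\<bar> < s" for m t
    proof -
      have "\<bar>u m t\<bar> \<le> fact (l + m) * fps_nth a (l + m)"
      proof -
        have "set (w @ replicate m j) \<subseteq> I" using insert.prems j by auto
        moreover have "x(j := t) \<in> cube I z r" using inC[OF that] sub by blast
        ultimately show ?thesis
          using maj_fold_pd_bound[OF F(4)] by (metis u_def l_def length_append length_replicate)
      qed
      also have "\<dots> \<le> fact (l + m) * (c / \<rho> ^ (l + m))"
        using A(2)[of "l + m"] F(2) by (intro mult_left_mono) (auto simp: pos_le_divide_eq)
      finally show ?thesis .
    qed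
    define q where "q = 2 * \<bar>x j - z j\<bar> / \<rho>"
    have q: "0 \<le> q" "q < 1" using xj s F(2) by (auto simp: q_def)
    have est: "\<bar>u 0 (x j)\<bar> \<le> (c * fact l * 2 ^ l / \<rho> ^ l) * q ^ n" if n: "n > 0" for n
    proof (cases "x j = z j")
      case True
      have "0 \<le> (c * fact l * 2 ^ l / \<rho> ^ l) * q ^ n" using A(3) F(2) q by simp
      then show ?thesis using u0[of 0] True by simp
    next
      case False
      have "\<exists>t. (if x j < z j then x j < t \<and> t < z j else z j < t \<and> t < x j) \<and>
        u 0 (x j) = (\<Sum>m<n. (u m (z j) / fact m) * (x j - z j) ^ m) + (u n t / fact n) * (x j - z j) ^ n"
      proof (rule Taylor[OF n refl, of "min (x j) (z j)" "max (x j) (z j)"])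
        show "\<forall>m t. m < n \<and> min (x j) (z j) \<le> t \<and> t \<le> max (x j) (z j) \<longrightarrow> (u m has_real_derivative u (Suc m) t) (at t)"
          using xj by (auto intro!: du)
      qed (use False in auto)
      then obtain t where t: "if x j < z j then x j < t \<and> t < z j else z j < t \<and> t < x j"
        "u 0 (x j) = (u n t / fact n) * (x j - z j) ^ n"
        unfolding u0 by auto
      have "\<bar>t - z j\<bar> < s" using t(1) xj by (auto split: if_splits)
      have "\<bar>u n t / fact n\<bar> \<le> fact (l + n) * (c / \<rho> ^ (l + n)) / fact n"
        using divide_right_mono[OF bu[OF \<open>\<bar>t - z j\<bar> < s\<close>, of n], of "fact n"] by simp
      also have "\<dots> = fact (l + n) / fact n * (c / \<rho> ^ (l + n))" by simp
      also have "fact (l + n) / fact n = (fact l * real ((l + n) choose l))"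
        by (simp add: binomial_fact)
      also have "\<dots> * (c / \<rho> ^ (l + n)) \<le> (fact l * 2 ^ (l + n)) * (c / \<rho> ^ (l + n))"
      proof (intro mult_right_mono mult_left_mono)
        have "(l + n) choose l \<le> 2 ^ (l + n)" by (rule binomial_le_pow2)
        then show "real ((l + n) choose l) \<le> 2 ^ (l + n)" by (metis of_nat_le_iff of_nat_numeral of_nat_power)
      qed (use A(3) F(2) in auto)
      finally have "\<bar>u n t / fact n\<bar> * \<bar>x j - z j\<bar> ^ n \<le> (fact l * 2 ^ (l + n)) * (c / \<rho> ^ (l + n)) * \<bar>x j - z j\<bar> ^ n"
        by (intro mult_right_mono) auto
      also have "\<dots> = (c * fact l * 2 ^ l / \<rho> ^ l) * q ^ n"
        by (simp add: q_def power_mult_distrib power_divide power_add)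
      finally show ?thesis by (simp add: t(2) abs_mult power_abs)
    qed
    have "(\<lambda>n. (c * fact l * 2 ^ l / \<rho> ^ l) * q ^ n) \<longlonglongrightarrow> (c * fact l * 2 ^ l / \<rho> ^ l) * 0"
      using q by (intro tendsto_intros LIMSEQ_power_zero) auto
    then have "\<bar>u 0 (x j)\<bar> \<le> (c * fact l * 2 ^ l / \<rho> ^ l) * 0"
      by (rule LIMSEQ_le_const) (use est in \<open>auto intro!: exI[of _ 1]\<close>)
    then show ?case by (simp add: u_def)
  qed
  from this[of I "[]"] have "F x = 0" if "x \<in> cube I z s" for x
    using that by (auto simp: cube_def)
  then show ?thesis using that s by blast
qed

text \<open>Either all derivatives at z vanish, or a word can be lengthened letter by letter up to
  the first nonzero derivative. In the latter case z lies on a smooth hypersurface, given by a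
  function G = \<open>fold pd w F\<close> with a nonzero partial derivative at z. Only countably
  many G arise in this way, whatever z is.\<close>

lemma anl_zero_or_word:
  assumes "finite I" "anl I z r F" "F z = 0"
  shows "(\<exists>s>0. s \<le> r \<and> (\<forall>x\<in>cube I z s. F x = 0)) \<or>
    (\<exists>w j. set w \<subseteq> I \<and> j \<in> I \<and> fold pd w F z = 0 \<and> pd j (fold pd w F) z \<noteq> 0)"
proof (rule disjCI)
  assume *: "\<not> (\<exists>w j. set w \<subseteq> I \<and> j \<in> I \<and> fold pd w F z = 0 \<and> pd j (fold pd w F) z \<noteq> 0)"
  have "fold pd w F z = 0" if "set w \<subseteq> I" for w
    using that
  proof (induction w rule: rev_induct)
    case (snoc j w)
    then have "pd j (fold pd w F) z = 0" using * by (metis append.simps(1) le_sup_iff list.set_intros(1) set_append subsetD)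
    then show ?case by simp
  qed (use assms(3) in simp)
  then obtain s where "s > 0" "s \<le> r" "\<And>x. x \<in> cube I z s \<Longrightarrow> F x = 0"
    using flat_analytic_zero[OF assms(1,2)] by blast
  then show "\<exists>s>0. s \<le> r \<and> (\<forall>x\<in>cube I z s. F x = 0)" by blast
qed

section \<open>Elimination of a variable\<close>

lemma quadratic_error_imp_DERIV:
  fixes f :: "real \<Rightarrow> real"
  assumes "\<forall>\<^sub>F s in nhds t. \<bar>f s - f t - D * (s - t)\<bar> \<le> K * (s - t)\<^sup>2"
  shows "(f has_real_derivative D) (at t)"
proof -
  have aux: "K * d\<^sup>2 / \<bar>d\<bar> = K * \<bar>d\<bar>" if "d \<noteq> 0" for d
    using that by (cases "d > 0") (simp_all add: power2_eq_square)
  have "((\<lambda>s. (f s - f t) / (s - t) - D) \<longlongrightarrow> 0) (at t)"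
  proof (rule tendsto_rabs_zero_cancel, rule tendsto_sandwich[of "\<lambda>_. 0" _ _ "\<lambda>s. K * \<bar>s - t\<bar>"])
    show "\<forall>\<^sub>F s in at t. \<bar>(f s - f t) / (s - t) - D\<bar> \<le> K * \<bar>s - t\<bar>"
      unfolding eventually_at_filter using assms
    proof eventually_elim
      case (elim s)
      show ?case
      proof (intro impI)
        assume "s \<noteq> t"
        then have "(f s - f t) / (s - t) - D = (f s - f t - D * (s - t)) / (s - t)"
          by (simp add: diff_divide_distrib)
        then have "\<bar>(f s - f t) / (s - t) - D\<bar> = \<bar>f s - f t - D * (s - t)\<bar> / \<bar>s - t\<bar>"
          by (simp add: abs_divide)
        also have "\<dots> \<le> K * (s - t)\<^sup>2 / \<bar>s - t\<bar>"
          using elim by (intro divide_right_mono) auto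
        also have "\<dots> = K * \<bar>s - t\<bar>"
          by (rule aux) (use \<open>s \<noteq> t\<close> in simp)
        finally show "\<bar>(f s - f t) / (s - t) - D\<bar> \<le> K * \<bar>s - t\<bar>" .
      qed
    qed
    have "((\<lambda>s. K * \<bar>s - t\<bar>) \<longlongrightarrow> K * \<bar>t - t\<bar>) (at t)" by (intro tendsto_intros)
    then show "((\<lambda>s. K * \<bar>s - t\<bar>) \<longlongrightarrow> 0) (at t)" by simp
  qed auto
  then have "((\<lambda>s. (f s - f t) / (s - t)) \<longlongrightarrow> D) (at t)"
    by (simp add: Lim_null[of _ D])
  then show ?thesis by (simp add: has_field_derivative_iff)
qed

text \<open>Along the solution of an implicit equation the coordinates i and j move together, so two
  partial derivatives have to be combined with a quadratic error. The mean value theorem is applied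
  along i and then along j; second derivatives bound the change of the coefficients.\<close>

lemma anl_two_variable_taylor:
  assumes "anl I z r F" "i \<in> I" "j \<in> I" "i \<noteq> j"
  obtains K where "K \<ge> 0" "\<And>x s t. x \<in> cube I z r \<Longrightarrow> \<bar>s - z i\<bar> < r \<Longrightarrow> \<bar>t - z j\<bar> < r \<Longrightarrow>
    \<bar>F (x(i := s, j := t)) - F x - pd i F x * (s - x i) - pd j F x * (t - x j)\<bar> \<le> K * (\<bar>s - x i\<bar> + \<bar>t - x j\<bar>)\<^sup>2"
proof -
  from assms(1) obtain \<rho> c a where F: "r > 0" "\<rho> > 0" "fps_norm_le \<rho> c a" "\<And>n. maj I (cube I z r) n a F"
    by (rule anlE) blast
  \<comment> \<open>The value at 0 of the second derivative of a.\<close>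
  define M where "M = 2 * fps_nth a 2"
  have M: "M \<ge> 0" using F(3) by (auto simp: M_def fps_norm_le_def)
  have pdb: "\<bar>pd k F (x(l := s)) - pd k F (x(l := t))\<bar> \<le> M * \<bar>s - t\<bar>"
    if "k \<in> I" "l \<in> I" "x(l := s) \<in> cube I z r" "x(l := t) \<in> cube I z r" for k l x s t
  proof -
    have "maj I (cube I z r) (Suc 0) (fps_deriv a) (pd k F)" using F(4)[of "Suc (Suc 0)"] that by auto
    from maj_line_bound[OF this that(2-4)] show ?thesis by (simp add: M_def numeral_2_eq_2)
  qed
  have line: "\<exists>\<xi>. \<bar>\<xi> - x k\<bar> \<le> \<bar>s - x k\<bar> \<and> \<bar>\<xi> - z k\<bar> < r \<and> F (x(k := s)) - F x = pd k F (x(k := \<xi>)) * (s - x k)"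
    if "k \<in> I" "x \<in> cube I z r" "\<bar>s - z k\<bar> < r" for k x s
  proof -
    have xk: "\<bar>x k - z k\<bar> < r" using that by (auto simp: cube_def)
    have D: "((\<lambda>s. F (x(k := s))) has_real_derivative pd k F (x(k := t))) (at t)" if "\<bar>t - z k\<bar> < r" for t
      using anl_has_pd[OF assms(1) \<open>k \<in> I\<close> fun_upd_in_cube[OF \<open>x \<in> _\<close> \<open>k \<in> I\<close> that]] .
    consider "s = x k" | "s < x k" | "x k < s" by linarith
    then show ?thesis
    proof cases
      case 1
      then show ?thesis using xk by (intro exI[of _ s]) auto
    next
      case 2
      have "\<exists>\<xi>>s. \<xi> < x k \<and> F (x(k := x k)) - F (x(k := s)) = (x k - s) * pd k F (x(k := \<xi>))"
      proof (rule MVT2[OF 2])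
        fix t assume "s \<le> t" "t \<le> x k"
        then show "((\<lambda>s. F (x(k := s))) has_real_derivative pd k F (x(k := t))) (at t)"
          by (intro D) (use xk that in linarith)
      qed
      then obtain \<xi> where \<xi>: "s < \<xi>" "\<xi> < x k" "F x - F (x(k := s)) = (x k - s) * pd k F (x(k := \<xi>))"
        by auto
      show ?thesis by (rule exI[of _ \<xi>]) (use \<xi> xk that in \<open>auto simp: algebra_simps\<close>)
    next
      case 3
      have "\<exists>\<xi>>x k. \<xi> < s \<and> F (x(k := s)) - F (x(k := x k)) = (s - x k) * pd k F (x(k := \<xi>))"
      proof (rule MVT2[OF 3])
        fix t assume "x k \<le> t" "t \<le> s"
        then show "((\<lambda>s. F (x(k := s))) has_real_derivative pd k F (x(k := t))) (at t)"
          by (intro D) (use xk that in linarith)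
      qed
      then obtain \<xi> where \<xi>: "x k < \<xi>" "\<xi> < s" "F (x(k := s)) - F x = (s - x k) * pd k F (x(k := \<xi>))"
        by auto
      show ?thesis by (rule exI[of _ \<xi>]) (use \<xi> xk that in \<open>auto simp: algebra_simps\<close>)
    qed
  qed
  show ?thesis
  proof (rule that[of "3 * M"])
    fix x s t assume x: "x \<in> cube I z r" and s: "\<bar>s - z i\<bar> < r" and t: "\<bar>t - z j\<bar> < r"
    define x' where "x' = x(i := s)"
    have x': "x' \<in> cube I z r" unfolding x'_def using x assms(2) s by (rule fun_upd_in_cube)
    have x'j: "x' j = x j" using assms(4) by (simp add: x'_def)
    define u v where "u = \<bar>s - x i\<bar>" and "v = \<bar>t - x j\<bar>"
    obtain \<xi> where \<xi>: "\<bar>\<xi> - x i\<bar> \<le> u" "\<bar>\<xi> - z i\<bar> < r" "F x' - F x = pd i F (x(i := \<xi>)) * (s - x i)"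
      using line[OF assms(2) x s] unfolding x'_def u_def by blast
    obtain \<eta> where \<eta>: "\<bar>\<eta> - x j\<bar> \<le> v" "\<bar>\<eta> - z j\<bar> < r" "F (x'(j := t)) - F x' = pd j F (x'(j := \<eta>)) * (t - x j)"
      using line[OF assms(3) x' t] unfolding v_def x'j by blast
    have 1: "\<bar>pd i F (x(i := \<xi>)) - pd i F x\<bar> \<le> M * u"
    proof -
      have "\<bar>pd i F (x(i := \<xi>)) - pd i F (x(i := x i))\<bar> \<le> M * \<bar>\<xi> - x i\<bar>"
        by (rule pdb[OF assms(2,2) fun_upd_in_cube[OF x assms(2) \<xi>(2)]]) (use x in simp)
      also have "\<dots> \<le> M * u" using \<xi>(1) M by (intro mult_left_mono) auto
      finally show ?thesis by simp
    qed
    have 2: "\<bar>pd j F (x'(j := \<eta>)) - pd j F x\<bar> \<le> M * v + M * u"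
    proof -
      have "\<bar>pd j F (x'(j := \<eta>)) - pd j F (x'(j := x' j))\<bar> \<le> M * \<bar>\<eta> - x' j\<bar>"
        by (rule pdb[OF assms(3,3) fun_upd_in_cube[OF x' assms(3) \<eta>(2)]]) (use x' in simp)
      also have "\<dots> \<le> M * v" using \<eta>(1) M x'j by (intro mult_left_mono) auto
      finally have "\<bar>pd j F (x'(j := \<eta>)) - pd j F x'\<bar> \<le> M * v" by simp
      moreover have "\<bar>pd j F (x(i := s)) - pd j F (x(i := x i))\<bar> \<le> M * \<bar>s - x i\<bar>"
        by (rule pdb[OF assms(3,2)]) (use x x' in \<open>simp_all add: x'_def\<close>)
      ultimately show ?thesis by (simp add: x'_def u_def)
    qed
    have "F (x'(j := t)) - F x - pd i F x * (s - x i) - pd j F x * (t - x j) =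
      (pd i F (x(i := \<xi>)) - pd i F x) * (s - x i) + (pd j F (x'(j := \<eta>)) - pd j F x) * (t - x j)"
      using \<xi>(3) \<eta>(3) by (simp add: algebra_simps)
    also have "\<bar>\<dots>\<bar> \<le> (M * u) * u + (M * v + M * u) * v"
      unfolding u_def[symmetric] v_def[symmetric]
      by (rule order_trans[OF abs_triangle_ineq], unfold abs_mult u_def[symmetric] v_def[symmetric],
          intro add_mono mult_right_mono 1 2) (auto simp: u_def v_def)
    also have "\<dots> = M * (u * u + v * v + u * v)" by (simp add: algebra_simps)
    also have "\<dots> \<le> M * (3 * (u + v)\<^sup>2)"
    proof (intro mult_left_mono M)
      have "u * v \<ge> 0" by (simp add: u_def v_def)
      then have "u * u + v * v + u * v \<le> (u + v)\<^sup>2" by (simp add: power2_eq_square algebra_simps)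
      also have "\<dots> \<le> 3 * (u + v)\<^sup>2" by simp
      finally show "u * u + v * v + u * v \<le> 3 * (u + v)\<^sup>2" .
    qed
    finally show "\<bar>F (x(i := s, j := t)) - F x - pd i F x * (s - x i) - pd j F x * (t - x j)\<bar>
      \<le> 3 * M * (\<bar>s - x i\<bar> + \<bar>t - x j\<bar>)\<^sup>2"
      by (simp add: x'_def u_def v_def)
  qed (use M in simp)
qed

text \<open>
  Each of the \<open>k\<close> differentiations gives up \<open>\<rho> / 2k\<close> of the radius, and \<open>k\<^sup>k \<le> e\<^sup>k k!\<close>.
\<close>

lemma fps_norm_le_iterate:
  fixes \<beta> a :: "real fps"
  defines "T \<equiv> \<lambda>a. \<beta> * fps_deriv a"
  assumes "\<rho> > 0" "fps_norm_le \<rho> B \<beta>" "fps_norm_le \<rho> c a"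
  shows "fps_nth ((T ^^ k) a) 0 \<ge> 0" "fps_nth ((T ^^ k) a) 0 \<le> c * (2 * B * exp 1 / \<rho>) ^ k * fact k"
proof -
  have B: "B \<ge> 0" using fps_norm_leD(3)[OF assms(3,2)] .
  have c: "c \<ge> 0" using fps_norm_leD(3)[OF assms(4,2)] .
  have *: "fps_norm_le (\<rho> - real m * (\<rho> / (2 * real k))) (c * (B / (\<rho> / (2 * real k))) ^ m) ((T ^^ m) a)"
    if "m \<le> k" "k > 0" for m
    using that
  proof (induction m)
    case 0
    then show ?case using assms by simp
  next
    case (Suc m)
    define \<epsilon> where "\<epsilon> = \<rho> / (2 * real k)"
    have \<epsilon>: "\<epsilon> > 0" using assms(2) Suc.prems by (simp add: \<epsilon>_def)
    have "real (Suc m) * \<epsilon> \<le> real k * \<epsilon>" using Suc.prems \<epsilon> by (intro mult_right_mono) auto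
    also have "\<dots> = \<rho> / 2" using Suc.prems by (simp add: \<epsilon>_def)
    finally have pos: "\<rho> - real (Suc m) * \<epsilon> > 0" using assms(2) by simp
    have "fps_norm_le (\<rho> - real (Suc m) * \<epsilon>) (c * (B / \<epsilon>) ^ m / ((\<rho> - real m * \<epsilon>) - (\<rho> - real (Suc m) * \<epsilon>))) (fps_deriv ((T ^^ m) a))"
    proof (rule fps_norm_le_deriv)
      show "fps_norm_le (\<rho> - real m * \<epsilon>) (c * (B / \<epsilon>) ^ m) ((T ^^ m) a)"
        using Suc unfolding \<epsilon>_def by simp
      show "\<rho> - real (Suc m) * \<epsilon> < \<rho> - real m * \<epsilon>" using \<epsilon> by (simp add: distrib_right)
    qed (rule pos)
    then have "fps_norm_le (\<rho> - real (Suc m) * \<epsilon>) (c * (B / \<epsilon>) ^ m / \<epsilon>) (fps_deriv ((T ^^ m) a))"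
      by (simp add: algebra_simps)
    moreover have "fps_norm_le (\<rho> - real (Suc m) * \<epsilon>) B \<beta>"
      by (rule fps_norm_le_mono[OF assms(3) pos]) (use \<epsilon> in auto)
    ultimately have "fps_norm_le (\<rho> - real (Suc m) * \<epsilon>) (B * (c * (B / \<epsilon>) ^ m / \<epsilon>)) (T ((T ^^ m) a))"
      unfolding T_def by (intro fps_norm_le_mult pos)
    then show ?case by (simp add: \<epsilon>_def mult_ac)
  qed
  have k: "fps_nth ((T ^^ k) a) 0 \<ge> 0 \<and> fps_nth ((T ^^ k) a) 0 \<le> c * (2 * B * exp 1 / \<rho>) ^ k * fact k"
  proof (cases "k = 0")
    case True
    then show ?thesis using fps_norm_leD(1,2)[OF assms(4,2), of 0] by simp
  next
    case False
    have n: "fps_norm_le (\<rho> / 2) (c * (B / (\<rho> / (2 * real k))) ^ k) ((T ^^ k) a)"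
      using *[of k] False by simp
    have "fps_nth ((T ^^ k) a) 0 \<le> c * (B / (\<rho> / (2 * real k))) ^ k"
      using fps_norm_leD(2)[OF n, of 0] assms(2) by simp
    also have "\<dots> = c * (2 * B / \<rho>) ^ k * real k ^ k"
      by (simp add: power_mult_distrib power_divide)
    also have "\<dots> \<le> c * (2 * B / \<rho>) ^ k * (exp 1 ^ k * fact k)"
    proof (intro mult_left_mono)
      have "summable (\<lambda>n. real k ^ n /\<^sub>R fact n)" by (rule summable_exp_generic)
      then have "(\<Sum>n\<in>{k}. real k ^ n /\<^sub>R fact n) \<le> exp (real k)"
        unfolding exp_def by (rule sum_le_suminf) auto
      then have "real k ^ k / fact k \<le> exp (real k)" by (simp add: divide_inverse mult.commute)
      moreover have "exp (real k) = exp 1 ^ k" using exp_of_nat_mult[of k "1 :: real"] by simp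
      ultimately show "real k ^ k \<le> exp 1 ^ k * fact k" by (simp add: pos_divide_le_eq)
    qed (use B c assms(2) in auto)
    also have "\<dots> = c * (2 * B * exp 1 / \<rho>) ^ k * fact k"
      by (simp add: power_mult_distrib power_divide)
    finally show ?thesis using fps_norm_leD(1)[OF n, of 0] assms(2) by simp
  qed
  show "fps_nth ((T ^^ k) a) 0 \<ge> 0" "fps_nth ((T ^^ k) a) 0 \<le> c * (2 * B * exp 1 / \<rho>) ^ k * fact k"
    using k by auto
qed

text \<open>The analytic implicit function theorem, stated for all composites F (x(j := \<psi> x)).
  A partial derivative of a composite is the composite of another function \<open>X i F\<close>;
  higher derivatives are therefore obtained by applying the vector fields \<open>X i\<close> before
  the substitution, and one operator T on series in one variable dominates them all.\<close>

lemma implicit_elimination_pos: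
  assumes fin: "finite I" and j: "j \<in> I" and g: "anl I z r g" and gz: "g z = 0" and hz: "pd j g z > 0"
  obtains \<delta> \<psi> where "\<delta> > 0" "\<delta> \<le> r"
    "\<And>x. x \<in> cube (I - {j}) z \<delta> \<Longrightarrow> x(j := \<psi> x) \<in> cube I z r"
    "\<And>x. x \<in> cube I z \<delta> \<Longrightarrow> g x = 0 \<Longrightarrow> \<psi> (x(j := z j)) = x j"
    "\<And>F. anl I z r F \<Longrightarrow> anl (I - {j}) z \<delta> (\<lambda>x. F (x(j := \<psi> x)))"
proof -
  define I' where "I' = I - {j}"
  define h where "h = pd j g"
  have h: "anl I z r h" unfolding h_def by (rule anl_pd[OF g j])
  obtain s where s: "0 < s" "s \<le> r" "anl I z s (\<lambda>x. 1 / h x)"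
      "\<And>x. x \<in> cube I z s \<Longrightarrow> \<bar>h x - h z\<bar> \<le> \<bar>h z\<bar> / 4"
    by (rule anl_inverse[OF fin h]) (use hz in \<open>auto simp: h_def\<close>)
  define \<mu> where "\<mu> = h z / 2"
  have \<mu>: "\<mu> > 0" using hz by (simp add: \<mu>_def h_def)
  have h\<mu>: "h x \<ge> \<mu>" if "x \<in> cube I z s" for x
    using s(4)[OF that] \<mu> unfolding \<mu>_def by linarith
  have gs: "anl I z s g" by (rule anl_mono[OF g s(1,2)])
  obtain L where L: "L \<ge> 0" "\<And>x y. x \<in> cube I z s \<Longrightarrow> y \<in> cube I z s \<Longrightarrow>
    \<bar>g x - g y\<bar> \<le> L * (\<Sum>i\<in>I. \<bar>x i - y i\<bar>)"
    using anl_lipschitz[OF fin gs] by blast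
  have line: "((\<lambda>t. g (x(j := t))) has_real_derivative h (x(j := t))) (at t)" if "x(j := t) \<in> cube I z s" for x t
    unfolding h_def using anl_has_pd[OF gs j that] .
  have jcube: "x(j := t) \<in> cube I z s" if "x(j := u) \<in> cube I z s" "\<bar>t - z j\<bar> < s" for x t u
    using fun_upd_in_cube[OF that(1) j that(2)] by simp
  have mono: "g (x(j := t2)) - g (x(j := t1)) \<ge> \<mu> * (t2 - t1)"
    if "x(j := t1) \<in> cube I z s" "x(j := t2) \<in> cube I z s" "t1 \<le> t2" for x t1 t2
  proof (cases "t1 = t2")
    case False
    then have "t1 < t2" using that by simp
    have b: "\<bar>t1 - z j\<bar> < s" "\<bar>t2 - z j\<bar> < s" using that j by (auto simp: cube_def dest!: bspec[of _ _ j])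
    have "\<exists>t>t1. t < t2 \<and> g (x(j := t2)) - g (x(j := t1)) = (t2 - t1) * h (x(j := t))"
    proof (rule MVT2[OF \<open>t1 < t2\<close>])
      fix t assume "t1 \<le> t" "t \<le> t2"
      then have "\<bar>t - z j\<bar> < s" using b by linarith
      then show "((\<lambda>t. g (x(j := t))) has_real_derivative h (x(j := t))) (at t)"
        by (intro line jcube[OF that(1)])
    qed
    then obtain t where t: "t > t1" "t < t2" "g (x(j := t2)) - g (x(j := t1)) = (t2 - t1) * h (x(j := t))"
      by blast
    have "\<bar>t - z j\<bar> < s" using b t by linarith
    then have "h (x(j := t)) \<ge> \<mu>" by (intro h\<mu> jcube[OF that(1)])
    then show ?thesis unfolding t(3) using \<open>t1 < t2\<close> by (simp add: mult.commute)
  qed simp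
  have mono_abs: "\<bar>g (x(j := t2)) - g (x(j := t1))\<bar> \<ge> \<mu> * \<bar>t2 - t1\<bar>"
    if "x(j := t1) \<in> cube I z s" "x(j := t2) \<in> cube I z s" for x t1 t2
    using mono[OF that] mono[OF that(2,1)] by (cases "t1 \<le> t2") auto
  define \<eta> where "\<eta> = s / 2"
  have \<eta>: "\<eta> > 0" "\<eta> < s" using s by (auto simp: \<eta>_def)
  \<comment> \<open>On this cube g differs from g z = 0 by less than \<mu> \<eta>, whereas a step
    \<eta> in the direction j changes it by at least \<mu> \<eta>; hence g changes sign on the
    segment in that direction.\<close>
  define \<delta> where "\<delta> = min \<eta> (\<mu> * \<eta> / (L * card I + 1))"
  have p: "L * card I + 1 > 0" using L(1) by (simp add: add_nonneg_pos)
  have \<delta>: "\<delta> > 0" "\<delta> \<le> \<eta>" "\<delta> < s" "L * (card I * \<delta>) < \<mu> * \<eta>"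
  proof -
    show "\<delta> > 0" "\<delta> \<le> \<eta>" using \<eta> \<mu> p by (auto simp: \<delta>_def)
    then show "\<delta> < s" using \<eta> by simp
    have "L * (card I * \<delta>) < (L * card I + 1) * \<delta>" using \<open>\<delta> > 0\<close> by (simp add: algebra_simps)
    also have "\<dots> \<le> (L * card I + 1) * (\<mu> * \<eta> / (L * card I + 1))"
      using p by (intro mult_left_mono) (auto simp: \<delta>_def)
    also have "\<dots> = \<mu> * \<eta>" using p by simp
    finally show "L * (card I * \<delta>) < \<mu> * \<eta>" .
  qed
  have inI: "x \<in> cube I z \<delta>" if "x \<in> cube I' z \<delta>" for x
    using that \<delta>(1) by (auto simp: cube_def I'_def)
  have inS: "x(j := t) \<in> cube I z s" if "x \<in> cube I' z \<delta>" "\<bar>t - z j\<bar> < s" for x t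
    using fun_upd_in_cube[of x I z s j t] j that(2) inI[OF that(1)] cube_mono[of \<delta> s I z] \<delta>(3) by auto
  have ex: "\<exists>t. \<bar>t - z j\<bar> \<le> \<eta> \<and> g (x(j := t)) = 0" if x: "x \<in> cube I' z \<delta>" for x
  proof -
    have xS: "x \<in> cube I z s" using inI[OF x] cube_mono[of \<delta> s I z] \<delta>(3) by auto
    have xj: "x(j := z j) = x" using x by (auto simp: cube_def I'_def)
    have "\<bar>g x - g z\<bar> \<le> L * (\<Sum>i\<in>I. \<bar>x i - z i\<bar>)"
      using xS center_in_cube[OF s(1)] by (rule L(2))
    also have "\<dots> \<le> L * (card I * \<delta>)" by (intro mult_left_mono sum_abs_cube_le inI x fin L)
    finally have gx: "\<bar>g x\<bar> < \<mu> * \<eta>" using \<delta>(4) gz by simp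
    have c: "x(j := z j + \<eta>) \<in> cube I z s" "x(j := z j - \<eta>) \<in> cube I z s" "x(j := z j) \<in> cube I z s"
      using \<eta> by (auto intro!: inS[OF x])
    have "g (x(j := z j + \<eta>)) \<ge> 0" "g (x(j := z j - \<eta>)) \<le> 0"
      using mono[OF c(3,1)] mono[OF c(2,3)] gx \<eta> unfolding xj by auto
    moreover have "continuous_on {z j - \<eta>..z j + \<eta>} (\<lambda>t. g (x(j := t)))"
      by (intro continuous_at_imp_continuous_on ballI DERIV_isCont[OF line] inS[OF x]) (use \<eta> in auto)
    ultimately obtain t where "t \<ge> z j - \<eta>" "t \<le> z j + \<eta>" "g (x(j := t)) = 0"
      using IVT'[of "\<lambda>t. g (x(j := t))" "z j - \<eta>" 0 "z j + \<eta>"] \<eta> by auto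
    then show ?thesis by (intro exI[of _ t]) auto
  qed
  define \<psi> where "\<psi> x = (SOME t. \<bar>t - z j\<bar> \<le> \<eta> \<and> g (x(j := t)) = 0)" for x
  have \<psi>: "\<bar>\<psi> x - z j\<bar> < s" "g (x(j := \<psi> x)) = 0" if "x \<in> cube I' z \<delta>" for x
  proof -
    have "\<bar>\<psi> x - z j\<bar> \<le> \<eta> \<and> g (x(j := \<psi> x)) = 0" unfolding \<psi>_def by (rule someI_ex[OF ex[OF that]])
    then show "\<bar>\<psi> x - z j\<bar> < s" "g (x(j := \<psi> x)) = 0" using \<eta> by auto
  qed
  have \<psi>S: "x(j := \<psi> x) \<in> cube I z s" if "x \<in> cube I' z \<delta>" for x
    by (intro inS \<psi> that)
  have uniq: "\<psi> x = t" if "x \<in> cube I' z \<delta>" "\<bar>t - z j\<bar> < s" "g (x(j := t)) = 0" for x t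
    using mono_abs[OF inS[OF that(1,2)] \<psi>S[OF that(1)]] \<psi>(2)[OF that(1)] that(3) \<mu>
    by (auto simp: mult_le_0_iff)
  define \<Lambda> where "\<Lambda> = L / \<mu>"
  have \<Lambda>: "\<Lambda> \<ge> 0" using L \<mu> by (simp add: \<Lambda>_def)
  have lip: "\<bar>\<psi> (x(i := t)) - \<psi> x\<bar> \<le> \<Lambda> * \<bar>t - x i\<bar>"
    if "x \<in> cube I' z \<delta>" "i \<in> I'" "x(i := t) \<in> cube I' z \<delta>" for x i t
  proof -
    have ij: "i \<noteq> j" "i \<in> I" using that by (auto simp: I'_def)
    have q: "x(i := t, j := \<psi> x) \<in> cube I z s" by (intro inS that \<psi>)
    have "\<mu> * \<bar>\<psi> (x(i := t)) - \<psi> x\<bar> \<le> \<bar>g (x(i := t, j := \<psi> (x(i := t)))) - g (x(i := t, j := \<psi> x))\<bar>"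
      by (intro mono_abs q \<psi>S that)
    also have "\<dots> = \<bar>g (x(i := t, j := \<psi> x)) - g (x(j := \<psi> x))\<bar>"
      using \<psi>(2) that by simp
    also have "\<dots> \<le> L * (\<Sum>k\<in>I. \<bar>(x(i := t, j := \<psi> x)) k - (x(j := \<psi> x)) k\<bar>)"
      by (intro L q \<psi>S that)
    also have "(\<Sum>k\<in>I. \<bar>(x(i := t, j := \<psi> x)) k - (x(j := \<psi> x)) k\<bar>) = (\<Sum>k\<in>I. if k = i then \<bar>t - x i\<bar> else 0)"
      using ij by (intro sum.cong) auto
    also have "\<dots> = \<bar>t - x i\<bar>" using ij fin by simp
    finally show ?thesis
      unfolding \<Lambda>_def times_divide_eq_left pos_le_divide_eq[OF \<mu>] by (simp only: mult.commute)
  qed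
  \<comment> \<open>The vector field d_i - (d_i g / d_j g) d_j, tangent to the level sets of g; on
    the graph of \<psi> it computes the derivative of the composite. The difference is written with
    a factor -1 to fit the majorant rules.\<close>
  define X where "X i F y = pd i F y + -1 * (1 / h y * pd i g y * pd j F y)" for i F y
  have Xpd: "has_pd i (\<lambda>x. F (x(j := \<psi> x))) (X i F (x(j := \<psi> x))) x"
    if F: "anl I z s F" and x: "x \<in> cube I' z \<delta>" and i: "i \<in> I'" for F x i
  proof -
    have ij: "i \<noteq> j" "i \<in> I" using i by (auto simp: I'_def)
    define q where "q = x(j := \<psi> x)"
    have q: "q \<in> cube I z s" unfolding q_def by (rule \<psi>S[OF x])
    have qi: "q i = x i" "q j = \<psi> x" using ij by (auto simp: q_def)
    obtain Kg where Kg: "Kg \<ge> 0" "\<And>x s' t. x \<in> cube I z s \<Longrightarrow> \<bar>s' - z i\<bar> < s \<Longrightarrow> \<bar>t - z j\<bar> < s \<Longrightarrow>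
      \<bar>g (x(i := s', j := t)) - g x - pd i g x * (s' - x i) - pd j g x * (t - x j)\<bar> \<le> Kg * (\<bar>s' - x i\<bar> + \<bar>t - x j\<bar>)\<^sup>2"
      using anl_two_variable_taylor[OF gs ij(2) j ij(1)] by blast
    obtain KF where KF: "KF \<ge> 0" "\<And>x s' t. x \<in> cube I z s \<Longrightarrow> \<bar>s' - z i\<bar> < s \<Longrightarrow> \<bar>t - z j\<bar> < s \<Longrightarrow>
      \<bar>F (x(i := s', j := t)) - F x - pd i F x * (s' - x i) - pd j F x * (t - x j)\<bar> \<le> KF * (\<bar>s' - x i\<bar> + \<bar>t - x j\<bar>)\<^sup>2"
      using anl_two_variable_taylor[OF F ij(2) j ij(1)] by blast
    \<comment> \<open>By the Lipschitz bound for \<psi>, the joint displacement |d| + |e| of the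
      coordinates i and j is at most (1 + \<Lambda>) |d|.\<close>
    define C where "C = (1 + \<Lambda>)\<^sup>2"
    define Fj where "Fj = pd j F q"
    define gi where "gi = pd i g q"
    define K where "K = KF * C + \<bar>Fj\<bar> * (Kg * C / \<mu>)"
    have hq: "h q \<ge> \<mu>" by (rule h\<mu>[OF q])
    have "\<forall>\<^sub>F t in nhds (x i). \<bar>F (x(i := t, j := \<psi> (x(i := t)))) - F (x(i := x i, j := \<psi> (x(i := x i))))
        - X i F q * (t - x i)\<bar> \<le> K * (t - x i)\<^sup>2"
      using coord_open_eventually_at[OF coord_open_cube x i]
    proof eventually_elim
      case (elim t)
      define d e where "d = t - x i" and "e = \<psi> (x(i := t)) - \<psi> x"
      have e: "\<bar>e\<bar> \<le> \<Lambda> * \<bar>d\<bar>" unfolding d_def e_def by (rule lip[OF x i elim])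
      have "(\<bar>d\<bar> + \<bar>e\<bar>)\<^sup>2 \<le> ((1 + \<Lambda>) * \<bar>d\<bar>)\<^sup>2" using e by (intro power_mono) (auto simp: algebra_simps)
      also have "\<dots> = C * d\<^sup>2" by (simp add: C_def power_mult_distrib)
      finally have de: "(\<bar>d\<bar> + \<bar>e\<bar>)\<^sup>2 \<le> C * d\<^sup>2" .
      have "x(i := t) \<in> cube I z \<delta>" by (rule inI[OF elim])
      then have ti: "\<bar>t - z i\<bar> < s" using ij(2) \<delta>(3) by (auto simp: cube_def dest!: bspec[of _ _ i])
      have tw: "q(i := t, j := \<psi> (x(i := t))) = x(i := t, j := \<psi> (x(i := t)))"
        using ij by (auto simp: q_def fun_eq_iff)
      have "\<bar>g (x(i := t, j := \<psi> (x(i := t)))) - g q - pd i g q * d - pd j g q * e\<bar> \<le> Kg * (\<bar>d\<bar> + \<bar>e\<bar>)\<^sup>2"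
        using Kg(2)[OF q ti \<psi>(1)[OF elim]] unfolding tw qi d_def e_def .
      also have "\<dots> \<le> Kg * (C * d\<^sup>2)" by (intro mult_left_mono de Kg)
      finally have 1: "\<bar>gi * d + h q * e\<bar> \<le> Kg * C * d\<^sup>2"
        using \<psi>(2)[OF elim] \<psi>(2)[OF x] by (simp add: q_def h_def gi_def abs_if split: if_splits)
      have "\<bar>F (x(i := t, j := \<psi> (x(i := t)))) - F q - pd i F q * d - pd j F q * e\<bar> \<le> KF * (\<bar>d\<bar> + \<bar>e\<bar>)\<^sup>2"
        using KF(2)[OF q ti \<psi>(1)[OF elim]] unfolding tw qi d_def e_def .
      also have "\<dots> \<le> KF * (C * d\<^sup>2)" by (intro mult_left_mono de KF)
      finally have 2: "\<bar>F (x(i := t, j := \<psi> (x(i := t)))) - F q - pd i F q * d - Fj * e\<bar> \<le> KF * C * d\<^sup>2"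
        by (simp add: Fj_def mult.assoc)
      have "e + gi / h q * d = (gi * d + h q * e) / h q"
        using hq \<mu> by (simp add: add_divide_distrib)
      then have "\<bar>e + gi / h q * d\<bar> = \<bar>gi * d + h q * e\<bar> / h q"
        using hq \<mu> by (simp add: abs_divide)
      also have "\<dots> \<le> (Kg * C * d\<^sup>2) / h q" using 1 hq \<mu> by (intro divide_right_mono) auto
      also have "\<dots> \<le> (Kg * C * d\<^sup>2) / \<mu>"
        using hq \<mu> Kg(1) by (intro divide_left_mono) (auto simp: C_def)
      finally have 3: "\<bar>Fj\<bar> * \<bar>e + gi / h q * d\<bar> \<le> \<bar>Fj\<bar> * ((Kg * C * d\<^sup>2) / \<mu>)"
        by (intro mult_left_mono) auto
      have "F (x(i := t, j := \<psi> (x(i := t)))) - F q - X i F q * d =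
        (F (x(i := t, j := \<psi> (x(i := t)))) - F q - pd i F q * d - Fj * e) + Fj * (e + gi / h q * d)"
        by (simp add: X_def Fj_def gi_def algebra_simps)
      also have "\<bar>\<dots>\<bar> \<le> KF * C * d\<^sup>2 + \<bar>Fj\<bar> * ((Kg * C * d\<^sup>2) / \<mu>)"
        by (rule order_trans[OF abs_triangle_ineq]) (use 2 3 in \<open>auto simp: abs_mult intro: add_mono\<close>)
      also have "\<dots> = K * d\<^sup>2" by (simp add: K_def algebra_simps)
      finally show ?case by (simp add: d_def q_def)
    qed
    from quadratic_error_imp_DERIV[OF this] show ?thesis by (simp add: q_def)
  qed
  from s(3) obtain \<rho>1 c1 b1 where b1: "\<rho>1 > 0" "fps_norm_le \<rho>1 c1 b1" "\<And>n. maj I (cube I z s) n b1 (\<lambda>x. 1 / h x)"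
    by (rule anlE) blast
  from gs obtain \<rho>2 c2 ag where ag: "\<rho>2 > 0" "fps_norm_le \<rho>2 c2 ag" "\<And>n. maj I (cube I z s) n ag g"
    by (rule anlE) blast
  \<comment> \<open>Dominates the two coefficients 1 and (d_i g) / h of the field
    \<open>X i\<close>, for all i at once.\<close>
  define \<beta> where "\<beta> = 1 + b1 * fps_deriv ag"
  define \<rho>0 where "\<rho>0 = min \<rho>1 (\<rho>2 / 2)"
  have \<rho>0: "\<rho>0 > 0" using b1 ag by (simp add: \<rho>0_def)
  have "fps_norm_le \<rho>0 c1 b1" using b1 \<rho>0 by (intro fps_norm_le_mono[OF b1(2)]) (auto simp: \<rho>0_def)
  moreover have "fps_norm_le \<rho>0 (c2 / (\<rho>2 - \<rho>2 / 2)) (fps_deriv ag)"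
    using ag \<rho>0 by (intro fps_norm_le_mono[OF fps_norm_le_deriv[OF ag(2), of "\<rho>2 / 2"]]) (auto simp: \<rho>0_def)
  ultimately have "fps_norm_le \<rho>0 (c1 * (c2 / (\<rho>2 - \<rho>2 / 2))) (b1 * fps_deriv ag)"
    using \<rho>0 by (intro fps_norm_le_mult)
  then obtain B where \<beta>: "fps_norm_le \<rho>0 B \<beta>"
    unfolding \<beta>_def using fps_norm_le_add[OF fps_norm_le_const[of 1 \<rho>0]] by fastforce
  define T where "T a = \<beta> * fps_deriv a" for a
  \<comment> \<open>The k-th derivative at 0 of this series is the value at 0 of T^k a. Formally it
    is a composed with the solution of y' = \<beta> (y), y 0 = 0, so that differentiating it amounts
    to applying T.\<close>
  define hat where "hat a = Abs_fps (\<lambda>k. fps_nth ((T ^^ k) a) 0 / fact k)" for a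
  have hat_deriv: "fps_deriv (hat a) = hat (T a)" for a
    by (simp add: hat_def fps_eq_iff funpow_swap1 del: of_nat_Suc)
  have majT: "maj I (cube I z s) n (T a) (X i F)" if "\<And>n. maj I (cube I z s) n a F" "i \<in> I" for n a F i
  proof -
    have "maj I (cube I z s) n (fps_deriv a + fps_const \<bar>-1\<bar> * (b1 * fps_deriv ag * fps_deriv a)) (X i F)"
      unfolding X_def using that(1)[of "Suc n"] ag(3)[of "Suc n"] that(2) j
      by (intro maj_add maj_mult coord_open_cube maj_const b1(3)) auto
    then show ?thesis by (simp add: T_def \<beta>_def algebra_simps)
  qed
  \<comment> \<open>All of a, F, \<rho> and c vary in the induction, since the next order concerns
    \<open>T a\<close> and \<open>X i F\<close> on a smaller radius. The norm bound certifies that F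
    is analytic, so that its composite may be differentiated.\<close>
  have hatmaj: "maj I' (cube I' z \<delta>) n (hat a) (\<lambda>x. F (x(j := \<psi> x)))"
    if "\<rho> > 0" "fps_norm_le \<rho> c a" "\<And>n. maj I (cube I z s) n a F" for n a F \<rho> c
    using that
  proof (induction n arbitrary: a F \<rho> c)
    case 0
    then show ?case using maj_bound[OF 0(3) \<psi>S] by (simp add: hat_def del: fun_upd_apply)
  next
    case (Suc n)
    have F: "anl I z s F" by (rule anlI) (use Suc.prems s in auto)
    have e: "pd i (\<lambda>x. F (x(j := \<psi> x))) x = X i F (x(j := \<psi> x))"
      if "i \<in> I'" "x \<in> cube I' z \<delta>" for i x
      by (rule has_pd_imp_pd, rule Xpd[OF F that(2,1)])
    define \<rho>' where "\<rho>' = min \<rho>0 (\<rho> / 2)"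
    have \<rho>': "\<rho>' > 0" "\<rho>' \<le> \<rho>0" "\<rho>' < \<rho>" using \<rho>0 Suc.prems by (auto simp: \<rho>'_def)
    have "fps_norm_le \<rho>' (B * (c / (\<rho> - \<rho>'))) (T a)"
      unfolding T_def by (intro fps_norm_le_mult \<rho>' fps_norm_le_deriv[OF Suc.prems(2)] fps_norm_le_mono[OF \<beta>] order_refl)
    then have "maj I' (cube I' z \<delta>) n (hat (T a)) (\<lambda>x. X i F (x(j := \<psi> x)))" if "i \<in> I'" for i
      by (rule Suc.IH[OF \<rho>'(1)]) (use majT[OF Suc.prems(3)] that I'_def in auto)
    then have "maj I' (cube I' z \<delta>) n (hat (T a)) (pd i (\<lambda>x. F (x(j := \<psi> x))))" if "i \<in> I'" for i
      by (rule maj_cong[OF coord_open_cube, rotated]) (use that e in auto)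
    moreover have "has_pd i (\<lambda>x. F (x(j := \<psi> x))) (pd i (\<lambda>x. F (x(j := \<psi> x))) x) x"
      if "i \<in> I'" "x \<in> cube I' z \<delta>" for i x
      unfolding e[OF that] by (rule Xpd[OF F that(2,1)])
    moreover have "\<bar>F (x(j := \<psi> x))\<bar> \<le> fps_nth (hat a) 0" if "x \<in> cube I' z \<delta>" for x
      using maj_bound[OF Suc.prems(3) \<psi>S[OF that]] by (simp add: hat_def del: fun_upd_apply)
    ultimately show ?case by (simp add: hat_deriv del: fun_upd_apply)
  qed
  have "anl I' z \<delta> (\<lambda>x. F (x(j := \<psi> x)))" if F: "anl I z r F" for F
  proof -
    from anl_mono[OF F s(1,2)] obtain \<rho> c a
      where A: "\<rho> > 0" "fps_norm_le \<rho> c a" "\<And>n. maj I (cube I z s) n a F"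
      by (rule anlE) blast
    define \<rho>' where "\<rho>' = min \<rho>0 \<rho>"
    have \<rho>': "\<rho>' > 0" "\<rho>' \<le> \<rho>0" "\<rho>' \<le> \<rho>" using A \<rho>0 by (auto simp: \<rho>'_def)
    have n1: "fps_norm_le \<rho>' B \<beta>" "fps_norm_le \<rho>' c a"
      using \<rho>' fps_norm_le_mono[OF \<beta>] fps_norm_le_mono[OF A(2)] by auto
    define R where "R = 2 * B * exp 1 / \<rho>' + 1"
    have B: "B \<ge> 0" using fps_norm_leD(3)[OF n1(1) \<rho>'(1)] .
    have c: "c \<ge> 0" using fps_norm_leD(3)[OF n1(2) \<rho>'(1)] .
    have R: "R > 0" "2 * B * exp 1 / \<rho>' \<le> R" using B \<rho>' by (auto simp: R_def intro!: add_nonneg_pos)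
    have it: "fps_nth (hat a) k \<ge> 0 \<and> fps_nth (hat a) k \<le> c * R ^ k" for k
    proof -
      note it = fps_norm_le_iterate[OF \<rho>'(1) n1, of k, folded T_def]
      have "fps_nth ((T ^^ k) a) 0 \<le> c * (2 * B * exp 1 / \<rho>') ^ k * fact k" by (rule it)
      also have "\<dots> \<le> c * R ^ k * fact k"
        by (intro mult_right_mono mult_left_mono power_mono) (use R c B \<rho>' in auto)
      finally show ?thesis using it(1) by (simp add: hat_def divide_simps)
    qed
    have "fps_norm_le (1 / (2 * R)) (2 * c) (hat a)"
      unfolding fps_norm_le_def
    proof (intro conjI allI)
      fix n
      show "fps_nth (hat a) n \<ge> 0" using it by blast
      have "(\<Sum>k\<le>n. fps_nth (hat a) k * (1 / (2 * R)) ^ k) \<le> (\<Sum>k\<le>n. c * (1/2) ^ k)"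
      proof (intro sum_mono)
        fix k
        have "fps_nth (hat a) k * (1 / (2 * R)) ^ k \<le> (c * R ^ k) * (1 / (2 * R)) ^ k"
          using it R by (intro mult_right_mono) auto
        also have "\<dots> = c * (1/2) ^ k" using R by (simp add: power_divide power_mult_distrib)
        finally show "fps_nth (hat a) k * (1 / (2 * R)) ^ k \<le> c * (1/2) ^ k" .
      qed
      also have "\<dots> = c * (\<Sum>k\<le>n. (1/2) ^ k)" by (simp add: sum_distrib_left)
      also have "(\<Sum>k\<le>n. (1/2::real) ^ k) = 2 - (1/2) ^ n" by (induction n) auto
      also have "c * (2 - (1/2) ^ n) \<le> 2 * c" using c by (simp add: algebra_simps)
      finally show "(\<Sum>k\<le>n. fps_nth (hat a) k * (1 / (2 * R)) ^ k) \<le> 2 * c" .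
    qed
    then show ?thesis
      by (rule anlI[OF \<delta>(1), rotated]) (use R hatmaj[OF A] in auto)
  qed
  moreover have "x(j := \<psi> x) \<in> cube I z r" if "x \<in> cube I' z \<delta>" for x
    using \<psi>S[OF that] cube_mono[OF s(2)] by blast
  moreover have "\<psi> (x(j := z j)) = x j" if "x \<in> cube I z \<delta>" "g x = 0" for x
    by (rule uniq) (use that j \<delta> in \<open>auto simp: cube_def I'_def dest!: bspec[of _ _ j]\<close>)
  moreover have "\<delta> \<le> r" using \<delta> s by simp
  ultimately show ?thesis using that \<delta>(1) unfolding I'_def by blast
qed

text \<open>If the derivative is negative, - g has the same zeros and a positive one.\<close>

lemma implicit_elimination:
  assumes fin: "finite I" and j: "j \<in> I" and g: "anl I z r g" and gz: "g z = 0" and hz: "pd j g z \<noteq> 0"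
  obtains \<delta> \<psi> where "\<delta> > 0" "\<delta> \<le> r"
    "\<And>x. x \<in> cube (I - {j}) z \<delta> \<Longrightarrow> x(j := \<psi> x) \<in> cube I z r"
    "\<And>x. x \<in> cube I z \<delta> \<Longrightarrow> g x = 0 \<Longrightarrow> \<psi> (x(j := z j)) = x j"
    "\<And>F. anl I z r F \<Longrightarrow> anl (I - {j}) z \<delta> (\<lambda>x. F (x(j := \<psi> x)))"
proof (cases "pd j g z > 0")
  case True
  show ?thesis using implicit_elimination_pos[OF fin j g gz True] that by blast
next
  case False
  have "r > 0" using g by (auto simp: anl_def)
  have "has_pd j g (pd j g z) z"
    using anl_has_pd[OF g j, of z "z j"] center_in_cube[OF \<open>r > 0\<close>] by simp
  from has_pd_imp_pd[OF DERIV_minus[OF this]] have pos: "pd j (\<lambda>x. - g x) z > 0" using False hz by simp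
  from gz have gz': "- g z = 0" by simp
  show ?thesis
  proof (rule implicit_elimination_pos[OF fin j anl_uminus[OF g] gz' pos])
    fix \<delta> \<psi>
    assume A: "\<delta> > 0" "\<delta> \<le> r"
      "\<And>x. x \<in> cube (I - {j}) z \<delta> \<Longrightarrow> x(j := \<psi> x) \<in> cube I z r"
      "\<And>x. x \<in> cube I z \<delta> \<Longrightarrow> - g x = 0 \<Longrightarrow> \<psi> (x(j := z j)) = x j"
      "\<And>F. anl I z r F \<Longrightarrow> anl (I - {j}) z \<delta> (\<lambda>x. F (x(j := \<psi> x)))"
    show ?thesis
    proof (rule that[OF A(1,2,3) _ A(5)])
      fix x assume "x \<in> cube I z \<delta>" "g x = 0"
      then show "\<psi> (x(j := z j)) = x j" by (intro A(4)) auto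
    qed
  qed
qed

section \<open>Values of functions on analytic sets\<close>

text \<open>A countable subcover unites the local exceptional sets. These are sets of values of
  \<tau>, not of points, because S may have a higher dimension than the line of parameters.\<close>

lemma Lindelof_countable_exceptions:
  fixes S :: "'a::second_countable_topology set"
  assumes "\<And>x. x \<in> S \<Longrightarrow> \<exists>W C. open W \<and> x \<in> W \<and> countable C \<and> (\<forall>y\<in>S \<inter> W. \<tau> y \<notin> C \<longrightarrow> R y)"
  obtains C where "countable C" "\<And>y. y \<in> S \<Longrightarrow> \<tau> y \<notin> C \<Longrightarrow> R y"
proof -
  from assms obtain W C where W: "\<And>x. x \<in> S \<Longrightarrow> open (W x) \<and> x \<in> W x \<and> countable (C x) \<and> (\<forall>y\<in>S \<inter> W x. \<tau> y \<notin> C x \<longrightarrow> R y)"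
    by metis
  obtain \<F> where \<F>: "\<F> \<subseteq> W ` S" "countable \<F>" "\<Union>\<F> = \<Union>(W ` S)"
    using Lindelof[of "W ` S"] W by blast
  obtain S0 where S0: "countable S0" "S0 \<subseteq> S" "\<F> = W ` S0"
    using \<F>(1,2) countable_subset_image[of \<F> W S] by auto
  show ?thesis
  proof (rule that[of "\<Union>(C ` S0)"])
    show "countable (\<Union>(C ` S0))" using S0 W by (intro countable_UN) auto
    fix y assume y: "y \<in> S" "\<tau> y \<notin> \<Union>(C ` S0)"
    then have "y \<in> \<Union>\<F>" using \<F>(3) W by blast
    then obtain x where "x \<in> S0" "y \<in> W x" using S0 by blast
    then show "R y" using y W S0(2) by blast
  qed
qed

lemma open_coordinate_box:
  fixes a :: "nat \<Rightarrow> real"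
  assumes "finite I"
  shows "open {x. \<forall>i\<in>I. \<bar>x i - a i\<bar> < r}"
proof -
  have "open {x :: nat \<Rightarrow> real. \<bar>x i - a i\<bar> < r}" for i
    by (intro open_Collect_less continuous_intros continuous_on_product_coordinates)
  then have "open (\<Inter>i\<in>I. {x :: nat \<Rightarrow> real. \<bar>x i - a i\<bar> < r})" using assms by (intro open_INT) auto
  also have "(\<Inter>i\<in>I. {x :: nat \<Rightarrow> real. \<bar>x i - a i\<bar> < r}) = {x. \<forall>i\<in>I. \<bar>x i - a i\<bar> < r}" by auto
  finally show ?thesis .
qed

text \<open>A cube contains the trace on S of an open box, since all points of S agree outside
  I.\<close>

lemma Lindelof_cube:
  assumes "finite I" "\<And>x y i. x \<in> S \<Longrightarrow> y \<in> S \<Longrightarrow> i \<notin> I \<Longrightarrow> x i = y i"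
    "\<And>x. x \<in> S \<Longrightarrow> \<exists>r>0. \<exists>C. countable C \<and> (\<forall>y\<in>S \<inter> cube I x r. \<tau> y \<notin> C \<longrightarrow> R y)"
  obtains C where "countable C" "\<And>y. y \<in> S \<Longrightarrow> \<tau> y \<notin> C \<Longrightarrow> R y"
proof (rule Lindelof_countable_exceptions[of S \<tau> R])
  fix x assume x: "x \<in> S"
  obtain r C where r: "r > 0" "countable C" "\<forall>y\<in>S \<inter> cube I x r. \<tau> y \<notin> C \<longrightarrow> R y"
    using assms(3)[OF x] by blast
  define W where "W = {y. \<forall>i\<in>I. \<bar>y i - x i\<bar> < r}"
  have "S \<inter> W \<subseteq> cube I x r"
  proof
    fix y assume y: "y \<in> S \<inter> W"
    then have "y i = x i" if "i \<notin> I" for i using assms(2)[of y x i] x that by blast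
    then show "y \<in> cube I x r" using y by (auto simp: cube_def W_def)
  qed
  then have "\<forall>y\<in>S \<inter> W. \<tau> y \<notin> C \<longrightarrow> R y" using r by blast
  moreover have "open W" unfolding W_def by (rule open_coordinate_box[OF assms(1)])
  moreover have "x \<in> W" using r by (auto simp: W_def)
  ultimately show "\<exists>W C. open W \<and> x \<in> W \<and> countable C \<and> (\<forall>y\<in>S \<inter> W. \<tau> y \<notin> C \<longrightarrow> R y)"
    using r by blast
qed (use that in blast)

section \<open>Differentiability of a function given through a parametrization\<close>

definition C1_at :: "(real \<Rightarrow> real) \<Rightarrow> real \<Rightarrow> bool" where
  "C1_at g t \<longleftrightarrow> (\<exists>g'. (\<forall>\<^sub>F s in nhds t. (g has_real_derivative g' s) (at s)) \<and> isCont g' t)"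

text \<open>T' does not vanish near s0, so T is injective there by the mean value theorem, its image
  is open, and g is Y composed with the inverse of T on that image.\<close>

lemma C1_at_parametrized:
  assumes "\<eta> > 0"
    and T: "\<And>s. \<bar>s - s0\<bar> < \<eta> \<Longrightarrow> (T has_real_derivative T' s) (at s)"
    and Y: "\<And>s. \<bar>s - s0\<bar> < \<eta> \<Longrightarrow> (Y has_real_derivative Y' s) (at s)"
    and cont: "isCont T' s0" "isCont Y' s0" and "T' s0 \<noteq> 0"
    and g: "\<And>s. \<bar>s - s0\<bar> < \<eta> \<Longrightarrow> Y s = g (T s)"
  shows "C1_at g (T s0)"
proof -
  have "\<forall>\<^sub>F s in nhds s0. T' s \<noteq> 0"
    using cont(1) assms(6) by (simp add: continuous_at tendsto_imp_eventually_ne eventually_nhds_conv_at)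
  then obtain \<eta>1 where \<eta>1: "\<eta>1 > 0" "\<And>s. \<bar>s - s0\<bar> < \<eta>1 \<Longrightarrow> T' s \<noteq> 0"
    unfolding eventually_nhds_metric dist_real_def by blast
  define \<epsilon> where "\<epsilon> = min \<eta> \<eta>1"
  have \<epsilon>: "\<epsilon> > 0" "\<And>s. \<bar>s - s0\<bar> < \<epsilon> \<Longrightarrow> \<bar>s - s0\<bar> < \<eta> \<and> T' s \<noteq> 0"
    using assms(1) \<eta>1 by (auto simp: \<epsilon>_def)
  define J where "J = {s0 - \<epsilon><..<s0 + \<epsilon>}"
  have J: "s \<in> J \<longleftrightarrow> \<bar>s - s0\<bar> < \<epsilon>" for s by (auto simp: J_def)
  have ne: "T u \<noteq> T v" if "u \<in> J" "v \<in> J" "u < v" for u v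
  proof
    assume eq: "T u = T v"
    have in_J: "s \<in> J" if "u \<le> s" "s \<le> v" for s using \<open>u \<in> J\<close> \<open>v \<in> J\<close> that by (auto simp: J_def)
    have "\<exists>s>u. s < v \<and> T v - T u = (v - u) * T' s"
      by (rule MVT2[OF that(3)]) (use in_J \<epsilon>(2) T in \<open>auto simp: J\<close>)
    then obtain s where "u < s" "s < v" "T v - T u = (v - u) * T' s" by blast
    then show False using eq that(3) \<epsilon>(2)[of s] in_J[of s] J by simp
  qed
  have inj: "inj_on T J" by (rule inj_onI) (metis ne linorder_neqE)
  have contT: "isCont T s" if "s \<in> J" for s using T \<epsilon>(2) that J by (blast intro: DERIV_isCont)
  have W: "open (T ` J)"
    by (rule invariance_of_domain) (use inj contT in \<open>auto intro!: continuous_at_imp_continuous_on simp: J_def\<close>)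
  define S where "S = inv_into J T"
  have ST: "S (T s) = s" if "s \<in> J" for s unfolding S_def by (rule inv_into_f_f[OF inj that])
  have contS: "isCont S (T s)" if s: "s \<in> J" for s
  proof -
    have "open J" by (simp add: J_def)
    then obtain d where d: "d > 0" "cball s d \<subseteq> J" using s open_contains_cball by blast
    show ?thesis
      by (rule isCont_inverse_function[of d]) (use d ST contT in \<open>auto simp: dist_real_def subset_iff abs_minus_commute\<close>)
  qed
  have dS: "(S has_real_derivative inverse (T' s)) (at (T s))" if s: "s \<in> J" for s
    unfolding has_field_derivative_def
  proof (rule has_derivative_inverse_strong_x[of J S "T s" T "(*) (T' s)"])
    show "open J" by (simp add: J_def)
    show "continuous_on J T" using contT by (auto intro: continuous_at_imp_continuous_on)
    show "T (S (T s)) = T s" "S (T s) \<in> J" using s by (simp_all add: ST)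
    show "\<And>z. z \<in> J \<Longrightarrow> S (T z) = z" by (rule ST)
    show "(T has_derivative (*) (T' s)) (at (S (T s)))"
      using T[of s] \<epsilon>(2)[of s] s J by (simp add: ST has_field_derivative_def)
    show "(*) (T' s) \<circ> (*) (inverse (T' s)) = id" using \<epsilon>(2)[of s] s J by (auto simp: fun_eq_iff)
  qed
  have dg: "(g has_real_derivative Y' (S u) * inverse (T' (S u))) (at u)" if u: "u \<in> T ` J" for u
  proof -
    from u obtain s where s: "s \<in> J" "u = T s" by blast
    have "((\<lambda>u. Y (S u)) has_real_derivative Y' s * inverse (T' s)) (at (T s))"
      by (rule DERIV_chain2[OF _ dS[OF s(1)]]) (use Y \<epsilon>(2) s J ST in auto)
    then have "(g has_real_derivative Y' s * inverse (T' s)) (at (T s))"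
    proof (rule has_field_derivative_transform_within_open[OF _ W])
      show "Y (S v) = g v" if "v \<in> T ` J" for v using that ST g \<epsilon>(2) J by auto
    qed (use s in auto)
    then show ?thesis by (simp add: s ST)
  qed
  have s0: "s0 \<in> J" using \<epsilon> by (simp add: J_def)
  show ?thesis
    unfolding C1_at_def
  proof (intro exI conjI)
    show "\<forall>\<^sub>F u in nhds (T s0). (g has_real_derivative Y' (S u) * inverse (T' (S u))) (at u)"
      by (rule eventually_mono[OF eventually_nhds_in_open[OF W] dg]) (use s0 in auto)
    have c: "isCont (\<lambda>u. Y' (S u)) (T s0)" "isCont (\<lambda>u. T' (S u)) (T s0)"
      by (rule isCont_o2[OF contS[OF s0]], simp add: ST[OF s0] cont)+
    show "isCont (\<lambda>u. Y' (S u) * inverse (T' (S u))) (T s0)"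
      by (intro continuous_intros c) (simp add: ST[OF s0] assms(6))
  qed
qed

lemma analytic_line_C1_at:
  assumes "anl I x s \<tau>" "anl I x s y" "i \<in> I" "pd i \<tau> x \<noteq> 0"
    and "\<And>u. u \<in> cube I x s \<Longrightarrow> y u = g (\<tau> u)"
  shows "C1_at g (\<tau> x)"
proof -
  have s: "s > 0" using assms(1) by (simp add: anl_def)
  have c: "x(i := t) \<in> cube I x s" if "\<bar>t - x i\<bar> < s" for t
    by (rule fun_upd_in_cube[of x I x s i t, OF center_in_cube[OF s] assms(3) that])
  have "C1_at g ((\<lambda>t. \<tau> (x(i := t))) (x i))"
  proof (rule C1_at_parametrized[OF s, where ?s0.0 = "x i" and T = "\<lambda>t. \<tau> (x(i := t))" and T' = "\<lambda>t. pd i \<tau> (x(i := t))" and Y' = "\<lambda>t. pd i y (x(i := t))"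
      and Y = "\<lambda>t. y (x(i := t))"])
    fix t assume t: "\<bar>t - x i\<bar> < s"
    show "((\<lambda>t. \<tau> (x(i := t))) has_real_derivative pd i \<tau> (x(i := t))) (at t)"
      "((\<lambda>t. y (x(i := t))) has_real_derivative pd i y (x(i := t))) (at t)"
      by (intro anl_has_pd[OF assms(1)] anl_has_pd[OF assms(2)] assms(3) c t)+
    show "y (x(i := t)) = g (\<tau> (x(i := t)))" by (intro assms(5) c t)
  next
    show "isCont (\<lambda>t. pd i \<tau> (x(i := t))) (x i)" "isCont (\<lambda>t. pd i y (x(i := t))) (x i)"
      by (rule DERIV_isCont, rule anl_has_pd[OF anl_pd[OF _ assms(3)] assms(3) c], rule assms, use s in simp)+
  qed (use assms(4) in simp)
  then show ?thesis by simp
qed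

text \<open>The majorant may be taken constant; its coefficient of degree 1, which is 0, is the
  Lipschitz constant.\<close>

lemma pd_zero_imp_constant:
  assumes "finite I" "anl I x s \<tau>" "\<And>i u. i \<in> I \<Longrightarrow> u \<in> cube I x s \<Longrightarrow> pd i \<tau> u = 0" "u \<in> cube I x s"
  shows "\<tau> u = \<tau> x"
proof -
  from assms(2) obtain \<rho> c a where F: "s > 0" "\<rho> > 0" "fps_norm_le \<rho> c a" "\<And>n. maj I (cube I x s) n a \<tau>"
    by (rule anlE) blast
  have "maj I (cube I x s) (Suc 0) (fps_const (fps_nth a 0)) \<tau>"
    using F(4)[of 1] assms(3) by simp
  from maj_lipschitz[OF assms(1) this assms(4) center_in_cube[OF F(1)]] show ?thesis by simp
qed

text \<open>
  The points where \<open>p\<close>, or a derivative of \<open>\<tau>\<close>, vanishes to finite order lie on countably many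
  analytic hypersurfaces, on which one coordinate is eliminated.  Elsewhere \<open>p\<close> vanishes
  identically nearby, and \<open>\<tau>\<close> is either locally constant or a submersion.
\<close>

lemma analytic_section_C1_at:
  assumes "finite I" "anl I z r p" "anl I z r \<tau>" "anl I z r y"
    and "\<And>x. x \<in> cube I z r \<Longrightarrow> p x = 0 \<Longrightarrow> y x = g (\<tau> x)"
  shows "\<exists>C. countable C \<and> (\<forall>x\<in>cube I z r. p x = 0 \<longrightarrow> \<tau> x \<notin> C \<longrightarrow> C1_at g (\<tau> x))"
  using assms
proof (induction "card I" arbitrary: I z r p \<tau> y rule: less_induct)
  case less
  note fin = less.prems(1) and p = less.prems(2) and \<tau> = less.prems(3) and y = less.prems(4) and g = less.prems(5)
  let ?Q = "cube I z r"
  \<comment> \<open>The hypersurface where G = 0 and d_j G is nonzero is locally a graph over the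
    coordinates I - {j}. Substituting its equation into p, \<tau> and y gives analytic functions of
    one variable fewer, to which the induction hypothesis applies.\<close>
  have claim: "\<exists>C. countable C \<and> (\<forall>x\<in>?Q. p x = 0 \<longrightarrow> G x = 0 \<longrightarrow> pd j G x \<noteq> 0 \<longrightarrow> \<tau> x \<notin> C \<longrightarrow> C1_at g (\<tau> x))"
    if G: "anl I z r G" and j: "j \<in> I" for G j
  proof -
    define S where "S = {x\<in>?Q. p x = 0 \<and> G x = 0 \<and> pd j G x \<noteq> 0}"
    have "\<exists>C. countable C \<and> (\<forall>y\<in>S. \<tau> y \<notin> C \<longrightarrow> C1_at g (\<tau> y))"
    proof (rule Lindelof_cube[OF fin, of S \<tau> "\<lambda>x. C1_at g (\<tau> x)"])
      show "u i = v i" if "u \<in> S" "v \<in> S" "i \<notin> I" for u v i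
        using that by (simp add: S_def cube_def)
      fix x assume x: "x \<in> S"
      then have xQ: "x \<in> ?Q" and Gx: "G x = 0" "pd j G x \<noteq> 0" by (auto simp: S_def)
      obtain s where s: "s > 0" "cube I x s \<subseteq> ?Q" by (rule cube_at_point[OF fin xQ])
      obtain \<delta> \<psi> where \<delta>: "\<delta> > 0" "\<delta> \<le> s"
        and in_s: "\<And>u. u \<in> cube (I - {j}) x \<delta> \<Longrightarrow> u(j := \<psi> u) \<in> cube I x s"
        and \<psi>: "\<And>u. u \<in> cube I x \<delta> \<Longrightarrow> G u = 0 \<Longrightarrow> \<psi> (u(j := x j)) = u j"
        and anl: "\<And>F. anl I x s F \<Longrightarrow> anl (I - {j}) x \<delta> (\<lambda>u. F (u(j := \<psi> u)))"
        by (rule implicit_elimination[OF fin j anl_subset[OF G s] Gx]) blast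
      have "\<exists>C. countable C \<and> (\<forall>u\<in>cube (I - {j}) x \<delta>. p (u(j := \<psi> u)) = 0 \<longrightarrow>
        \<tau> (u(j := \<psi> u)) \<notin> C \<longrightarrow> C1_at g (\<tau> (u(j := \<psi> u))))"
      proof (rule less.hyps)
        show "card (I - {j}) < card I" using fin j by (rule card_Diff1_less)
        show "y (u(j := \<psi> u)) = g (\<tau> (u(j := \<psi> u)))"
          if "u \<in> cube (I - {j}) x \<delta>" "p (u(j := \<psi> u)) = 0" for u
          using g[OF _ that(2)] in_s[OF that(1)] s(2) by blast
      qed (use fin anl anl_subset[OF p s] anl_subset[OF \<tau> s] anl_subset[OF y s] in auto)
      then obtain C where C: "countable C" "\<And>u. u \<in> cube (I - {j}) x \<delta> \<Longrightarrow> p (u(j := \<psi> u)) = 0 \<Longrightarrow>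
        \<tau> (u(j := \<psi> u)) \<notin> C \<Longrightarrow> C1_at g (\<tau> (u(j := \<psi> u)))" by blast
      have "C1_at g (\<tau> v)" if v: "v \<in> S \<inter> cube I x \<delta>" "\<tau> v \<notin> C" for v
      proof -
        define u where "u = v(j := x j)"
        have "u \<in> cube (I - {j}) x \<delta>" using v by (auto simp: u_def cube_def)
        moreover have "u(j := \<psi> u) = v" using \<psi>[of v] v by (auto simp: u_def S_def)
        ultimately show ?thesis using C(2)[of u] v by (auto simp: S_def)
      qed
      then show "\<exists>r>0. \<exists>C. countable C \<and> (\<forall>v\<in>S \<inter> cube I x r. \<tau> v \<notin> C \<longrightarrow> C1_at g (\<tau> v))"
        using \<delta>(1) C(1) by blast
    qed blast
    then show ?thesis unfolding S_def by blast
  qed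
  \<comment> \<open>Words over a finite alphabet, hence countably many functions, each of which may
    contribute its own exceptional set.\<close>
  define \<G> where "\<G> = (\<Union>w\<in>{w. set w \<subseteq> I}. insert (fold pd w p) ((\<lambda>i. fold pd w (pd i \<tau>)) ` I))"
  have "countable \<G>" unfolding \<G>_def using fin by (intro countable_UN) (auto intro: countable_finite)
  have \<G>: "anl I z r G" if "G \<in> \<G>" for G
    using that anl_fold_pd[OF p] anl_fold_pd[OF anl_pd[OF \<tau>]] by (auto simp: \<G>_def)
  obtain C0 where C0: "\<And>G j. G \<in> \<G> \<Longrightarrow> j \<in> I \<Longrightarrow> countable (C0 G j) \<and>
    (\<forall>x\<in>?Q. p x = 0 \<longrightarrow> G x = 0 \<longrightarrow> pd j G x \<noteq> 0 \<longrightarrow> \<tau> x \<notin> C0 G j \<longrightarrow> C1_at g (\<tau> x))"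
    using claim[OF \<G>] by metis
  \<comment> \<open>Where \<tau> is locally constant nothing is learnt about g, but such points
    contribute only countably many values of \<tau>.\<close>
  define K where "K = {x\<in>?Q. \<exists>s>0. \<forall>u\<in>cube I x s. \<tau> u = \<tau> x}"
  obtain CK where CK: "countable CK" "\<And>x. x \<in> K \<Longrightarrow> \<tau> x \<notin> CK \<Longrightarrow> False"
  proof (rule Lindelof_cube[OF fin, of K \<tau> "\<lambda>_. False"])
    show "u i = v i" if "u \<in> K" "v \<in> K" "i \<notin> I" for u v i
      using that by (simp add: K_def cube_def)
    fix x assume "x \<in> K"
    then obtain s where "s > 0" "\<forall>u\<in>cube I x s. \<tau> u = \<tau> x" by (auto simp: K_def)
    then show "\<exists>r>0. \<exists>C. countable C \<and> (\<forall>y\<in>K \<inter> cube I x r. \<tau> y \<notin> C \<longrightarrow> False)"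
      by (intro exI[of _ s] conjI exI[of _ "{\<tau> x}"]) auto
  qed blast
  define C where "C = (\<Union>G\<in>\<G>. \<Union>j\<in>I. C0 G j) \<union> CK"
  show ?case
  proof (intro exI[of _ C] conjI ballI impI)
    show "countable C"
      unfolding C_def using C0 CK(1) \<open>countable \<G>\<close> fin by (intro countable_Un countable_UN) (auto intro: countable_finite)
    fix x assume x: "x \<in> ?Q" "p x = 0" "\<tau> x \<notin> C"
    obtain s where s: "s > 0" "cube I x s \<subseteq> ?Q" by (rule cube_at_point[OF fin x(1)])
    note ps = anl_subset[OF p s] and \<tau>s = anl_subset[OF \<tau> s] and ys = anl_subset[OF y s]
    show "C1_at g (\<tau> x)"
    proof (cases "\<exists>G\<in>\<G>. \<exists>j\<in>I. G x = 0 \<and> pd j G x \<noteq> 0")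
      case True
      then obtain G j where Gj: "G \<in> \<G>" "j \<in> I" "G x = 0" "pd j G x \<noteq> 0" by blast
      then have "\<tau> x \<notin> C0 G j" using x(3) by (auto simp: C_def)
      then show ?thesis using C0[OF Gj(1,2)] x Gj by blast
    next
      case no: False
      have "\<not> (\<exists>w j. set w \<subseteq> I \<and> j \<in> I \<and> fold pd w p x = 0 \<and> pd j (fold pd w p) x \<noteq> 0)"
        using no by (auto simp: \<G>_def)
      with anl_zero_or_word[OF fin ps x(2)] obtain s1 where s1: "s1 > 0" "s1 \<le> s" "\<forall>u\<in>cube I x s1. p u = 0"
        by blast
      show ?thesis
      proof (cases "\<exists>i\<in>I. pd i \<tau> x \<noteq> 0")
        case True
        then obtain i where i: "i \<in> I" "pd i \<tau> x \<noteq> 0" by blast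
        show ?thesis
        proof (rule analytic_line_C1_at[OF anl_mono[OF \<tau>s s1(1,2)] anl_mono[OF ys s1(1,2)] i])
          fix u assume "u \<in> cube I x s1"
          then show "y u = g (\<tau> u)" using s1(3) cube_mono[OF s1(2)] s(2) by (intro g) blast+
        qed
      next
        case False
        \<comment> \<open>The derivative d_i \<tau> vanishes at x, hence near x, for otherwise x
          would lie on one of the hypersurfaces given by \<open>\<G>\<close>.\<close>
        have "\<exists>t>0. t \<le> s \<and> (\<forall>u\<in>cube I x t. pd i \<tau> u = 0)" if i: "i \<in> I" for i
        proof -
          have "\<not> (\<exists>w j. set w \<subseteq> I \<and> j \<in> I \<and> fold pd w (pd i \<tau>) x = 0 \<and> pd j (fold pd w (pd i \<tau>)) x \<noteq> 0)"
            using no i unfolding \<G>_def by blast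
          then show ?thesis using anl_zero_or_word[OF fin anl_pd[OF \<tau>s i]] False i by blast
        qed
        then obtain t where t: "\<And>i. i \<in> I \<Longrightarrow> t i > 0 \<and> t i \<le> s \<and> (\<forall>u\<in>cube I x (t i). pd i \<tau> u = 0)"
          by metis
        define t0 where "t0 = Min (insert s (t ` I))"
        have t0: "t0 > 0" "t0 \<le> s" "\<And>i. i \<in> I \<Longrightarrow> t0 \<le> t i"
          unfolding t0_def using fin t s(1) by (auto simp: Min_gr_iff)
        have "\<tau> u = \<tau> x" if "u \<in> cube I x t0" for u
        proof (rule pd_zero_imp_constant[OF fin anl_mono[OF \<tau>s t0(1,2)] _ that])
          fix i u assume "i \<in> I" "u \<in> cube I x t0"
          then show "pd i \<tau> u = 0" using t t0(3) cube_mono[of t0 "t i" I x] by blast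
        qed
        then have "x \<in> K" using t0(1) x(1) by (auto simp: K_def)
        then show ?thesis using CK(2) x(3) by (auto simp: C_def)
      qed
    qed
  qed
qed

section \<open>Subanalytic maps on lines\<close>

text \<open>Termwise differentiation at every order: the coefficients of the majorants supply the
  Weierstrass test on each coordinate segment.\<close>

lemma maj_suminf:
  fixes F :: "nat \<Rightarrow> (nat \<Rightarrow> real) \<Rightarrow> real" and b :: "nat \<Rightarrow> real fps"
  assumes "\<And>k n. maj I (cube I z r) n (b k) (F k)" "\<And>m. summable (\<lambda>k. fps_nth (b k) m)"
  shows "maj I (cube I z r) n (Abs_fps (\<lambda>m. \<Sum>k. fps_nth (b k) m)) (\<lambda>x. \<Sum>k. F k x)"
  using assms
proof (induction n arbitrary: b F)
  case 0
  have "\<bar>\<Sum>k. F k x\<bar> \<le> (\<Sum>k. fps_nth (b k) 0)" if "x \<in> cube I z r" for x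
    using norm_suminf_le[of "\<lambda>k. F k x" "\<lambda>k. fps_nth (b k) 0"] maj_bound[OF 0(1) that] 0(2)[of 0] by simp
  then show ?case by simp
next
  case (Suc n)
  let ?Q = "cube I z r"
  have bound: "\<bar>\<Sum>k. F k x\<bar> \<le> (\<Sum>k. fps_nth (b k) 0)" if "x \<in> ?Q" for x
    using norm_suminf_le[of "\<lambda>k. F k x" "\<lambda>k. fps_nth (b k) 0"] maj_bound[OF Suc.prems(1) that]
      Suc.prems(2)[of 0] by simp
  have D: "maj I ?Q m (fps_deriv (b k)) (pd i (F k))" if "i \<in> I" for i k m
    using Suc.prems(1)[of "Suc m" k] that by simp
  have s1: "summable (\<lambda>k. fps_nth (fps_deriv (b k)) m)" for m
    using Suc.prems(2)[of "Suc m"] by (simp add: summable_mult)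
  have h: "has_pd i (\<lambda>x. \<Sum>k. F k x) (\<Sum>k. pd i (F k) x) x" if i: "i \<in> I" and x: "x \<in> ?Q" for i x
  proof -
    define S where "S = {z i - r<..<z i + r}"
    have xS: "x i \<in> S" using x i by (auto simp: S_def cube_def abs_less_iff dest!: bspec[of _ _ i])
    have c: "x(i := t) \<in> ?Q" if "t \<in> S" for t
      using that by (intro fun_upd_in_cube[OF x i]) (auto simp: S_def)
    have "((\<lambda>t. \<Sum>k. F k (x(i := t))) has_real_derivative (\<Sum>k. pd i (F k) (x(i := x i)))) (at (x i))"
    proof (rule has_field_derivative_series'(2)[of S _ _ "x i"])
      show "((\<lambda>t. F k (x(i := t))) has_real_derivative pd i (F k) (x(i := t))) (at t within S)"
        if "t \<in> S" for k t
        by (rule has_field_derivative_at_within[OF has_pd_line[OF Suc.prems(1)[of "Suc 0"] i c[OF that]]])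
      show "uniformly_convergent_on S (\<lambda>n t. \<Sum>k<n. pd i (F k) (x(i := t)))"
        by (rule Weierstrass_m_test'[OF _ s1[of 0]]) (use maj_bound[OF D[OF i] c] in auto)
      show "summable (\<lambda>k. F k (x(i := x i)))"
        using maj_bound[OF Suc.prems(1) x] Suc.prems(2)[of 0] by (auto intro: summable_comparison_test')
      show "x i \<in> interior S" using xS by (simp add: S_def)
    qed (use xS in \<open>auto simp: S_def\<close>)
    then show ?thesis by simp
  qed
  have e: "pd i (\<lambda>x. \<Sum>k. F k x) x = (\<Sum>k. pd i (F k) x)" if "i \<in> I" "x \<in> ?Q" for i x
    by (rule has_pd_imp_pd, rule h[OF that])
  have "maj I ?Q n (fps_deriv (Abs_fps (\<lambda>m. \<Sum>k. fps_nth (b k) m))) (pd i (\<lambda>x. \<Sum>k. F k x))" if i: "i \<in> I" for i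
  proof (rule maj_cong[OF coord_open_cube])
    have "maj I ?Q n (Abs_fps (\<lambda>m. \<Sum>k. fps_nth (fps_deriv (b k)) m)) (\<lambda>x. \<Sum>k. pd i (F k) x)"
      by (rule Suc.IH[OF D[OF i] s1])
    also have "Abs_fps (\<lambda>m. \<Sum>k. fps_nth (fps_deriv (b k)) m) = fps_deriv (Abs_fps (\<lambda>m. \<Sum>k. fps_nth (b k) m))"
      using Suc.prems(2) by (simp add: fps_eq_iff suminf_mult del: of_nat_Suc)
    finally show "maj I ?Q n (fps_deriv (Abs_fps (\<lambda>m. \<Sum>k. fps_nth (b k) m))) (\<lambda>x. \<Sum>k. pd i (F k) x)" .
  qed (simp add: e[OF i])
  then show ?case using bound h by (simp add: e del: fun_upd_apply)
qed

lemma anl_suminf: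
  assumes "r > 0" "\<rho> > 0" "\<And>k n. maj I (cube I z r) n (b k) (F k)" "\<And>k. fps_norm_le \<rho> (c k) (b k)" "summable c"
  shows "anl I z r (\<lambda>x. \<Sum>k. F k x)"
proof (rule anlI[OF assms(1,2)])
  have s: "summable (\<lambda>k. fps_nth (b k) m)" for m
  proof (rule summable_comparison_test'[of "\<lambda>k. c k / \<rho> ^ m"])
    fix k
    show "norm (fps_nth (b k) m) \<le> c k / \<rho> ^ m"
      using fps_norm_leD(1,2)[OF assms(4,2), of k m] assms(2) by (simp add: pos_le_divide_eq)
  qed (use assms(5) in simp)
  show "maj I (cube I z r) n (Abs_fps (\<lambda>m. \<Sum>k. fps_nth (b k) m)) (\<lambda>x. \<Sum>k. F k x)" for n
    by (rule maj_suminf[OF assms(3) s])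
  show "fps_norm_le \<rho> (\<Sum>k. c k) (Abs_fps (\<lambda>m. \<Sum>k. fps_nth (b k) m))"
    unfolding fps_norm_le_def
  proof (intro conjI allI)
    fix n
    show "fps_nth (Abs_fps (\<lambda>m. \<Sum>k. fps_nth (b k) m)) n \<ge> 0"
      using s fps_norm_leD(1)[OF assms(4,2)] by (simp add: suminf_nonneg)
    have "(\<Sum>m\<le>n. fps_nth (Abs_fps (\<lambda>m. \<Sum>k. fps_nth (b k) m)) m * \<rho> ^ m) = (\<Sum>m\<le>n. \<Sum>k. fps_nth (b k) m * \<rho> ^ m)"
      using s by (simp add: suminf_mult2)
    also have "\<dots> = (\<Sum>k. \<Sum>m\<le>n. fps_nth (b k) m * \<rho> ^ m)"
      by (rule suminf_sum[symmetric]) (intro summable_mult2 s)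
    also have "\<dots> \<le> (\<Sum>k. c k)"
      by (intro suminf_le fps_norm_leD(4)[OF assms(4,2)] summable_sum summable_mult2 s assms(5))
    finally show "(\<Sum>m\<le>n. fps_nth (Abs_fps (\<lambda>m. \<Sum>k. fps_nth (b k) m)) m * \<rho> ^ m) \<le> (\<Sum>k. c k)" .
  qed
qed

lemma maj_power: "coord_open I Q \<Longrightarrow> maj I Q n a F \<Longrightarrow> maj I Q n (a ^ k) (\<lambda>x. F x ^ k)"
proof (induction k)
  case 0
  show ?case using maj_const[of I Q n 1] by simp
next
  case (Suc k)
  then show ?case using maj_mult[of I Q n a F "a ^ k" "\<lambda>x. F x ^ k"] by simp
qed

lemma maj_prod:
  assumes "coord_open I Q" "\<And>k. k \<in> K \<Longrightarrow> maj I Q n (a k) (F k)"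
  shows "maj I Q n (\<Prod>k\<in>K. a k) (\<lambda>x. \<Prod>k\<in>K. F k x)"
  using assms(2)
proof (induction K rule: infinite_finite_induct)
  case (insert k K)
  then show ?case using maj_mult[OF assms(1), of n "a k" "F k"] by simp
qed (use maj_const[of I Q n 1] in simp_all)

lemma fps_norm_le_prod:
  "\<rho> > 0 \<Longrightarrow> (\<And>k. k \<in> K \<Longrightarrow> fps_norm_le \<rho> (c k) (a k)) \<Longrightarrow> fps_norm_le \<rho> (\<Prod>k\<in>K. c k) (\<Prod>k\<in>K. a k)"
proof (induction K rule: infinite_finite_induct)
  case (insert k K)
  then show ?case using fps_norm_le_mult[of \<rho> "c k" "a k"] by simp
qed (use fps_norm_le_const[of 1 \<rho>] in simp_all)

section \<open>From analytic functions on \<open>Euclidean_space\<close> to analytic functions on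
  cubes\<close>

lemma open_contains_cube:
  assumes "openin (Euclidean_space k) V" "a \<in> V"
  obtains r where "r > 0" "cube {..<k} a r \<subseteq> V"
proof -
  obtain T where T: "openin (product_topology (\<lambda>_. euclideanreal) UNIV) T" "V = T \<inter> {x. \<forall>i\<ge>k. x i = 0}"
    using assms(1) unfolding Euclidean_space_def openin_subtopology by blast
  have a: "a \<in> T" "\<And>i. i \<ge> k \<Longrightarrow> a i = 0" using assms(2) T(2) by auto
  obtain X where X: "a \<in> (\<Pi>\<^sub>E i\<in>UNIV. X i)" "\<And>i. openin euclideanreal (X i)" "(\<Pi>\<^sub>E i\<in>UNIV. X i) \<subseteq> T"
    using product_topology_open_contains_basis[OF T(1) a(1)] by blast
  have "\<exists>e>0. ball (a i) e \<subseteq> X i" for i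
    using X(1,2) open_contains_ball[of "X i"] by (auto simp: PiE_iff)
  then obtain e where e: "\<And>i. e i > 0 \<and> ball (a i) (e i) \<subseteq> X i" by metis
  define r where "r = Min (insert 1 (e ` {..<k}))"
  have r: "r > 0" "\<And>i. i < k \<Longrightarrow> r \<le> e i"
    unfolding r_def using e by (auto simp: Min_gr_iff)
  have "cube {..<k} a r \<subseteq> V"
  proof
    fix x assume x: "x \<in> cube {..<k} a r"
    have "x i \<in> X i" for i
    proof (cases "i < k")
      case True
      then have "\<bar>x i - a i\<bar> < e i" using x r(2)[OF True] by (auto simp: cube_def dest!: bspec[of _ _ i])
      then show ?thesis using e[of i] by (auto simp: dist_real_def abs_minus_commute subset_iff)
    next
      case False
      then have "x i = a i" using x by (simp add: cube_def)
      then show ?thesis using X(1) by (auto simp: PiE_iff)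
    qed
    then show "x \<in> V" using X(3) a(2) x by (auto simp: T(2) PiE_iff cube_def)
  qed
  then show ?thesis using that r(1) by blast
qed

lemma truncate_cube:
  assumes "x \<in> cube I z r" "{..<k} \<subseteq> I"
  shows "truncate k x \<in> cube {..<k} (truncate k z) r"
  using assms by (auto simp: cube_def truncate_def subset_iff)

text \<open>Absolute convergence at the corner of the cube of radius R bounds the sum of |c
  \<alpha>| R^|\<alpha>|. On the cube of radius r = R/2 the monomial of index \<alpha> has the
  majorant (r + X)^|\<alpha>|, whose norm with weight r is R^|\<alpha>|, so the norms of the
  majorants are summable. The truncation allows I to contain coordinates on which the function does
  not depend.\<close>

lemma real_analytic_imp_anl:
  assumes "real_analytic_on k V g" "openin (Euclidean_space k) V" "truncate k z \<in> V" "{..<k} \<subseteq> I"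
  obtains r where "r > 0" "anl I z r (\<lambda>x. g (truncate k x))"
proof -
  define a where "a = truncate k z"
  obtain r1 where r1: "r1 > 0" "cube {..<k} a r1 \<subseteq> V"
    using open_contains_cube[OF assms(2,3)] unfolding a_def by blast
  obtain r2 c where r2: "r2 > 0" and c: "\<And>x. x \<in> V \<Longrightarrow> (\<forall>i<k. \<bar>x i - a i\<bar> < r2) \<Longrightarrow>
      ((\<lambda>\<alpha>. c \<alpha> * (\<Prod>i<k. (x i - a i) ^ \<alpha> i)) has_sum g x) {\<alpha>. \<forall>i\<ge>k. \<alpha> i = 0}"
    using assms(1,3) unfolding real_analytic_on_def a_def by blast
  define A where "A = {\<alpha> :: nat \<Rightarrow> nat. \<forall>i\<ge>k. \<alpha> i = 0}"
  define R where "R = min r1 r2 / 2"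
  define r where "r = R / 2"
  have R: "R > 0" "R < r1" "R < r2" "r > 0" "r \<le> r1" "r \<le> r2" "r + r = R" using r1 r2 by (auto simp: R_def r_def)
  have "countable A"
  proof -
    have "(\<lambda>l i. if i < k then l ! i else 0) ` lists UNIV \<supseteq> A"
    proof
      fix \<alpha> assume "\<alpha> \<in> A"
      then have "\<alpha> = (\<lambda>i. if i < k then map \<alpha> [0..<k] ! i else 0)" by (auto simp: A_def fun_eq_iff)
      then show "\<alpha> \<in> (\<lambda>l i. if i < k then l ! i else 0) ` lists UNIV" by blast
    qed
    then show ?thesis by (rule countable_subset) (intro countable_image countable_lists, simp)
  qed
  define e where "e = to_nat_on A"
  have e: "inj_on e A" unfolding e_def using \<open>countable A\<close> by (rule inj_on_to_nat_on)
  define d where "d n = inv_into A e n" for n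
  have de: "d (e \<alpha>) = \<alpha>" if "\<alpha> \<in> A" for \<alpha> unfolding d_def using e that by (rule inv_into_f_f)
  \<comment> \<open>Padding by zeros: for k = 0 there is only one multi-index to enumerate.\<close>
  define cc where "cc n = (if n \<in> e ` A then c (d n) else 0)" for n
  have transfer: "(\<lambda>n. (if n \<in> e ` A then f (d n) else 0)) sums s" if "(f has_sum s) A" for f :: "_ \<Rightarrow> real" and s
  proof -
    have "((\<lambda>n. f (d n)) has_sum s) (e ` A)"
      by (subst has_sum_reindex[OF e]) (use that de in \<open>auto simp: o_def cong: has_sum_cong\<close>)
    moreover have "((\<lambda>n. f (d n)) has_sum s) (e ` A) \<longleftrightarrow> ((\<lambda>n. if n \<in> e ` A then f (d n) else 0) has_sum s) UNIV"
      by (rule has_sum_cong_neutral) auto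
    ultimately have "((\<lambda>n. if n \<in> e ` A then f (d n) else 0) has_sum s) UNIV" by simp
    then show ?thesis by (rule has_sum_imp_sums)
  qed
  define F where "F n x = cc n * (\<Prod>i<k. (x i - a i) ^ d n i)" for n and x :: "nat \<Rightarrow> real"
  have sums_F: "(\<lambda>n. F n x) sums g x" if "x \<in> V" "\<forall>i<k. \<bar>x i - a i\<bar> < r2" for x
  proof -
    have "(\<lambda>n. F n x) = (\<lambda>n. if n \<in> e ` A then c (d n) * (\<Prod>i<k. (x i - a i) ^ d n i) else 0)"
      by (auto simp: F_def cc_def)
    then show ?thesis using transfer[OF c[OF that, folded A_def]] by simp
  qed
  define x0 where "x0 i = (if i < k then a i + R else 0)" for i
  have x0: "x0 \<in> V" "\<forall>i<k. \<bar>x0 i - a i\<bar> < r2"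
    using r1(2) R by (auto simp: x0_def cube_def a_def truncate_def subset_iff)
  have "(\<lambda>\<alpha>. c \<alpha> * (\<Prod>i<k. (x0 i - a i) ^ \<alpha> i)) summable_on A"
    by (rule has_sum_imp_summable[OF c[OF x0, folded A_def]])
  then have "(\<lambda>\<alpha>. \<bar>c \<alpha> * (\<Prod>i<k. (x0 i - a i) ^ \<alpha> i)\<bar>) summable_on A"
    unfolding summable_on_iff_abs_summable_on_real[of "\<lambda>\<alpha>. c \<alpha> * (\<Prod>i<k. (x0 i - a i) ^ \<alpha> i)"] real_norm_def .
  then obtain S where "((\<lambda>\<alpha>. \<bar>c \<alpha> * (\<Prod>i<k. (x0 i - a i) ^ \<alpha> i)\<bar>) has_sum S) A"
    unfolding summable_on_def by blast
  from transfer[OF this] have "summable (\<lambda>n. if n \<in> e ` A then \<bar>c (d n) * (\<Prod>i<k. (x0 i - a i) ^ d n i)\<bar> else 0)"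
    by (rule sums_summable)
  also have "(\<lambda>n. if n \<in> e ` A then \<bar>c (d n) * (\<Prod>i<k. (x0 i - a i) ^ d n i)\<bar> else 0) = (\<lambda>n. \<bar>cc n\<bar> * (\<Prod>i<k. R ^ d n i))"
    using R(1) by (auto simp: cc_def x0_def abs_mult abs_prod fun_eq_iff)
  finally have summ: "summable (\<lambda>n. \<bar>cc n\<bar> * (\<Prod>i<k. R ^ d n i))" .
  have "anl I z r (\<lambda>x. \<Sum>n. F n x)"
  proof (rule anl_suminf[OF R(4) R(4) _ _ summ])
    fix n
    define b where "b = fps_const r + fps_X"
    show "fps_norm_le r (\<bar>cc n\<bar> * (\<Prod>i<k. R ^ d n i)) (fps_const \<bar>cc n\<bar> * (\<Prod>i<k. b ^ d n i))"
      unfolding R(7)[symmetric] b_def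
      by (intro fps_norm_le_mult fps_norm_le_const fps_norm_le_prod fps_norm_le_power fps_norm_le_add fps_norm_le_X)
        (use R in auto)
    show "maj I (cube I z r) m (fps_const \<bar>cc n\<bar> * (\<Prod>i<k. b ^ d n i)) (F n)" for m
      unfolding F_def b_def
    proof (intro maj_mult maj_const maj_prod maj_power coord_open_cube maj_coord)
      fix i x assume i: "i \<in> {..<k}" and x: "x \<in> cube I z r"
      then show "\<bar>x i - a i\<bar> \<le> r" using assms(4)
        by (auto simp: cube_def a_def truncate_def subset_iff intro: less_imp_le)
    qed
  qed
  moreover have "(\<Sum>n. F n x) = g (truncate k x)" if x: "x \<in> cube I z r" for x
  proof -
    have t: "truncate k x \<in> cube {..<k} a r" unfolding a_def by (rule truncate_cube[OF x assms(4)])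
    then have "truncate k x \<in> V" using r1(2) cube_mono[OF R(5)] by blast
    moreover have "\<bar>truncate k x i - a i\<bar> < r2" if "i < k" for i
      using t R(6) that by (auto simp: cube_def dest!: bspec[of _ _ i])
    ultimately have "(\<lambda>n. F n (truncate k x)) sums g (truncate k x)" by (intro sums_F) auto
    moreover have "F n (truncate k x) = F n x" for n
      by (auto simp: F_def truncate_def intro!: prod.cong)
    ultimately show ?thesis by (simp add: sums_iff)
  qed
  ultimately have "anl I z r (\<lambda>x. g (truncate k x))" by (rule anl_cong)
  then show ?thesis using that R(4) by blast
qed

section \<open>Lines, graphs and semianalytic sets\<close>

definition graph_point :: "(real^'m \<Rightarrow> real^'n) \<Rightarrow> real^'m \<Rightarrow> nat \<Rightarrow> real" where
  "graph_point f x = (\<lambda>i. if i < CARD('m) then x $ from_nat_into UNIV i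
           else if i < CARD('m) + CARD('n) then f x $ from_nat_into UNIV (i - CARD('m))
           else 0)"

lemma graph_in_Rn_eq: "graph_in_Rn f U = graph_point f ` U"
  unfolding graph_in_Rn_def graph_point_def ..

lemma bij_from_nat_into_UNIV: "bij_betw (from_nat_into (UNIV :: 'a::finite set)) {..<CARD('a)} UNIV"
  by (rule bij_betw_from_nat_into_finite) simp

lemma vec_eq_coords:
  fixes x y :: "real^'m"
  assumes "\<And>i. i < CARD('m) \<Longrightarrow> x $ from_nat_into UNIV i = y $ from_nat_into UNIV i"
  shows "x = y"
proof (rule vec_eq_iff[THEN iffD2, rule_format])
  fix k :: 'm
  obtain i where "i < CARD('m)" "k = from_nat_into UNIV i"
    using bij_from_nat_into_UNIV[where 'a = 'm] by (auto simp: bij_betw_def)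
  then show "x $ k = y $ k" using assms by simp
qed

lemma inner_coords:
  fixes w z :: "real^'n"
  shows "w \<bullet> z = (\<Sum>i<CARD('n). w $ from_nat_into UNIV i * z $ from_nat_into UNIV i)"
  unfolding inner_vec_def inner_real_def
  using sum.reindex_bij_betw[OF bij_from_nat_into_UNIV[where 'a = 'n], of "\<lambda>k. w $ k * z $ k"] by simp

lemma open_of_openin_Euclidean:
  assumes "openin (Euclidean_space k) V"
  obtains T where "open T" "V = T \<inter> Rn k"
proof -
  obtain T where "openin (product_topology (\<lambda>_. euclideanreal) UNIV) T" "V = T \<inter> {x. \<forall>i\<ge>k. x i = 0}"
    using assms unfolding Euclidean_space_def openin_subtopology by blast
  then show ?thesis
    using that by (simp add: euclidean_product_topology topspace_Euclidean_space open_openin[symmetric])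
qed

lemma continuous_on_graph_point:
  assumes "continuous_on U f"
  shows "continuous_on U (graph_point f)"
  unfolding graph_point_def
proof (rule continuous_on_coordinatewise_then_product)
  fix i
  show "continuous_on U (\<lambda>x. if i < CARD('m) then x $ from_nat_into UNIV i
           else if i < CARD('m) + CARD('n) then f x $ from_nat_into UNIV (i - CARD('m)) else (0::real))"
    by (cases "i < CARD('m)"; cases "i < CARD('m) + CARD('n)") (auto intro!: continuous_intros assms)
qed

text \<open>
  The parameter of the line is carried by the coordinate \<open>K\<close>, which the semianalytic subset of
  \<open>\<real>\<^sup>K\<close> does not involve.
\<close>

lemma semianalytic_system_C1_at:
  fixes a b :: "nat \<Rightarrow> real"
  assumes V: "openin (Euclidean_space K) V" and PQ: "finite P" "finite Q"
    and an: "\<And>g. g \<in> P \<union> Q \<Longrightarrow> real_analytic_on K V g"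
    and m: "m \<le> K"
    and E: "E = {u. (\<forall>i>K. u i = 0) \<and> (\<forall>i<m. u i = a i + u K * b i) \<and> truncate K u \<in> V \<and>
      (\<forall>p\<in>P. p (truncate K u) = 0) \<and> (\<forall>q\<in>Q. q (truncate K u) > 0)}"
    and G: "\<And>u. u \<in> E \<Longrightarrow> (\<Sum>i<n. c i * u (m + i)) = G (u K)"
  shows "\<exists>C. countable C \<and> (\<forall>u\<in>E. u K \<notin> C \<longrightarrow> C1_at G (u K))"
proof (rule Lindelof_cube[of "{..K}" E "\<lambda>u. u K" "\<lambda>u. C1_at G (u K)"])
  show "u i = v i" if "u \<in> E" "v \<in> E" "i \<notin> {..K}" for u v i using that by (auto simp: E)
next
  fix z assume z: "z \<in> E"
  have zV: "truncate K z \<in> V" using z by (simp add: E)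
  have sub: "{..<K} \<subseteq> {..K}" by auto
  let ?I = "{..K}"
  obtain r0 where r0: "r0 > 0" "cube {..<K} (truncate K z) r0 \<subseteq> V" by (rule open_contains_cube[OF V zV])
  have "\<exists>r>0. anl ?I z r (\<lambda>x. g (truncate K x))" if "g \<in> P \<union> Q" for g
    using real_analytic_imp_anl[OF an[OF that] V zV sub] by blast
  then obtain r1 where r1: "\<And>g. g \<in> P \<union> Q \<Longrightarrow> r1 g > 0 \<and> anl ?I z (r1 g) (\<lambda>x. g (truncate K x))" by metis
  \<comment> \<open>Strict inequalities persist near z, so that only equations remain on a small
    cube.\<close>
  have "\<exists>r>0. \<forall>x\<in>cube ?I z r. q (truncate K x) > 0" if q: "q \<in> Q" for q
  proof -
    have pos: "q (truncate K z) > 0" using z q by (simp add: E)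
    obtain s where s: "s > 0" "\<And>x. x \<in> cube ?I z s \<Longrightarrow> \<bar>q (truncate K x) - q (truncate K z)\<bar> \<le> q (truncate K z) / 2"
      by (rule anl_small_oscillation[of ?I z "r1 q" "\<lambda>x. q (truncate K x)" "q (truncate K z) / 2"])
         (use r1[of q] q pos in auto)
    have "q (truncate K x) > 0" if "x \<in> cube ?I z s" for x using s(2)[OF that] pos by linarith
    then show ?thesis using s(1) by blast
  qed
  then obtain r2 where r2: "\<And>q. q \<in> Q \<Longrightarrow> r2 q > 0 \<and> (\<forall>x\<in>cube ?I z (r2 q). q (truncate K x) > 0)" by metis
  define r where "r = Min (insert r0 (r1 ` (P \<union> Q) \<union> r2 ` Q))"
  have r: "r > 0" "r \<le> r0" "\<And>g. g \<in> P \<union> Q \<Longrightarrow> r \<le> r1 g" "\<And>q. q \<in> Q \<Longrightarrow> r \<le> r2 q"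
    unfolding r_def using PQ r0(1) r1 r2 by (auto simp: Min_gr_iff)
  have an': "anl ?I z r (\<lambda>x. g (truncate K x))" if "g \<in> P \<union> Q" for g
    using anl_mono r1[OF that] r(1) r(3)[OF that] by blast
  have coord: "anl ?I z r (\<lambda>u. u i)" for i using anl_coord[OF r(1), of ?I z i 0] by simp
  \<comment> \<open>A sum of squares merges all equations into one, including those which say that
    the first m coordinates lie on the line.\<close>
  define p where "p u = (\<Sum>g\<in>P. g (truncate K u) * g (truncate K u)) +
    (\<Sum>i<m. (u i - (a i + u K * b i)) * (u i - (a i + u K * b i)))" for u
  have p: "anl ?I z r p"
    unfolding p_def using r(1) an'
    by (intro anl_add anl_sum anl_mult anl_diff coord anl_const) auto
  have p_E: "u \<in> E \<longleftrightarrow> p u = 0" if u: "u \<in> cube ?I z r" for u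
  proof -
    have "p u = 0 \<longleftrightarrow> (\<forall>g\<in>P. g (truncate K u) = 0) \<and> (\<forall>i<m. u i = a i + u K * b i)"
      unfolding p_def using PQ(1)
      by (subst add_nonneg_eq_0_iff) (auto simp: sum_nonneg sum_nonneg_eq_0_iff)
    moreover have "\<forall>i>K. u i = 0" using u z by (simp add: cube_def E)
    moreover have "truncate K u \<in> V"
      using truncate_cube[OF u sub] cube_mono[OF r(2)] r0(2) by blast
    moreover have "\<forall>q\<in>Q. q (truncate K u) > 0"
      using r2 cube_mono[OF r(4)] u by blast
    ultimately show ?thesis by (auto simp: E)
  qed
  have "\<exists>C. countable C \<and> (\<forall>u\<in>cube ?I z r. p u = 0 \<longrightarrow> u K \<notin> C \<longrightarrow> C1_at G (u K))"
  proof (rule analytic_section_C1_at)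
    show "anl ?I z r (\<lambda>u. \<Sum>i<n. c i * u (m + i))"
      using r(1) by (intro anl_sum anl_mult anl_const coord)
    show "(\<Sum>i<n. c i * u (m + i)) = G (u K)" if "u \<in> cube ?I z r" "p u = 0" for u
      using G p_E[OF that(1)] that(2) by blast
  qed (use p coord in auto)
  then show "\<exists>r>0. \<exists>C. countable C \<and> (\<forall>u\<in>E \<inter> cube ?I z r. u K \<notin> C \<longrightarrow> C1_at G (u K))"
    using r(1) p_E by blast
qed auto

text \<open>Near a given point A is a finite union of systems, each with its own countable set of
  exceptional parameters.\<close>

lemma semianalytic_C1_at:
  fixes a b :: "nat \<Rightarrow> real"
  assumes A: "semianalytic K A" and m: "m \<le> K"
    and E: "E = {u. (\<forall>i>K. u i = 0) \<and> (\<forall>i<m. u i = a i + u K * b i) \<and> truncate K u \<in> A}"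
    and G: "\<And>u. u \<in> E \<Longrightarrow> (\<Sum>i<n. c i * u (m + i)) = G (u K)"
  shows "\<exists>C. countable C \<and> (\<forall>u\<in>E. u K \<notin> C \<longrightarrow> C1_at G (u K))"
proof (rule Lindelof_cube[of "{..K}" E "\<lambda>u. u K" "\<lambda>u. C1_at G (u K)"])
  show "u i = v i" if "u \<in> E" "v \<in> E" "i \<notin> {..K}" for u v i using that by (auto simp: E)
next
  fix z assume z: "z \<in> E"
  then have "truncate K z \<in> Rn K" by (auto simp: topspace_Euclidean_space truncate_def)
  then obtain V F where V: "openin (Euclidean_space K) V" "truncate K z \<in> V" and F: "finite F"
    and PQ: "\<And>P Q. (P, Q) \<in> F \<Longrightarrow> finite P \<and> finite Q \<and> (\<forall>g\<in>P \<union> Q. real_analytic_on K V g)"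
    and AV: "A \<inter> V = (\<Union>(P, Q)\<in>F. {x\<in>V. (\<forall>p\<in>P. p x = 0) \<and> (\<forall>q\<in>Q. q x > 0)})"
    using A unfolding semianalytic_def by (fastforce split: prod.splits)
  define ES where "ES P Q = {u. (\<forall>i>K. u i = 0) \<and> (\<forall>i<m. u i = a i + u K * b i) \<and> truncate K u \<in> V \<and>
      (\<forall>p\<in>P. p (truncate K u) = 0) \<and> (\<forall>q\<in>Q. q (truncate K u) > 0)}" for P Q :: "((nat \<Rightarrow> real) \<Rightarrow> real) set"
  have sub: "ES P Q \<subseteq> E" if "(P, Q) \<in> F" for P Q
  proof
    fix u assume u: "u \<in> ES P Q"
    then have "truncate K u \<in> A \<inter> V" unfolding AV using that by (auto simp: ES_def)
    then show "u \<in> E" using u by (auto simp: E ES_def)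
  qed
  have "\<exists>C. countable C \<and> (\<forall>u\<in>ES (fst X) (snd X). u K \<notin> C \<longrightarrow> C1_at G (u K))" if "X \<in> F" for X
    by (rule semianalytic_system_C1_at[OF V(1) _ _ _ m ES_def G])
       (use PQ[of "fst X" "snd X"] sub[of "fst X" "snd X"] that in auto)
  then obtain C where C: "\<And>X. X \<in> F \<Longrightarrow> countable (C X) \<and> (\<forall>u\<in>ES (fst X) (snd X). u K \<notin> C X \<longrightarrow> C1_at G (u K))"
    by metis
  obtain r where r: "r > 0" "cube {..<K} (truncate K z) r \<subseteq> V" by (rule open_contains_cube[OF V])
  show "\<exists>r>0. \<exists>C. countable C \<and> (\<forall>u\<in>E \<inter> cube {..K} z r. u K \<notin> C \<longrightarrow> C1_at G (u K))"
  proof (intro exI[of _ r] conjI exI[of _ "\<Union>X\<in>F. C X"] ballI impI)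
    show "countable (\<Union>X\<in>F. C X)" using F C by (intro countable_UN) (auto intro: countable_finite)
    fix u assume u: "u \<in> E \<inter> cube {..K} z r" "u K \<notin> (\<Union>X\<in>F. C X)"
    then have "truncate K u \<in> V" using r(2) truncate_cube[of u "{..K}" z r K] by (auto simp: lessThan_subset_iff subset_iff)
    then have "truncate K u \<in> A \<inter> V" using u by (auto simp: E)
    then obtain P Q where "(P, Q) \<in> F" "\<forall>p\<in>P. p (truncate K u) = 0" "\<forall>q\<in>Q. q (truncate K u) > 0"
      unfolding AV by auto
    moreover from this have "u \<in> ES P Q" using u \<open>truncate K u \<in> V\<close> by (auto simp: ES_def E)
    ultimately show "C1_at G (u K)" using C[of "(P, Q)"] u(2) by auto
  qed (rule r(1))
qed auto

text \<open>The points of the graph over the line are lifted to the semianalytic set whose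
  projection is the graph, and the parameter t is adjoined as a last coordinate. On the lifted set
  the inner product of w and f is a linear form in the coordinates, and it depends only on
  t.\<close>

lemma subanalytic_line_C1_at:
  fixes f :: "real^'m \<Rightarrow> real^'n"
  assumes sub: "subanalytic (CARD('m) + CARD('n)) (graph_in_Rn f U)" and "open U" and cont: "continuous_on U f"
  shows "\<exists>C. countable C \<and> (\<forall>t. x + t *\<^sub>R v \<in> U \<longrightarrow> t \<notin> C \<longrightarrow> C1_at (\<lambda>t. w \<bullet> f (x + t *\<^sub>R v)) t)"
proof -
  let ?M = "CARD('m)" and ?N = "CARD('n)"
  define G where "G t = w \<bullet> f (x + t *\<^sub>R v)" for t
  define J where "J = {t. x + t *\<^sub>R v \<in> U}"
  have "open J"
    unfolding J_def using open_vimage[OF \<open>open U\<close>, of "\<lambda>t. x + t *\<^sub>R v"] by (simp add: vimage_def continuous_intros)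
  have contJ: "continuous_on J (\<lambda>t. graph_point f (x + t *\<^sub>R v))"
    by (rule continuous_on_compose2[OF continuous_on_graph_point[OF cont]]) (auto simp: J_def intro!: continuous_intros)
  obtain C where "countable C" "\<And>t. t \<in> J \<Longrightarrow> t \<notin> C \<Longrightarrow> C1_at G t"
  proof (rule Lindelof_countable_exceptions[of J "\<lambda>t. t" "C1_at G"])
    fix t0 assume t0: "t0 \<in> J"
    have "graph_point f (x + t0 *\<^sub>R v) \<in> Rn (?M + ?N)"
      by (auto simp: topspace_Euclidean_space graph_point_def)
    then obtain V l A K' where V: "openin (Euclidean_space (?M + ?N)) V" "graph_point f (x + t0 *\<^sub>R v) \<in> V"
      and A: "semianalytic (?M + ?N + l) A" and VA: "graph_in_Rn f U \<inter> V = truncate (?M + ?N) ` A"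
      using sub unfolding subanalytic_def by metis
    define K where "K = ?M + ?N + l"
    define a where "a i = x $ from_nat_into UNIV i" for i
    define b where "b i = v $ from_nat_into UNIV i" for i
    define c where "c i = w $ from_nat_into UNIV i" for i
    define E where "E = {u. (\<forall>i>K. u i = 0) \<and> (\<forall>i<?M. u i = a i + u K * b i) \<and> truncate K u \<in> A}"
    have "\<exists>C. countable C \<and> (\<forall>u\<in>E. u K \<notin> C \<longrightarrow> C1_at G (u K))"
    proof (rule semianalytic_C1_at[OF A[folded K_def] _ E_def])
      fix u assume u: "u \<in> E"
      then have "truncate (?M + ?N) (truncate K u) \<in> graph_in_Rn f U" using VA by (auto simp: E_def)
      then obtain y where y: "y \<in> U" "truncate (?M + ?N) (truncate K u) = graph_point f y"
        by (auto simp: graph_in_Rn_eq)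
      have uy: "u i = graph_point f y i" if "i < ?M + ?N" for i
        using fun_cong[OF y(2), of i] that by (simp add: truncate_def K_def)
      have "y = x + u K *\<^sub>R v"
      proof (rule vec_eq_coords)
        fix i assume i: "i < ?M"
        then show "y $ from_nat_into UNIV i = (x + u K *\<^sub>R v) $ from_nat_into UNIV i"
          using uy[of i] u by (simp add: E_def a_def b_def graph_point_def)
      qed
      then have "G (u K) = (\<Sum>i<?N. c i * f y $ from_nat_into UNIV i)"
        by (simp add: G_def inner_coords c_def)
      also have "\<dots> = (\<Sum>i<?N. c i * u (?M + i))"
        using uy by (intro sum.cong) (auto simp: graph_point_def)
      finally show "(\<Sum>i<?N. c i * u (?M + i)) = G (u K)" by simp
    qed (simp add: K_def)
    then obtain C where C: "countable C" "\<And>u. u \<in> E \<Longrightarrow> u K \<notin> C \<Longrightarrow> C1_at G (u K)" by blast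
    obtain T where T: "open T" "V = T \<inter> Rn (?M + ?N)" by (rule open_of_openin_Euclidean[OF V(1)])
    \<comment> \<open>By continuity of f the points of the graph over parameters near t0 stay in V,
      where the graph is the projection of A.\<close>
    define W where "W = (\<lambda>t. graph_point f (x + t *\<^sub>R v)) -` T \<inter> J"
    have "open W" unfolding W_def
      by (rule continuous_on_open_vimage[THEN iffD1, rule_format, OF \<open>open J\<close> contJ T(1)])
    moreover have "t0 \<in> W" using V(2) T(2) t0 by (auto simp: W_def)
    moreover have "C1_at G t" if t: "t \<in> J \<inter> W" "t \<notin> C" for t
    proof -
      have "graph_point f (x + t *\<^sub>R v) \<in> graph_in_Rn f U \<inter> V"
        using t T(2) by (auto simp: W_def J_def graph_in_Rn_eq topspace_Euclidean_space graph_point_def)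
      then obtain z where z: "z \<in> A" "graph_point f (x + t *\<^sub>R v) = truncate (?M + ?N) z" using VA by auto
      define u where "u = z(K := t)"
      have zR: "z i = 0" if "i \<ge> K" for i
        using A z(1) that by (auto simp: semianalytic_def topspace_Euclidean_space K_def)
      have "truncate K u = z" using zR by (auto simp: truncate_def u_def fun_eq_iff)
      moreover have "u i = a i + u K * b i" if "i < ?M" for i
        using fun_cong[OF z(2), of i] that by (simp add: u_def K_def graph_point_def truncate_def a_def b_def)
      ultimately have "u \<in> E" using z(1) zR by (auto simp: E_def u_def)
      then show ?thesis using C(2)[of u] t(2) by (simp add: u_def)
    qed
    ultimately show "\<exists>W C. open W \<and> t0 \<in> W \<and> countable C \<and> (\<forall>t\<in>J \<inter> W. t \<notin> C \<longrightarrow> C1_at G t)"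
      using C(1) by blast
  qed blast
  then show ?thesis unfolding G_def J_def by blast
qed

section \<open>Functions of one variable\<close>

text \<open>If no T contained a relatively open piece of S, every S - T would be relatively open and
  dense in S. By Baire their intersection would be dense in S, but the cover makes it empty.\<close>

lemma closed_cover_contains_ball:
  fixes S :: "'a::{real_normed_vector,heine_borel} set"
  assumes "closed S" "S \<noteq> {}" "countable \<F>" "\<And>T. T \<in> \<F> \<Longrightarrow> closed T" "S \<subseteq> \<Union>\<F>"
  obtains T x e where "T \<in> \<F>" "x \<in> S" "e > 0" "S \<inter> ball x e \<subseteq> T"
proof -
  have "\<exists>T\<in>\<F>. \<exists>x\<in>S. \<exists>e>0. S \<inter> ball x e \<subseteq> T"
  proof (rule ccontr)
    assume "\<not> ?thesis"
    then have no: "\<not> S \<inter> ball x e \<subseteq> T" if "T \<in> \<F>" "x \<in> S" "e > 0" for T x e using that by blast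
    have "S \<subseteq> closure (\<Inter>((\<lambda>T. S - T) ` \<F>))"
    proof (rule Baire[OF assms(1)])
      show "countable ((\<lambda>T. S - T) ` \<F>)" using assms(3) by simp
      fix T' assume "T' \<in> (\<lambda>T. S - T) ` \<F>"
      then obtain T where T: "T \<in> \<F>" "T' = S - T" by blast
      have "openin (top_of_set S) T'" unfolding T(2) Diff_eq using assms(4)[OF T(1)] by (intro openin_open_Int) auto
      moreover have "S \<subseteq> closure T'"
        unfolding subset_iff closure_approachable
      proof (intro allI impI)
        fix x e assume "x \<in> S" "(e::real) > 0"
        then obtain y where "y \<in> S" "y \<in> ball x e" "y \<notin> T" using no[OF T(1)] by blast
        then show "\<exists>y\<in>T'. dist y x < e" using T(2) by (auto simp: dist_commute)
      qed
      ultimately show "openin (top_of_set S) T' \<and> S \<subseteq> closure T'" by blast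
    qed
    moreover have "\<F> \<noteq> {}" using assms(2,5) by auto
    ultimately have "S \<subseteq> closure (S - \<Union>\<F>)" by (simp add: INT_extend_simps(4)[symmetric] Sup_upper)
    then show False using assms(2,5) by (simp add: Diff_eq_empty_iff[THEN iffD2])
  qed
  then show ?thesis using that by blast
qed

section \<open>From local increase on a dense set to increase\<close>

definition loc_increasing :: "(real \<Rightarrow> real) \<Rightarrow> real \<Rightarrow> bool" where
  "loc_increasing h t \<longleftrightarrow> (\<exists>\<eta>>0. \<forall>s s'. t - \<eta> < s \<longrightarrow> s < s' \<longrightarrow> s' < t + \<eta> \<longrightarrow> h s < h s')"

lemma open_loc_increasing: "open {t. loc_increasing h t}"
  unfolding open_dist
proof (intro ballI)
  fix t assume "t \<in> {t. loc_increasing h t}"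
  then obtain \<eta> where \<eta>: "\<eta> > 0" "\<And>s s'. t - \<eta> < s \<Longrightarrow> s < s' \<Longrightarrow> s' < t + \<eta> \<Longrightarrow> h s < h s'"
    unfolding loc_increasing_def by blast
  have "loc_increasing h u" if u: "\<bar>u - t\<bar> < \<eta> / 2" for u
    unfolding loc_increasing_def
  proof (intro exI[of _ "\<eta> / 2"] conjI allI impI)
    fix s s' assume "u - \<eta> / 2 < s" "s < s'" "s' < u + \<eta> / 2"
    then show "h s < h s'" using u by (intro \<eta>(2)) linarith+
  qed (use \<eta> in simp)
  then show "\<exists>e>0. \<forall>y. dist y t < e \<longrightarrow> y \<in> {t. loc_increasing h t}"
    using \<eta>(1) by (intro exI[of _ "\<eta> / 2"]) (auto simp: dist_real_def)
qed

text \<open>A maximum of h over a compact subinterval can only lie at its right end, because h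
  increases to the right of every other point.\<close>

lemma loc_increasing_interval:
  assumes "continuous_on {s..t} h" "s < t" "\<And>u. s < u \<Longrightarrow> u < t \<Longrightarrow> loc_increasing h u"
  shows "h s < h t"
proof -
  have 1: "h u < h u'" if "s < u" "u < u'" "u' < t" for u u'
  proof -
    have "continuous_on {u..u'} h" by (rule continuous_on_subset[OF assms(1)]) (use that in auto)
    then have "\<exists>m\<in>{u..u'}. \<forall>y\<in>{u..u'}. h y \<le> h m"
      using that by (intro continuous_attains_sup) auto
    then obtain m where m: "m \<in> {u..u'}" "\<And>y. y \<in> {u..u'} \<Longrightarrow> h y \<le> h m" by blast
    have right: False if n: "n \<in> {u..<u'}" and max: "\<And>y. y \<in> {u..u'} \<Longrightarrow> h y \<le> h n" for n
    proof -
      have "loc_increasing h n" by (rule assms(3)) (use n that \<open>s < u\<close> \<open>u' < t\<close> in auto)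
      then obtain \<eta> where \<eta>: "\<eta> > 0" "\<And>s s'. n - \<eta> < s \<Longrightarrow> s < s' \<Longrightarrow> s' < n + \<eta> \<Longrightarrow> h s < h s'"
        unfolding loc_increasing_def by blast
      define y where "y = min u' (n + \<eta> / 2)"
      have y: "n < y" "y < n + \<eta>" "y \<in> {u..u'}" using n \<eta>(1) by (auto simp: y_def min_def)
      have "h n < h y" by (rule \<eta>(2)) (use y \<eta>(1) in auto)
      then show False using max[OF y(3)] by simp
    qed
    have "m = u'" using right[of m] m by force
    moreover have "h u \<noteq> h m" using right[of u] m(2) that by force
    moreover have "h u \<le> h m" using m(2) that by simp
    ultimately show ?thesis by simp
  qed
  \<comment> \<open>Local increase is known only strictly between s and t. The strict gain comes
    from the middle third; the ends are reached by continuity.\<close>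
  define u u' where "u = (2 * s + t) / 3" and "u' = (s + 2 * t) / 3"
  have u: "s < u" "u < u'" "u' < t" using assms(2) by (auto simp: u_def u'_def)
  have "h s \<le> h u"
  proof (rule continuous_le_on_closure[of "{s<..<u}" h])
    show "continuous_on (closure {s<..<u}) h"
      by (rule continuous_on_subset[OF assms(1)]) (use u in auto)
    show "h y \<le> h u" if "y \<in> {s<..<u}" for y using 1[of y u] that u by auto
  qed (use u in auto)
  moreover have "h u' \<le> h t"
  proof (rule continuous_ge_on_closure[of "{u'<..<t}" h])
    show "continuous_on (closure {u'<..<t}) h"
      by (rule continuous_on_subset[OF assms(1)]) (use u in auto)
    show "h u' \<le> h y" if "y \<in> {u'<..<t}" for y using 1[of u' y] that u by auto
  qed (use u in auto)
  ultimately show ?thesis using 1[OF u] by linarith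
qed

definition signed_at :: "(real \<Rightarrow> real) \<Rightarrow> real \<Rightarrow> bool" where
  "signed_at h t \<longleftrightarrow> (\<exists>\<eta>>0. \<forall>s. t < s \<longrightarrow> s < t + \<eta> \<longrightarrow> h t \<le> h s) \<or>
    (\<exists>\<eta>>0. \<forall>s. t < s \<longrightarrow> s < t + \<eta> \<longrightarrow> h s \<le> h t)"

text \<open>Capping t + d at \<beta> makes the condition meaningful for all t of the interval, so
  that the set is an intersection over d of closed sets.\<close>

lemma closed_right_increase:
  fixes h :: "real \<Rightarrow> real"
  assumes "continuous_on {\<alpha>..\<beta>} h"
  shows "closed {t\<in>{\<alpha>..\<beta>}. \<forall>d. 0 < d \<longrightarrow> d < \<eta> \<longrightarrow> h t \<le> h (min (t + d) \<beta>)}"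
proof -
  have "closed ({\<alpha>..\<beta>} \<inter> (\<lambda>t. h (min (t + d) \<beta>) - h t) -` {0..})" if "d > 0" for d
    by (intro continuous_closed_preimage continuous_on_diff assms continuous_on_compose2[OF assms] continuous_intros)
       (use that in auto)
  then have "closed (\<Inter>d\<in>{0<..<\<eta>}. {\<alpha>..\<beta>} \<inter> (\<lambda>t. h (min (t + d) \<beta>) - h t) -` {0..})"
    by (intro closed_INT) auto
  then have "closed ({\<alpha>..\<beta>} \<inter> (\<Inter>d\<in>{0<..<\<eta>}. {\<alpha>..\<beta>} \<inter> (\<lambda>t. h (min (t + d) \<beta>) - h t) -` {0..}))"
    by (intro closed_Int) auto
  also have "{\<alpha>..\<beta>} \<inter> (\<Inter>d\<in>{0<..<\<eta>}. {\<alpha>..\<beta>} \<inter> (\<lambda>t. h (min (t + d) \<beta>) - h t) -` {0..}) =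
    {t\<in>{\<alpha>..\<beta>}. \<forall>d. 0 < d \<longrightarrow> d < \<eta> \<longrightarrow> h t \<le> h (min (t + d) \<beta>)}" by auto
  finally show ?thesis .
qed

text \<open>The points where a given sign persists on a right interval of length 1/(n + 1) form a
  closed set, and countably many such sets cover K. By Baire one of them contains a portion of K, on
  which sign and length are uniform. The comparison point t ranges over all parameters slightly to
  the right, in K or not.\<close>

lemma signed_uniform_on_portion:
  fixes h :: "real \<Rightarrow> real"
  assumes cont: "continuous_on {\<alpha>..\<beta>} h" and sg: "\<And>t. \<alpha> \<le> t \<Longrightarrow> t < \<beta> \<Longrightarrow> signed_at h t"
    and K: "closed K" "K \<noteq> {}" "K \<subseteq> {\<alpha>..\<beta>}"
  obtains x e \<eta> where "x \<in> K" "e > 0" "\<eta> > 0"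
    "(\<forall>s\<in>K \<inter> ball x e. \<forall>t. s < t \<longrightarrow> t < s + \<eta> \<longrightarrow> t \<le> \<beta> \<longrightarrow> h s \<le> h t) \<or>
     (\<forall>s\<in>K \<inter> ball x e. \<forall>t. s < t \<longrightarrow> t < s + \<eta> \<longrightarrow> t \<le> \<beta> \<longrightarrow> h t \<le> h s)"
proof -
  define X where "X k \<eta> = {t\<in>{\<alpha>..\<beta>}. \<forall>d. 0 < d \<longrightarrow> d < \<eta> \<longrightarrow> k t \<le> k (min (t + d) \<beta>)}" for k :: "real \<Rightarrow> real" and \<eta>
  define \<F> where "\<F> = (\<Union>n::nat. {X h (1 / Suc n), X (\<lambda>t. - h t) (1 / Suc n)})"
  have Xl: "h s \<le> h t" if "s \<in> X h \<eta>" "s < t" "t < s + \<eta>" "t \<le> \<beta>" for s t \<eta> and h :: "real \<Rightarrow> real"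
  proof -
    have "0 < t - s" "t - s < \<eta>" using that by auto
    then have "h s \<le> h (min (s + (t - s)) \<beta>)" using that(1) unfolding X_def by blast
    then show ?thesis using that by (simp add: min_absorb1)
  qed
  have Xi: "\<exists>n. t \<in> X h (1 / Suc n)"
    if t: "t \<in> {\<alpha>..\<beta>}" and \<eta>: "\<eta> > 0" and le: "\<And>s. t < s \<Longrightarrow> s < t + \<eta> \<Longrightarrow> s \<le> \<beta> \<Longrightarrow> h t \<le> h s" for t \<eta> and h :: "real \<Rightarrow> real"
  proof -
    obtain n where n: "1 / Suc n < \<eta>" using \<eta> nat_approx_posE by blast
    have "h t \<le> h (min (t + d) \<beta>)" if d: "0 < d" "d < 1 / Suc n" for d
    proof (cases "t = \<beta>")
      case True
      then show ?thesis using d by (simp add: min_def)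
    next
      case False
      then show ?thesis using d n t by (intro le) (auto simp: min_def)
    qed
    then show ?thesis using t unfolding X_def by blast
  qed
  have "K \<subseteq> \<Union>\<F>"
  proof
    fix t assume "t \<in> K"
    then have t: "t \<in> {\<alpha>..\<beta>}" using K by auto
    have "(\<exists>n. t \<in> X h (1 / Suc n)) \<or> (\<exists>n. t \<in> X (\<lambda>t. - h t) (1 / Suc n))"
    \<comment> \<open>At \<beta> nothing lies to the right, so the capped condition holds
      trivially.\<close>
    proof (cases "t = \<beta>")
      case True
      then show ?thesis using Xi[OF t, of 1 h] by auto
    next
      case False
      then have "signed_at h t" using t by (intro sg) auto
      then show ?thesis
        unfolding signed_at_def
      proof
        assume "\<exists>\<eta>>0. \<forall>s. t < s \<longrightarrow> s < t + \<eta> \<longrightarrow> h t \<le> h s"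
        then show ?thesis using Xi[OF t, of _ h] by blast
      next
        assume "\<exists>\<eta>>0. \<forall>s. t < s \<longrightarrow> s < t + \<eta> \<longrightarrow> h s \<le> h t"
        then show ?thesis using Xi[OF t, of _ "\<lambda>t. - h t"] by auto
      qed
    qed
    then show "t \<in> \<Union>\<F>" unfolding \<F>_def by blast
  qed
  moreover have "closed T" if "T \<in> \<F>" for T
    using that closed_right_increase[OF cont] closed_right_increase[OF continuous_on_minus[OF cont]]
    unfolding \<F>_def X_def by auto
  moreover have "countable \<F>" unfolding \<F>_def by auto
  ultimately obtain T x e where T: "T \<in> \<F>" "x \<in> K" "e > 0" "K \<inter> ball x e \<subseteq> T"
    using closed_cover_contains_ball[OF K(1,2)] by metis
  then obtain n where "T = X h (1 / Suc n) \<or> T = X (\<lambda>t. - h t) (1 / Suc n)" unfolding \<F>_def by blast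
  then show ?thesis
  proof
    assume "T = X h (1 / Suc n)"
    then show ?thesis using T Xl[of _ h "1 / Suc n"] by (intro that[of x e "1 / Suc n"]) auto
  next
    assume "T = X (\<lambda>t. - h t) (1 / Suc n)"
    then show ?thesis using T Xl[of _ "\<lambda>t. - h t" "1 / Suc n"] by (intro that[of x e "1 / Suc n"]) auto
  qed
qed

lemma closed_in_interval_gaps:
  fixes K :: "real set"
  assumes "closed K" "K \<inter> {s..t} \<noteq> {}"
  obtains \<sigma> \<sigma>' where "\<sigma> \<in> K" "s \<le> \<sigma>" "\<And>u. s \<le> u \<Longrightarrow> u < \<sigma> \<Longrightarrow> u \<notin> K" "\<sigma> \<le> t"
    "\<sigma>' \<in> K" "\<sigma>' \<le> t" "\<And>u. \<sigma>' < u \<Longrightarrow> u \<le> t \<Longrightarrow> u \<notin> K" "s \<le> \<sigma>'"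
proof -
  have c: "compact (K \<inter> {s..t})" using assms(1) by (intro closed_Int_compact) auto
  obtain \<sigma> where "\<sigma> \<in> K \<inter> {s..t}" "\<forall>u\<in>K \<inter> {s..t}. \<sigma> \<le> u"
    using compact_attains_inf[OF c assms(2)] by blast
  moreover obtain \<sigma>' where "\<sigma>' \<in> K \<inter> {s..t}" "\<forall>u\<in>K \<inter> {s..t}. u \<le> \<sigma>'"
    using compact_attains_sup[OF c assms(2)] by blast
  ultimately show ?thesis by (intro that[of \<sigma> \<sigma>']) force+
qed

text \<open>Let K be the closed set where h is not locally increasing. If it meets the open
  interval, some portion of K has a uniform sign. If values rise to the right of the points of that
  portion, h increases there and also across the gaps of K, hence near a point of K, against the
  definition of K. If values fall, a gap following a point of K gives a contradiction, since h
  increases on it.\<close>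

lemma signed_increasing:
  assumes cont: "continuous_on {a<..<b} h" and sg: "\<And>t. a < t \<Longrightarrow> t < b \<Longrightarrow> signed_at h t"
    and dense: "\<And>p q. a < p \<Longrightarrow> p < q \<Longrightarrow> q < b \<Longrightarrow> \<exists>t. p < t \<and> t < q \<and> loc_increasing h t"
    and pq: "a < p" "p < q" "q < b"
  shows "h p \<le> h q"
proof -
  define K where "K = - {t. loc_increasing h t}"
  have K: "closed K" unfolding K_def using open_loc_increasing by auto
  have incr: "h s < h t" if "a < s" "s < t" "t < b" "\<And>u. s < u \<Longrightarrow> u < t \<Longrightarrow> u \<notin> K" for s t
    by (rule loc_increasing_interval[OF continuous_on_subset[OF cont]]) (use that in \<open>auto simp: K_def\<close>)
  have "False" if k: "k \<in> K" "p < k" "k < q" for k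
  proof -
    \<comment> \<open>End points outside K force the centre x of the portion to lie strictly between
      them.\<close>
    obtain \<alpha> where \<alpha>: "p < \<alpha>" "\<alpha> < k" "\<alpha> \<notin> K" using dense[of p k] k pq by (auto simp: K_def)
    obtain \<beta> where \<beta>: "k < \<beta>" "\<beta> < q" "\<beta> \<notin> K" using dense[of k q] k pq by (auto simp: K_def)
    define K' where "K' = K \<inter> {\<alpha>..\<beta>}"
    have "closed K'" "K' \<noteq> {}" "K' \<subseteq> {\<alpha>..\<beta>}" using K k \<alpha> \<beta> by (auto simp: K'_def)
    then obtain x e \<eta> where x: "x \<in> K'" and e: "e > 0" and \<eta>: "\<eta> > 0"
      and alt: "(\<forall>s\<in>K' \<inter> ball x e. \<forall>t. s < t \<longrightarrow> t < s + \<eta> \<longrightarrow> t \<le> \<beta> \<longrightarrow> h s \<le> h t) \<or>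
        (\<forall>s\<in>K' \<inter> ball x e. \<forall>t. s < t \<longrightarrow> t < s + \<eta> \<longrightarrow> t \<le> \<beta> \<longrightarrow> h t \<le> h s)"
      using signed_uniform_on_portion[of \<alpha> \<beta> h K'] continuous_on_subset[OF cont, of "{\<alpha>..\<beta>}"] sg \<alpha> \<beta> pq
      by (smt (verit) atLeastAtMost_iff greaterThanLessThan_iff subsetI)
    have "x \<noteq> \<alpha>" "x \<noteq> \<beta>" using x \<alpha> \<beta> by (auto simp: K'_def)
    then have x\<alpha>\<beta>: "\<alpha> < x" "x < \<beta>" using x by (auto simp: K'_def)
    \<comment> \<open>Half of \<eta>, so that two points within \<epsilon> of x are less than \<eta>
      apart.\<close>
    define \<epsilon> where "\<epsilon> = min (min e (\<eta> / 2)) (min (x - \<alpha>) (\<beta> - x))"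
    have \<epsilon>: "\<epsilon> > 0" "\<epsilon> \<le> e" "\<epsilon> \<le> \<eta> / 2" "\<alpha> \<le> x - \<epsilon>" "x + \<epsilon> \<le> \<beta>"
      using e \<eta> x\<alpha>\<beta> by (auto simp: \<epsilon>_def min_def)
    have inK: "s \<in> K' \<inter> ball x e" if "s \<in> K" "x - \<epsilon> < s" "s < x + \<epsilon>" for s
      using that \<epsilon> by (auto simp: K'_def dist_real_def)
    from alt show False
    proof
      assume up: "\<forall>s\<in>K' \<inter> ball x e. \<forall>t. s < t \<longrightarrow> t < s + \<eta> \<longrightarrow> t \<le> \<beta> \<longrightarrow> h s \<le> h t"
      have upK: "h s \<le> h t" if "s \<in> K" "x - \<epsilon> < s" "s \<le> t" "t < x + \<epsilon>" for s t
      proof (cases "s = t")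
        case False
        then show ?thesis using up[rule_format, OF inK[OF that(1)], of t] that \<epsilon> by auto
      qed simp
      \<comment> \<open>Increase through the gap up to the next point of K, then from that point by
        the uniform sign.\<close>
      have weak: "h s \<le> h t" if st: "x - \<epsilon> < s" "s < t" "t < x + \<epsilon>" for s t
      proof (cases "K \<inter> {s..t} = {}")
        case True
        have "h s < h t" by (rule incr) (use st \<epsilon> \<alpha> \<beta> pq True in auto)
        then show ?thesis by simp
      next
        case False
        obtain \<sigma> where \<sigma>: "\<sigma> \<in> K" "s \<le> \<sigma>" "\<And>u. s \<le> u \<Longrightarrow> u < \<sigma> \<Longrightarrow> u \<notin> K" "\<sigma> \<le> t"
          by (rule closed_in_interval_gaps[OF K False]) blast
        have "h s \<le> h \<sigma>"
        proof (cases "s = \<sigma>")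
          case False
          have "h s < h \<sigma>" by (rule incr) (use st \<epsilon> \<alpha> \<beta> pq \<sigma> False in auto)
          then show ?thesis by simp
        qed simp
        also have "\<dots> \<le> h t" by (rule upK) (use \<sigma> st in auto)
        finally show ?thesis .
      qed
      \<comment> \<open>A point of local increase between s and t makes the inequality
        strict.\<close>
      have "h s < h t" if st: "x - \<epsilon> < s" "s < t" "t < x + \<epsilon>" for s t
      proof -
        obtain u where u: "s < u" "u < t" "loc_increasing h u" using dense[of s t] st \<epsilon> \<alpha> \<beta> pq by auto
        then obtain \<mu> where \<mu>: "\<mu> > 0" "\<And>v v'. u - \<mu> < v \<Longrightarrow> v < v' \<Longrightarrow> v' < u + \<mu> \<Longrightarrow> h v < h v'"
          unfolding loc_increasing_def by blast
        define u' where "u' = min (u + \<mu> / 2) ((u + t) / 2)"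
        have u': "u < u'" "u' < u + \<mu>" "u' < t" using u \<mu>(1) by (auto simp: u'_def min_def)
        have "h s \<le> h u" by (rule weak) (use u st in auto)
        also have "h u < h u'" by (rule \<mu>(2)) (use u' \<mu>(1) in auto)
        also have "h u' \<le> h t" by (rule weak) (use u u' st in auto)
        finally show ?thesis .
      qed
      then have "loc_increasing h x" unfolding loc_increasing_def using \<epsilon>(1) by blast
      then show False using x by (auto simp: K'_def K_def)
    next
      assume down: "\<forall>s\<in>K' \<inter> ball x e. \<forall>t. s < t \<longrightarrow> t < s + \<eta> \<longrightarrow> t \<le> \<beta> \<longrightarrow> h t \<le> h s"
      \<comment> \<open>The last point of K before t starts a gap on which h increases strictly,
        whereas the uniform sign at that point says that h falls.\<close>
      obtain t where t: "x < t" "t < x + \<epsilon>" "t \<notin> K"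
        using dense[of x "x + \<epsilon>"] \<epsilon> x\<alpha>\<beta> \<alpha> \<beta> pq by (auto simp: K_def)
      have xt: "K \<inter> {x..t} \<noteq> {}" using x t by (auto simp: K'_def)
      obtain \<sigma> where \<sigma>: "\<sigma> \<in> K" "\<sigma> \<le> t" "\<And>u. \<sigma> < u \<Longrightarrow> u \<le> t \<Longrightarrow> u \<notin> K" "x \<le> \<sigma>"
        by (rule closed_in_interval_gaps[OF K xt]) blast
      have "\<sigma> < t" using \<sigma> t by (cases "\<sigma> = t") auto
      have "h \<sigma> < h t" by (rule incr) (use \<sigma> \<open>\<sigma> < t\<close> t x\<alpha>\<beta> \<alpha> \<beta> \<epsilon> pq in auto)
      moreover have "h t \<le> h \<sigma>"
        using down[rule_format, OF inK[OF \<sigma>(1)], of t] \<sigma> \<open>\<sigma> < t\<close> t \<epsilon> by auto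
      ultimately show False by simp
    qed
  qed
  then have "h p < h q" using pq by (intro incr) auto
  then show ?thesis by simp
qed

text \<open>Tilt h by a small slope to get k and suppose k p > k q. As k maps C to a countable set,
  some level l strictly between is missed by k on C. At the last parameter m where k is at least l
  one has k m = l, so k has a positive derivative at m and cannot stay below l afterwards.\<close>

lemma increasing_countable_exceptions:
  fixes h :: "real \<Rightarrow> real"
  assumes cont: "continuous_on {p..q} h" and "p \<le> q" and C: "countable C"
    and D: "\<And>t. p < t \<Longrightarrow> t < q \<Longrightarrow> t \<notin> C \<Longrightarrow> \<exists>D\<ge>0. (h has_real_derivative D) (at t)"
  shows "h p \<le> h q"
proof (rule field_le_epsilon)
  fix \<epsilon>0 :: real assume "\<epsilon>0 > 0"
  define \<epsilon> where "\<epsilon> = \<epsilon>0 / (q - p + 1)"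
  have \<epsilon>: "\<epsilon> > 0" "\<epsilon> * (q - p) \<le> \<epsilon>0" using \<open>\<epsilon>0 > 0\<close> \<open>p \<le> q\<close> by (auto simp: \<epsilon>_def field_simps)
  define k where "k t = h t + \<epsilon> * (t - p)" for t
  have contk: "continuous_on {p..q} k" unfolding k_def by (intro continuous_intros cont)
  have "k p \<le> k q"
  proof (rule ccontr)
    assume "\<not> k p \<le> k q"
    then have "uncountable {k q<..<k p}" by (simp add: uncountable_open_interval)
    moreover have "countable (k ` C)" using C by simp
    ultimately have "{k q<..<k p} - k ` C \<noteq> {}" by (metis Diff_eq_empty_iff countable_subset)
    then obtain l where "l \<in> {k q<..<k p} - k ` C" by blast
    then have l: "k q < l" "l < k p" "l \<notin> k ` C" by simp_all
    define Z where "Z = {p..q} \<inter> k -` {l..}"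
    have "closed Z" unfolding Z_def by (intro continuous_closed_preimage contk) auto
    then have "compact Z" unfolding Z_def by (meson bounded_Int bounded_closed_interval compact_eq_bounded_closed)
    moreover have "p \<in> Z" using l \<open>p \<le> q\<close> by (auto simp: Z_def)
    ultimately obtain m where m: "m \<in> Z" "\<And>u. u \<in> Z \<Longrightarrow> u \<le> m" using compact_attains_sup[of Z] by auto
    have "m \<noteq> q" using m l by (auto simp: Z_def)
    then have mq: "p \<le> m" "m < q" using m by (auto simp: Z_def)
    have right: "k u < l" if "m < u" "u \<le> q" for u
      using m(2)[of u] that mq by (force simp: Z_def)
    have "k m \<le> l"
    proof (rule continuous_le_on_closure[of "{m<..<q}" k])
      show "continuous_on (closure {m<..<q}) k" by (rule continuous_on_subset[OF contk]) (use mq in auto)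
      show "k y \<le> l" if "y \<in> {m<..<q}" for y using right[of y] that by auto
    qed (use mq in auto)
    then have km: "k m = l" using m by (auto simp: Z_def)
    have "m \<notin> C" "m \<noteq> p" using l km by auto
    then obtain E where E: "E \<ge> 0" "(h has_real_derivative E) (at m)" using D[of m] mq by auto
    have "(k has_real_derivative E + \<epsilon>) (at m)"
      unfolding k_def by (auto intro!: derivative_eq_intros E)
    from DERIV_pos_inc_right[OF this] obtain d where d: "d > 0" "\<And>u. u > 0 \<Longrightarrow> u < d \<Longrightarrow> k m < k (m + u)"
      using E \<epsilon> by auto
    define u where "u = min (d / 2) (q - m)"
    have "u > 0" "u < d" "m + u \<le> q" using d(1) mq by (auto simp: u_def min_def)
    then show False using d(2)[of u] right[of "m + u"] km by auto
  qed
  then show "h p \<le> h q + \<epsilon>0" using \<epsilon>(2) by (simp add: k_def)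
qed

section \<open>Functions of one variable with the regularity that tameness provides\<close>

definition regular_on :: "real \<Rightarrow> real \<Rightarrow> (real \<Rightarrow> real) \<Rightarrow> bool" where
  "regular_on a b g \<longleftrightarrow> continuous_on {a<..<b} g \<and>
    ((\<forall>c t. a < t \<longrightarrow> t < b \<longrightarrow> signed_at (\<lambda>s. g s - c * s) t) \<or>
     (\<exists>C. countable C \<and> (\<forall>t. a < t \<longrightarrow> t < b \<longrightarrow> t \<notin> C \<longrightarrow> C1_at g t)))"

lemma C1_atE:
  assumes "C1_at g t" "\<epsilon> > 0"
  obtains g' \<eta> where "\<eta> > 0" "\<And>s. \<bar>s - t\<bar> < \<eta> \<Longrightarrow> (g has_real_derivative g' s) (at s) \<and> \<bar>g' s - g' t\<bar> < \<epsilon>"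
proof -
  obtain g' where g': "\<forall>\<^sub>F s in nhds t. (g has_real_derivative g' s) (at s)" "isCont g' t"
    using assms(1) unfolding C1_at_def by blast
  have "\<forall>\<^sub>F s in nhds t. dist (g' s) (g' t) < \<epsilon>"
    using g'(2) assms(2) by (simp add: isCont_def tendsto_at_iff_tendsto_nhds tendstoD)
  with g'(1) have "\<forall>\<^sub>F s in nhds t. (g has_real_derivative g' s) (at s) \<and> \<bar>g' s - g' t\<bar> < \<epsilon>"
    by eventually_elim (simp add: dist_real_def)
  then show ?thesis using that unfolding eventually_nhds_metric dist_real_def by blast
qed

text \<open>In the C1 case, a derivative below c at a point t would stay below c nearby, which
  excludes points of local increase of g s - c s there, although these are dense.\<close>

lemma regular_increasing:
  assumes reg: "regular_on a b g"
    and dense: "\<And>p q. a < p \<Longrightarrow> p < q \<Longrightarrow> q < b \<Longrightarrow> \<exists>t. p < t \<and> t < q \<and> loc_increasing (\<lambda>s. g s - c * s) t"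
    and pq: "a < p" "p < q" "q < b"
  shows "g p - c * p \<le> g q - c * q"
proof -
  have cont: "continuous_on {a<..<b} (\<lambda>s. g s - c * s)"
    using reg unfolding regular_on_def by (intro continuous_intros) auto
  consider "\<forall>t. a < t \<longrightarrow> t < b \<longrightarrow> signed_at (\<lambda>s. g s - c * s) t"
    | C where "countable C" "\<And>t. a < t \<Longrightarrow> t < b \<Longrightarrow> t \<notin> C \<Longrightarrow> C1_at g t"
    using reg unfolding regular_on_def by blast
  then show ?thesis
  proof cases
    case 1
    then show ?thesis by (intro signed_increasing[OF cont _ dense pq]) auto
  next
    case 2
    show ?thesis
    proof (rule increasing_countable_exceptions[of p q "\<lambda>s. g s - c * s", OF _ _ 2(1)])
      show "continuous_on {p..q} (\<lambda>s. g s - c * s)"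
        by (rule continuous_on_subset[OF cont]) (use pq in auto)
      fix t assume t: "p < t" "t < q" "t \<notin> C"
      have C1: "C1_at g t" using 2(2) t pq by auto
      obtain \<eta>0 g0 where "\<eta>0 > 0" "\<And>s. \<bar>s - t\<bar> < \<eta>0 \<Longrightarrow> (g has_real_derivative g0 s) (at s) \<and> \<bar>g0 s - g0 t\<bar> < 1"
        using C1_atE[OF C1 zero_less_one] by blast
      then have d: "(g has_real_derivative g0 t) (at t)" by simp
      have "g0 t \<ge> c"
      proof (rule ccontr)
        assume "\<not> g0 t \<ge> c"
        then have cpos: "c - g0 t > 0" by simp
        obtain \<eta> g' where \<eta>: "\<eta> > 0" and g': "\<And>s. \<bar>s - t\<bar> < \<eta> \<Longrightarrow> (g has_real_derivative g' s) (at s) \<and> \<bar>g' s - g' t\<bar> < c - g0 t"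
          by (rule C1_atE[OF C1 cpos]) blast
        have "g' t = g0 t" using DERIV_unique[OF _ d] g'[of t] \<eta> by simp
        then have neg: "(g has_real_derivative g' s) (at s) \<and> g' s < c" if "\<bar>s - t\<bar> < \<eta>" for s
          using g'[OF that] by linarith
        have "\<exists>u. t < u \<and> u < min q (t + \<eta>) \<and> loc_increasing (\<lambda>s. g s - c * s) u"
          by (rule dense) (use t \<eta> pq in auto)
        then obtain u where u: "t < u" "u < min q (t + \<eta>)" "loc_increasing (\<lambda>s. g s - c * s) u" by blast
        obtain \<mu> where \<mu>: "\<mu> > 0" "\<And>v v'. u - \<mu> < v \<Longrightarrow> v < v' \<Longrightarrow> v' < u + \<mu> \<Longrightarrow> g v - c * v < g v' - c * v'"
          using u(3) unfolding loc_increasing_def by blast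
        define v where "v = min (u + \<mu> / 2) ((u + (t + \<eta>)) / 2)"
        have u\<eta>: "u < t + \<eta>" using u(2) by simp
        have v: "u < v" "v < u + \<mu>" "v < t + \<eta>" using \<mu>(1) u\<eta> by (auto simp: v_def min_def)
        have "\<exists>\<xi>>u. \<xi> < v \<and> g v - g u = (v - u) * g' \<xi>"
          by (rule MVT2[OF v(1)]) (use neg u v in auto)
        then obtain \<xi> where \<xi>: "u < \<xi>" "\<xi> < v" "g v - g u = (v - u) * g' \<xi>" by blast
        have "g' \<xi> < c" using neg[of \<xi>] \<xi> u v by auto
        then have "g v - g u < (v - u) * c" unfolding \<xi>(3) using v(1) by (intro mult_strict_left_mono) auto
        moreover have "g u - c * u < g v - c * v" by (rule \<mu>(2)) (use v \<mu>(1) in auto)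
        ultimately show False by (simp add: algebra_simps)
      qed
      then show "\<exists>D\<ge>0. ((\<lambda>s. g s - c * s) has_real_derivative D) (at t)"
        by (intro exI[of _ "g0 t - c"]) (auto intro!: derivative_eq_intros d)
    qed (use pq in auto)
  qed
qed

section \<open>Near affinity on subintervals\<close>

definition slope_bounds :: "(real \<Rightarrow> real) \<Rightarrow> real \<Rightarrow> real \<Rightarrow> real \<Rightarrow> real \<Rightarrow> bool" where
  "slope_bounds g c c' p q \<longleftrightarrow> (\<forall>s t. p \<le> s \<longrightarrow> s < t \<longrightarrow> t \<le> q \<longrightarrow> c * (t - s) \<le> g t - g s \<and> g t - g s \<le> c' * (t - s))"

text \<open>Here the closed set is the whole interval, so the portion with a uniform sign contains
  an interval.\<close>

lemma signed_monotone_subinterval: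
  fixes g :: "real \<Rightarrow> real"
  assumes cont: "continuous_on {p..q} g" and "p < q"
    and sg: "\<And>t. p \<le> t \<Longrightarrow> t < q \<Longrightarrow> signed_at (\<lambda>s. g s - c * s) t"
  obtains p' q' where "p \<le> p'" "p' < q'" "q' \<le> q"
    "(\<forall>s t. p' \<le> s \<longrightarrow> s < t \<longrightarrow> t \<le> q' \<longrightarrow> c * (t - s) \<le> g t - g s) \<or>
     (\<forall>s t. p' \<le> s \<longrightarrow> s < t \<longrightarrow> t \<le> q' \<longrightarrow> g t - g s \<le> c * (t - s))"
proof -
  have "continuous_on {p..q} (\<lambda>s. g s - c * s)" by (intro continuous_intros cont)
  then obtain x e \<eta> where x: "x \<in> {p..q}" "e > 0" "\<eta> > 0" and alt:
    "(\<forall>s\<in>{p..q} \<inter> ball x e. \<forall>t. s < t \<longrightarrow> t < s + \<eta> \<longrightarrow> t \<le> q \<longrightarrow> g s - c * s \<le> g t - c * t) \<or>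
     (\<forall>s\<in>{p..q} \<inter> ball x e. \<forall>t. s < t \<longrightarrow> t < s + \<eta> \<longrightarrow> t \<le> q \<longrightarrow> g t - c * t \<le> g s - c * s)"
    using signed_uniform_on_portion[of p q "\<lambda>s. g s - c * s" "{p..q}"] sg \<open>p < q\<close> by auto
  \<comment> \<open>A third, so that points within \<epsilon> of x lie in the ball and are less than
    \<eta> apart.\<close>
  define \<epsilon> where "\<epsilon> = min e \<eta> / 3"
  have \<epsilon>: "\<epsilon> > 0" "\<epsilon> < e" "2 * \<epsilon> < \<eta>" using x by (auto simp: \<epsilon>_def min_def)
  define p' q' where "p' = max p (x - \<epsilon>)" and "q' = min q (x + \<epsilon>)"
  have pq': "p \<le> p'" "p' < q'" "q' \<le> q" using x \<epsilon> \<open>p < q\<close> by (auto simp: p'_def q'_def)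
  have *: "s \<in> {p..q} \<inter> ball x e" "t < s + \<eta>" "t \<le> q" if "p' \<le> s" "s < t" "t \<le> q'" for s t
    using that \<epsilon> by (auto simp: p'_def q'_def dist_real_def)
  from alt show ?thesis
  proof
    assume A: "\<forall>s\<in>{p..q} \<inter> ball x e. \<forall>t. s < t \<longrightarrow> t < s + \<eta> \<longrightarrow> t \<le> q \<longrightarrow> g s - c * s \<le> g t - c * t"
    have "c * (t - s) \<le> g t - g s" if "p' \<le> s" "s < t" "t \<le> q'" for s t
      using A[rule_format, OF *(1)[OF that] that(2) *(2,3)[OF that]] by (simp add: algebra_simps)
    then show ?thesis using that pq' by blast
  next
    assume A: "\<forall>s\<in>{p..q} \<inter> ball x e. \<forall>t. s < t \<longrightarrow> t < s + \<eta> \<longrightarrow> t \<le> q \<longrightarrow> g t - c * t \<le> g s - c * s"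
    have "g t - g s \<le> c * (t - s)" if "p' \<le> s" "s < t" "t \<le> q'" for s t
      using A[rule_format, OF *(1)[OF that] that(2) *(2,3)[OF that]] by (simp add: algebra_simps)
    then show ?thesis using that pq' by blast
  qed
qed

lemma slope_bounds_mono: "slope_bounds g c c' p q \<Longrightarrow> p \<le> p' \<Longrightarrow> q' \<le> q \<Longrightarrow> slope_bounds g c c' p' q'"
  unfolding slope_bounds_def by (meson order_trans)

text \<open>If the upper slope bound C failed on every subinterval, each subinterval would contain
  one with lower slope C, hence points where g s - C' s increases locally. This function would then
  increase from p to q, but C' exceeds the mean slope of g.\<close>

lemma signed_lower_slope_imp_slope_bounds:
  fixes g :: "real \<Rightarrow> real"
  assumes cont: "continuous_on {p..q} g" and pq: "p < q"
    and sg: "\<And>c t. p \<le> t \<Longrightarrow> t < q \<Longrightarrow> signed_at (\<lambda>s. g s - c * s) t"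
    and low: "\<And>s t. p \<le> s \<Longrightarrow> s < t \<Longrightarrow> t \<le> q \<Longrightarrow> c * (t - s) \<le> g t - g s"
  obtains p' q' c' where "p \<le> p'" "p' < q'" "q' \<le> q" "slope_bounds g c c' p' q'"
proof -
  define C' where "C' = (g q - g p) / (q - p) + 1"
  \<comment> \<open>Larger than C', so that the local increase of g s - C' s is strict.\<close>
  define C where "C = C' + 1"
  have "\<exists>p' q'. p \<le> p' \<and> p' < q' \<and> q' \<le> q \<and> (\<forall>s t. p' \<le> s \<longrightarrow> s < t \<longrightarrow> t \<le> q' \<longrightarrow> g t - g s \<le> C * (t - s))"
  proof (rule ccontr)
    assume no: "\<not> ?thesis"
    have reg: "regular_on p q g"
      unfolding regular_on_def
    proof (intro conjI disjI1 allI impI)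
      show "continuous_on {p<..<q} g" by (rule continuous_on_subset[OF cont]) auto
    qed (use sg in auto)
    have dense: "\<exists>t. u < t \<and> t < v \<and> loc_increasing (\<lambda>s. g s - C' * s) t" if uv: "p < u" "u < v" "v < q" for u v
    proof -
      obtain u' v' where uv': "u \<le> u'" "u' < v'" "v' \<le> v" and alt:
        "(\<forall>s t. u' \<le> s \<longrightarrow> s < t \<longrightarrow> t \<le> v' \<longrightarrow> C * (t - s) \<le> g t - g s) \<or>
         (\<forall>s t. u' \<le> s \<longrightarrow> s < t \<longrightarrow> t \<le> v' \<longrightarrow> g t - g s \<le> C * (t - s))"
      proof (rule signed_monotone_subinterval[of u v g C])
        show "continuous_on {u..v} g" by (rule continuous_on_subset[OF cont]) (use uv in auto)
        show "signed_at (\<lambda>s. g s - C * s) t" if "u \<le> t" "t < v" for t using that uv by (intro sg) auto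
      qed (use uv in blast)+
      then have up: "C * (t - s) \<le> g t - g s" if "u' \<le> s" "s < t" "t \<le> v'" for s t
      proof -
        have "\<not> (\<forall>s t. u' \<le> s \<longrightarrow> s < t \<longrightarrow> t \<le> v' \<longrightarrow> g t - g s \<le> C * (t - s))"
        proof
          assume "\<forall>s t. u' \<le> s \<longrightarrow> s < t \<longrightarrow> t \<le> v' \<longrightarrow> g t - g s \<le> C * (t - s)"
          moreover have "p \<le> u'" "v' \<le> q" using uv uv' by auto
          ultimately show False using no uv'(2) by blast
        qed
        then show ?thesis using alt that by blast
      qed
      define t where "t = (u' + v') / 2"
      have "loc_increasing (\<lambda>s. g s - C' * s) t"
        unfolding loc_increasing_def
      proof (intro exI[of _ "(v' - u') / 2"] conjI allI impI)
        fix s s' assume s: "t - (v' - u') / 2 < s" "s < s'" "s' < t + (v' - u') / 2"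
        have "C' * (s' - s) < C * (s' - s)" using s by (simp add: C_def)
        also have "\<dots> \<le> g s' - g s" by (rule up) (use s in \<open>auto simp: t_def field_simps\<close>)
        finally show "g s - C' * s < g s' - C' * s'" by (simp add: algebra_simps)
      qed (use uv' in simp)
      then show ?thesis using uv' by (intro exI[of _ t]) (auto simp: t_def)
    qed
    have mid: "g u - C' * u \<le> g v - C' * v" if "p < u" "u < v" "v < q" for u v
      by (rule regular_increasing[OF reg dense that])
    have contC: "continuous_on {p..q} (\<lambda>s. g s - C' * s)" by (intro continuous_intros cont)
    define m where "m = (p + q) / 2"
    have m: "p < m" "m < q" using pq by (auto simp: m_def)
    have "g p - C' * p \<le> g m - C' * m"
    proof (rule continuous_le_on_closure[of "{p<..<m}" "\<lambda>s. g s - C' * s"])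
      show "continuous_on (closure {p<..<m}) (\<lambda>s. g s - C' * s)"
        by (rule continuous_on_subset[OF contC]) (use m in auto)
    qed (use m mid in auto)
    moreover have "g m - C' * m \<le> g q - C' * q"
    proof (rule continuous_ge_on_closure[of "{m<..<q}" "\<lambda>s. g s - C' * s"])
      show "continuous_on (closure {m<..<q}) (\<lambda>s. g s - C' * s)"
        by (rule continuous_on_subset[OF contC]) (use m in auto)
    qed (use m mid in auto)
    ultimately have "C' * (q - p) \<le> g q - g p" by (simp add: algebra_simps)
    moreover have "C' * (q - p) = g q - g p + (q - p)" using pq by (simp add: C'_def distrib_right)
    ultimately show False using pq by simp
  qed
  then obtain p' q' where pq': "p \<le> p'" "p' < q'" "q' \<le> q"
    "\<And>s t. p' \<le> s \<Longrightarrow> s < t \<Longrightarrow> t \<le> q' \<Longrightarrow> g t - g s \<le> C * (t - s)" by blast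
  then have "slope_bounds g c C p' q'"
    unfolding slope_bounds_def using low by (meson order_trans)
  then show ?thesis using that pq' by blast
qed

lemma signed_at_uminus: "signed_at h t \<Longrightarrow> signed_at (\<lambda>s. - h s) t"
  unfolding signed_at_def by simp blast

text \<open>In the signed case the sign for slope 0 gives a one-sided slope bound on a subinterval,
  which is completed to a two-sided one. The sign for the midpoint of the slope interval then halves
  that interval on a further subinterval, as often as desired. In the C1 case a right neighbourhood
  of any point off C will do.\<close>

lemma regular_almost_affine:
  fixes g :: "real \<Rightarrow> real"
  assumes reg: "regular_on a b g" and "a < b" "\<epsilon> > 0"
  obtains p q c where "a < p" "p < q" "q < b" "\<And>s t. p \<le> s \<Longrightarrow> s < t \<Longrightarrow> t \<le> q \<Longrightarrow> \<bar>g t - g s - c * (t - s)\<bar> \<le> \<epsilon> * (t - s)"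
proof -
  have cont: "continuous_on {a<..<b} g" using reg unfolding regular_on_def by blast
  consider "\<forall>c t. a < t \<longrightarrow> t < b \<longrightarrow> signed_at (\<lambda>s. g s - c * s) t"
    | C where "countable C" "\<And>t. a < t \<Longrightarrow> t < b \<Longrightarrow> t \<notin> C \<Longrightarrow> C1_at g t"
    using reg unfolding regular_on_def by blast
  then show ?thesis
  proof cases
    case 1
    define p0 q0 where "p0 = (2 * a + b) / 3" and "q0 = (a + 2 * b) / 3"
    have pq0: "a < p0" "p0 < q0" "q0 < b" using \<open>a < b\<close> by (auto simp: p0_def q0_def)
    have contI: "continuous_on {p..q} g" if "a < p" "q < b" for p q
      by (rule continuous_on_subset[OF cont]) (use that in auto)
    obtain p1 q1 where pq1: "p0 \<le> p1" "p1 < q1" "q1 \<le> q0" and alt: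
      "(\<forall>s t. p1 \<le> s \<longrightarrow> s < t \<longrightarrow> t \<le> q1 \<longrightarrow> 0 * (t - s) \<le> g t - g s) \<or>
       (\<forall>s t. p1 \<le> s \<longrightarrow> s < t \<longrightarrow> t \<le> q1 \<longrightarrow> g t - g s \<le> 0 * (t - s))"
    proof (rule signed_monotone_subinterval[OF contI[OF pq0(1,3)] pq0(2), of 0])
      show "signed_at (\<lambda>s. g s - 0 * s) t" if "p0 \<le> t" "t < q0" for t
        by (rule 1[rule_format]) (use that pq0 in auto)
    qed blast
    have "\<exists>p q c c'. a < p \<and> p < q \<and> q < b \<and> slope_bounds g c c' p q"
      using alt
    proof
      assume A: "\<forall>s t. p1 \<le> s \<longrightarrow> s < t \<longrightarrow> t \<le> q1 \<longrightarrow> 0 * (t - s) \<le> g t - g s"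
      obtain p q c' where "p1 \<le> p" "p < q" "q \<le> q1" "slope_bounds g 0 c' p q"
        by (rule signed_lower_slope_imp_slope_bounds[of p1 q1 g 0]) (use contI 1 pq0 pq1 A in auto)
      then show ?thesis using pq0 pq1 by (meson less_le_trans le_less_trans)
    next
      assume A: "\<forall>s t. p1 \<le> s \<longrightarrow> s < t \<longrightarrow> t \<le> q1 \<longrightarrow> g t - g s \<le> 0 * (t - s)"
      have sgm: "signed_at (\<lambda>s. - g s - c * s) t" if "a < t" "t < b" for c t
        using signed_at_uminus[OF 1[rule_format, OF that, of "- c"]] by simp
      obtain p q c' where pq: "p1 \<le> p" "p < q" "q \<le> q1" "slope_bounds (\<lambda>s. - g s) 0 c' p q"
        by (rule signed_lower_slope_imp_slope_bounds[of p1 q1 "\<lambda>s. - g s" 0])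
           (use contI sgm pq0 pq1 A in \<open>auto intro: continuous_on_minus\<close>)
      then have "slope_bounds g (- c') 0 p q" unfolding slope_bounds_def by force
      then show ?thesis using pq pq0 pq1 by (meson less_le_trans le_less_trans)
    qed
    then obtain p2 q2 c0 c0' where init: "a < p2" "p2 < q2" "q2 < b" "slope_bounds g c0 c0' p2 q2" by blast
    have "\<exists>p q c c'. a < p \<and> p < q \<and> q < b \<and> slope_bounds g c c' p q \<and> c' - c \<le> (c0' - c0) / 2 ^ n" for n :: nat
    proof (induction n)
      case 0
      then show ?case using init by force
    next
      case (Suc n)
      then obtain p q c c' where IH: "a < p" "p < q" "q < b" "slope_bounds g c c' p q" "c' - c \<le> (c0' - c0) / 2 ^ n" by blast
      define m where "m = (c + c') / 2"
      obtain p' q' where pq': "p \<le> p'" "p' < q'" "q' \<le> q" and alt: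
        "(\<forall>s t. p' \<le> s \<longrightarrow> s < t \<longrightarrow> t \<le> q' \<longrightarrow> m * (t - s) \<le> g t - g s) \<or>
         (\<forall>s t. p' \<le> s \<longrightarrow> s < t \<longrightarrow> t \<le> q' \<longrightarrow> g t - g s \<le> m * (t - s))"
      proof (rule signed_monotone_subinterval[OF contI[OF IH(1,3)] IH(2), of m])
        show "signed_at (\<lambda>s. g s - m * s) t" if "p \<le> t" "t < q" for t
          by (rule 1[rule_format]) (use that IH in auto)
      qed blast
      have sb: "slope_bounds g c c' p' q'" by (rule slope_bounds_mono[OF IH(4) pq'(1,3)])
      then have "slope_bounds g m c' p' q' \<or> slope_bounds g c m p' q'"
        using alt unfolding slope_bounds_def by blast
      moreover have "c' - m \<le> (c0' - c0) / 2 ^ Suc n" "m - c \<le> (c0' - c0) / 2 ^ Suc n"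
        using IH(5) by (auto simp: m_def field_simps)
      ultimately show ?case using pq' IH(1,3) by (meson less_le_trans le_less_trans)
    qed
    moreover obtain n where "(c0' - c0) / 2 ^ n < \<epsilon>"
    proof -
      obtain n where "(c0' - c0) / \<epsilon> < 2 ^ n" using real_arch_pow[of 2] by auto
      then show ?thesis using that \<open>\<epsilon> > 0\<close> by (simp add: field_simps)
    qed
    ultimately obtain p q c c' where pq: "a < p" "p < q" "q < b" "slope_bounds g c c' p q" "c' - c < \<epsilon>"
      by (meson le_less_trans)
    show ?thesis
    proof (rule that[OF pq(1-3), of c])
      fix s t assume st: "p \<le> s" "s < t" "t \<le> q"
      have "c * (t - s) \<le> g t - g s" "g t - g s \<le> c' * (t - s)" using pq(4) st unfolding slope_bounds_def by auto
      moreover have "(c' - c) * (t - s) \<le> \<epsilon> * (t - s)" using pq(5) st by (intro mult_right_mono) auto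
      ultimately show "\<bar>g t - g s - c * (t - s)\<bar> \<le> \<epsilon> * (t - s)" by (simp add: algebra_simps)
    qed
  next
    case 2
    have "uncountable {a<..<b}" using \<open>a < b\<close> by (simp add: uncountable_open_interval)
    then have "{a<..<b} - C \<noteq> {}" using 2(1) by (metis Diff_eq_empty_iff countable_subset)
    then obtain t0 where "t0 \<in> {a<..<b} - C" by blast
    then have t0: "a < t0" "t0 < b" "t0 \<notin> C" by simp_all
    obtain \<eta> g' where \<eta>: "\<eta> > 0" and g': "\<And>s. \<bar>s - t0\<bar> < \<eta> \<Longrightarrow> (g has_real_derivative g' s) (at s) \<and> \<bar>g' s - g' t0\<bar> < \<epsilon>"
      using C1_atE[OF 2(2)[OF t0] \<open>\<epsilon> > 0\<close>] by blast
    define q where "q = min (t0 + \<eta> / 2) ((t0 + b) / 2)"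
    have q: "t0 < q" "q < t0 + \<eta>" "q < b" using \<eta> t0 by (auto simp: q_def min_def)
    show ?thesis
    proof (rule that[OF t0(1) q(1,3), of "g' t0"])
      fix s t assume st: "t0 \<le> s" "s < t" "t \<le> q"
      have "\<exists>\<xi>>s. \<xi> < t \<and> g t - g s = (t - s) * g' \<xi>"
        by (rule MVT2[OF st(2)]) (use g' st q in auto)
      then obtain \<xi> where \<xi>: "s < \<xi>" "\<xi> < t" "g t - g s = (t - s) * g' \<xi>" by blast
      have "\<bar>g' \<xi> - g' t0\<bar> < \<epsilon>" using g'[of \<xi>] \<xi> st q by auto
      then have "\<bar>g' \<xi> - g' t0\<bar> * (t - s) \<le> \<epsilon> * (t - s)" using st by (intro mult_right_mono) auto
      moreover have "g t - g s - g' t0 * (t - s) = (g' \<xi> - g' t0) * (t - s)" using \<xi>(3) by (simp add: algebra_simps)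
      ultimately show "\<bar>g t - g s - g' t0 * (t - s)\<bar> \<le> \<epsilon> * (t - s)" using st by (simp add: abs_mult)
    qed
  qed
qed

section \<open>O-minimal maps on lines\<close>

lemma truncate_truncate: "truncate k (truncate l x) = truncate (min k l) x"
  by (auto simp: truncate_def)

lemma truncate_in_Rn [simp]: "truncate k x \<in> Rn k"
  by (auto simp: truncate_def topspace_Euclidean_space)

lemma truncate_Rn: "x \<in> Rn k \<Longrightarrow> k \<le> l \<Longrightarrow> truncate l x = x"
  by (auto simp: truncate_def topspace_Euclidean_space)

context o_minimal_structure
begin

section \<open>Definable sets: Boolean operations, reindexing and quantifiers\<close>

lemma univ: "Rn k \<in> S k"
  using complement[OF empty] by simp

lemma inter: "A \<in> S k \<Longrightarrow> B \<in> S k \<Longrightarrow> A \<inter> B \<in> S k"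
proof -
  assume A: "A \<in> S k" and B: "B \<in> S k"
  have "Rn k - ((Rn k - A) \<union> (Rn k - B)) \<in> S k" using A B by (intro complement union)
  also have "Rn k - ((Rn k - A) \<union> (Rn k - B)) = A \<inter> B" using subset[OF A] subset[OF B] by auto
  finally show ?thesis .
qed

lemma definable_conj: "{x\<in>Rn K. P x} \<in> S K \<Longrightarrow> {x\<in>Rn K. Q x} \<in> S K \<Longrightarrow> {x\<in>Rn K. P x \<and> Q x} \<in> S K"
  using inter[of "{x\<in>Rn K. P x}" K "{x\<in>Rn K. Q x}"] by (simp add: Collect_conj_eq[symmetric] Int_def conj_ac)

lemma definable_not: "{x\<in>Rn K. P x} \<in> S K \<Longrightarrow> {x\<in>Rn K. \<not> P x} \<in> S K"
proof -
  assume "{x\<in>Rn K. P x} \<in> S K"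
  then have "Rn K - {x\<in>Rn K. P x} \<in> S K" by (rule complement)
  also have "Rn K - {x\<in>Rn K. P x} = {x\<in>Rn K. \<not> P x}" by blast
  finally show ?thesis .
qed

lemma definable_ball: "(\<And>i. i < (k :: nat) \<Longrightarrow> {x\<in>Rn K. P i x} \<in> S K) \<Longrightarrow> {x\<in>Rn K. \<forall>i<k. P i x} \<in> S K"
proof (induction k)
  case 0
  then show ?case using univ by simp
next
  case (Suc k)
  have "{x\<in>Rn K. P k x \<and> (\<forall>i<k. P i x)} \<in> S K" using Suc by (intro definable_conj) auto
  then show ?case unfolding All_less_Suc .
qed

lemma cylinder: "A \<in> S k \<Longrightarrow> {x\<in>Rn (k + p). truncate k x \<in> A} \<in> S (k + p)"
proof (induction p)
  case 0
  then have "{x\<in>Rn k. truncate k x \<in> A} = A" using subset[OF 0] truncate_Rn by fastforce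
  then show ?case using 0 by simp
next
  case (Suc p)
  from times_line[OF Suc.IH[OF Suc.prems]] show ?case
    by (simp add: truncate_truncate min_def cong: conj_cong)
qed

lemma shifted: "A \<in> S k \<Longrightarrow> {x\<in>Rn (q + k). (\<lambda>i. x (q + i)) \<in> A} \<in> S (q + k)"
proof (induction q)
  case 0
  then have "{x\<in>Rn k. x \<in> A} = A" using subset[OF 0] by auto
  then show ?case using 0 by simp
next
  case (Suc q)
  have "{x\<in>Rn (Suc (q + k)). (\<lambda>i. x (Suc i)) \<in> {x\<in>Rn (q + k). (\<lambda>i. x (q + i)) \<in> A}} =
    {x\<in>Rn (Suc q + k). (\<lambda>i. x (Suc q + i)) \<in> A}"
    by (auto simp: topspace_Euclidean_space)
  then show ?case using line_times[OF Suc.IH[OF Suc.prems]] by simp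
qed

lemma window:
  assumes "A \<in> S k" "q + k \<le> K"
  shows "{x\<in>Rn K. (\<lambda>i. if i < k then x (q + i) else 0) \<in> A} \<in> S K"
proof -
  have "{x\<in>Rn (q + k + (K - (q + k))). truncate (q + k) x \<in> {x\<in>Rn (q + k). (\<lambda>i. x (q + i)) \<in> A}} \<in> S (q + k + (K - (q + k)))"
    by (intro cylinder shifted assms)
  moreover have "(\<lambda>i. truncate (q + k) x (q + i)) = (\<lambda>i. if i < k then x (q + i) else 0)" for x
    by (auto simp: truncate_def)
  ultimately show ?thesis using assms(2) by simp
qed

lemma coordinates_equal:
  assumes "i < j" "j < K"
  shows "{x\<in>Rn K. x i = x j} \<in> S K"
proof -
  have "{x\<in>Rn K. (\<lambda>l. if l < Suc (j - i) then x (i + l) else 0) \<in> {x\<in>Rn (Suc (j - i)). x 0 = x (j - i)}} \<in> S K"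
    using assms by (intro window diagonal) auto
  also have "{x\<in>Rn K. (\<lambda>l. if l < Suc (j - i) then x (i + l) else 0) \<in> {x\<in>Rn (Suc (j - i)). x 0 = x (j - i)}} =
    {x\<in>Rn K. x i = x j}"
    using assms by (auto simp: topspace_Euclidean_space)
  finally show ?thesis .
qed

lemma projections: "A \<in> S (K + p) \<Longrightarrow> truncate K ` A \<in> S K"
proof (induction p arbitrary: A)
  case 0
  then have "truncate K ` A = A" using subset[OF 0] truncate_Rn[of _ K K] by force
  then show ?case using 0 by simp
next
  case (Suc p)
  then have "truncate K ` truncate (K + p) ` A \<in> S K" by (intro Suc.IH projection) simp
  then show ?case by (simp add: image_image truncate_truncate min_def)
qed

lemma existential:
  assumes "{y\<in>Rn (K + k). P y} \<in> S (K + k)"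
    and "\<And>x. x \<in> Rn K \<Longrightarrow> Q x \<longleftrightarrow> (\<exists>y\<in>Rn (K + k). truncate K y = x \<and> P y)"
  shows "{x\<in>Rn K. Q x} \<in> S K"
proof -
  have "truncate K ` {y\<in>Rn (K + k). P y} = {x\<in>Rn K. Q x}" using assms(2) by fastforce
  then show ?thesis using projections[OF assms(1)] by simp
qed

text \<open>\<open>window\<close> handles only consecutive blocks of coordinates. The wanted
  coordinates are copied to k fresh ones at the end, which form a block, and these are projected
  away.\<close>

lemma substitution:
  assumes "A \<in> S k" "\<And>i. i < k \<Longrightarrow> \<sigma> i < K"
  shows "{x\<in>Rn K. (\<lambda>i. if i < k then x (\<sigma> i) else 0) \<in> A} \<in> S K"
proof (rule existential[where k = k and P = "\<lambda>y. (\<lambda>i. if i < k then y (K + i) else 0) \<in> A \<and> (\<forall>i<k. y (\<sigma> i) = y (K + i))"])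
  show "{y\<in>Rn (K + k). (\<lambda>i. if i < k then y (K + i) else 0) \<in> A \<and> (\<forall>i<k. y (\<sigma> i) = y (K + i))} \<in> S (K + k)"
    by (intro definable_conj window definable_ball coordinates_equal assms) (use assms(2) in \<open>force+\<close>)
  fix x assume x: "x \<in> Rn K"
  show "(\<lambda>i. if i < k then x (\<sigma> i) else 0) \<in> A \<longleftrightarrow>
    (\<exists>y\<in>Rn (K + k). truncate K y = x \<and> (\<lambda>i. if i < k then y (K + i) else 0) \<in> A \<and> (\<forall>i<k. y (\<sigma> i) = y (K + i)))"
  proof
    assume A: "(\<lambda>i. if i < k then x (\<sigma> i) else 0) \<in> A"
    define y where "y i = (if i < K then x i else if i < K + k then x (\<sigma> (i - K)) else 0)" for i
    have "y \<in> Rn (K + k)" by (auto simp: y_def topspace_Euclidean_space)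
    moreover have "truncate K y = x" using x by (auto simp: y_def truncate_def topspace_Euclidean_space)
    moreover have "(\<lambda>i. if i < k then y (K + i) else 0) = (\<lambda>i. if i < k then x (\<sigma> i) else 0)"
      by (auto simp: y_def)
    moreover have "\<forall>i<k. y (\<sigma> i) = y (K + i)" using assms(2) by (auto simp: y_def)
    ultimately show "\<exists>y\<in>Rn (K + k). truncate K y = x \<and> (\<lambda>i. if i < k then y (K + i) else 0) \<in> A \<and> (\<forall>i<k. y (\<sigma> i) = y (K + i))"
      using A by metis
  next
    assume "\<exists>y\<in>Rn (K + k). truncate K y = x \<and> (\<lambda>i. if i < k then y (K + i) else 0) \<in> A \<and> (\<forall>i<k. y (\<sigma> i) = y (K + i))"
    then obtain y where y: "truncate K y = x" "(\<lambda>i. if i < k then y (K + i) else 0) \<in> A" "\<And>i. i < k \<Longrightarrow> y (\<sigma> i) = y (K + i)"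
      by blast
    have "x (\<sigma> i) = y (K + i)" if "i < k" for i
      using y(3)[OF that] assms(2)[OF that] y(1) by (auto simp: truncate_def)
    then have "(\<lambda>i. if i < k then x (\<sigma> i) else 0) = (\<lambda>i. if i < k then y (K + i) else 0)" by auto
    then show "(\<lambda>i. if i < k then x (\<sigma> i) else 0) \<in> A" using y(2) by simp
  qed
qed

section \<open>Definable functions\<close>

definition definable_fun :: "nat \<Rightarrow> ((nat \<Rightarrow> real) \<Rightarrow> real) \<Rightarrow> bool" where
  "definable_fun K \<phi> \<longleftrightarrow> {x\<in>Rn (Suc K). x K = \<phi> (truncate K x)} \<in> S (Suc K)"

lemma definable_fun_graph:
  assumes "definable_fun K \<phi>" "K \<le> j" "j < L"
  shows "{x\<in>Rn L. x j = \<phi> (truncate K x)} \<in> S L"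
proof -
  define \<sigma> where "\<sigma> i = (if i < K then i else j)" for i
  have "{x\<in>Rn L. (\<lambda>i. if i < Suc K then x (\<sigma> i) else 0) \<in> {x\<in>Rn (Suc K). x K = \<phi> (truncate K x)}} \<in> S L"
    using assms unfolding definable_fun_def by (intro substitution) (auto simp: \<sigma>_def)
  also have "{x\<in>Rn L. (\<lambda>i. if i < Suc K then x (\<sigma> i) else 0) \<in> {x\<in>Rn (Suc K). x K = \<phi> (truncate K x)}} =
    {x\<in>Rn L. x j = \<phi> (truncate K x)}"
  proof -
    have "truncate K (\<lambda>i. if i < Suc K then x (\<sigma> i) else 0) = truncate K x" for x :: "nat \<Rightarrow> real"
      by (auto simp: truncate_def \<sigma>_def)
    then show ?thesis by (auto simp: \<sigma>_def topspace_Euclidean_space)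
  qed
  finally show ?thesis .
qed

lemma definable_preimage:
  assumes "A \<in> S k" "\<And>i. i < k \<Longrightarrow> definable_fun K (\<phi> i)"
  shows "{x\<in>Rn K. (\<lambda>i. if i < k then \<phi> i x else 0) \<in> A} \<in> S K"
proof (rule existential[where k = k and P = "\<lambda>y. (\<lambda>i. if i < k then y (K + i) else 0) \<in> A \<and> (\<forall>i<k. y (K + i) = \<phi> i (truncate K y))"])
  show "{y\<in>Rn (K + k). (\<lambda>i. if i < k then y (K + i) else 0) \<in> A \<and> (\<forall>i<k. y (K + i) = \<phi> i (truncate K y))} \<in> S (K + k)"
    by (intro definable_conj window definable_ball definable_fun_graph assms) auto
  fix x assume x: "x \<in> Rn K"
  show "(\<lambda>i. if i < k then \<phi> i x else 0) \<in> A \<longleftrightarrow>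
    (\<exists>y\<in>Rn (K + k). truncate K y = x \<and> (\<lambda>i. if i < k then y (K + i) else 0) \<in> A \<and> (\<forall>i<k. y (K + i) = \<phi> i (truncate K y)))"
  proof
    assume A: "(\<lambda>i. if i < k then \<phi> i x else 0) \<in> A"
    define y where "y i = (if i < K then x i else if i < K + k then \<phi> (i - K) x else 0)" for i
    have "y \<in> Rn (K + k)" by (auto simp: y_def topspace_Euclidean_space)
    moreover have "truncate K y = x" using x by (auto simp: y_def truncate_def topspace_Euclidean_space)
    moreover have "(\<lambda>i. if i < k then y (K + i) else 0) = (\<lambda>i. if i < k then \<phi> i x else 0)"
      by (auto simp: y_def)
    moreover have "\<forall>i<k. y (K + i) = \<phi> i x" by (auto simp: y_def)
    ultimately show "\<exists>y\<in>Rn (K + k). truncate K y = x \<and> (\<lambda>i. if i < k then y (K + i) else 0) \<in> A \<and> (\<forall>i<k. y (K + i) = \<phi> i (truncate K y))"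
      using A by metis
  next
    assume "\<exists>y\<in>Rn (K + k). truncate K y = x \<and> (\<lambda>i. if i < k then y (K + i) else 0) \<in> A \<and> (\<forall>i<k. y (K + i) = \<phi> i (truncate K y))"
    then obtain y where y: "truncate K y = x" "(\<lambda>i. if i < k then y (K + i) else 0) \<in> A" "\<And>i. i < k \<Longrightarrow> y (K + i) = \<phi> i x"
      by blast
    then have "(\<lambda>i. if i < k then \<phi> i x else 0) = (\<lambda>i. if i < k then y (K + i) else 0)" by auto
    then show "(\<lambda>i. if i < k then \<phi> i x else 0) \<in> A" using y(2) by simp
  qed
qed

lemma definable_fun_coord: "i < K \<Longrightarrow> definable_fun K (\<lambda>x. x i)"
  unfolding definable_fun_def using coordinates_equal[of i K "Suc K"]
  by (simp add: truncate_def eq_commute)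

text \<open>The converse direction of \<open>o_minimal\<close> makes every singleton of the line
  definable; this is how parameters enter.\<close>

lemma definable_fun_const: "definable_fun K (\<lambda>_. c)"
proof -
  have "{x\<in>Rn 1. x 0 = c} \<in> S 1"
    unfolding o_minimal
  proof (intro conjI exI[of _ "{{c}}"])
    have "(\<lambda>i. if i < 1 then c else 0) \<in> {x\<in>Rn 1. x 0 = c}" by (auto simp: topspace_Euclidean_space)
    then show "(\<lambda>x. x 0) ` {x\<in>Rn 1. x 0 = c} = \<Union>{{c}}" by force
  qed (auto simp: is_interval_1)
  then have "{x\<in>Rn (Suc K). (\<lambda>i. if i < 1 then x (K + i) else 0) \<in> {x\<in>Rn 1. x 0 = c}} \<in> S (Suc K)"
    by (rule window) simp
  also have "{x\<in>Rn (Suc K). (\<lambda>i. if i < 1 then x (K + i) else 0) \<in> {x\<in>Rn 1. x 0 = c}} = {x\<in>Rn (Suc K). x K = c}"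
    by (auto simp: topspace_Euclidean_space)
  finally show ?thesis unfolding definable_fun_def .
qed

lemma definable_fun_lift: "definable_fun K \<phi> \<Longrightarrow> definable_fun (Suc K) (\<lambda>x. \<phi> (truncate K x))"
  using definable_fun_graph[of K \<phi> "Suc K" "Suc (Suc K)"]
  by (simp add: definable_fun_def truncate_truncate min_def)

lemma definable_fun_binary:
  assumes op: "{x\<in>Rn 3. x 2 = F (x 0) (x 1)} \<in> S 3" and \<phi>: "definable_fun K \<phi>" and \<psi>: "definable_fun K \<psi>"
  shows "definable_fun K (\<lambda>x. F (\<phi> x) (\<psi> x))"
proof -
  define G where "G i = (if i = 0 then \<lambda>x. \<phi> (truncate K x) else if i = (1::nat) then \<lambda>x. \<psi> (truncate K x) else (\<lambda>x. x K))" for i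
  have "{x\<in>Rn (Suc K). (\<lambda>i. if i < 3 then G i x else 0) \<in> {x\<in>Rn 3. x 2 = F (x 0) (x 1)}} \<in> S (Suc K)"
    by (rule definable_preimage[OF op])
       (auto simp: G_def intro: definable_fun_lift[OF \<phi>] definable_fun_lift[OF \<psi>] definable_fun_coord)
  also have "{x\<in>Rn (Suc K). (\<lambda>i. if i < 3 then G i x else 0) \<in> {x\<in>Rn 3. x 2 = F (x 0) (x 1)}} =
    {x\<in>Rn (Suc K). x K = F (\<phi> (truncate K x)) (\<psi> (truncate K x))}"
    by (auto simp: G_def topspace_Euclidean_space)
  finally show ?thesis unfolding definable_fun_def .
qed

lemmas definable_fun_add = definable_fun_binary[OF add]
  and definable_fun_mult = definable_fun_binary[OF mult]

lemma definable_fun_sum: "(\<And>i. i < (n :: nat) \<Longrightarrow> definable_fun K (\<phi> i)) \<Longrightarrow> definable_fun K (\<lambda>x. \<Sum>i<n. \<phi> i x)"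
  by (induction n) (auto intro: definable_fun_const definable_fun_add)

lemma definable_less:
  assumes "definable_fun K \<phi>" "definable_fun K \<psi>"
  shows "{x\<in>Rn K. \<phi> x < \<psi> x} \<in> S K"
proof -
  define G where "G i = (if i = (0::nat) then \<phi> else \<psi>)" for i
  have "{x\<in>Rn K. (\<lambda>i. if i < 2 then G i x else 0) \<in> {x\<in>Rn 2. x 0 < x 1}} \<in> S K"
    by (rule definable_preimage[OF less]) (auto simp: G_def assms)
  also have "{x\<in>Rn K. (\<lambda>i. if i < 2 then G i x else 0) \<in> {x\<in>Rn 2. x 0 < x 1}} = {x\<in>Rn K. \<phi> x < \<psi> x}"
    by (auto simp: G_def topspace_Euclidean_space)
  finally show ?thesis .
qed

text \<open>f is eliminated by quantifying over its value: auxiliary coordinates hold the components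
  of a candidate value, the corresponding point is required to lie on the graph, and what remains is
  a linear inequality.\<close>

lemma definable_line_superlevel:
  fixes f :: "real^'m \<Rightarrow> real^'n"
  assumes gr: "graph_in_Rn f U \<in> S (CARD('m) + CARD('n))"
  shows "{s\<in>Rn 1. x + s 0 *\<^sub>R v \<in> U \<and> d \<le> w \<bullet> f (x + s 0 *\<^sub>R v) - c * s 0} \<in> S 1"
proof (rule existential)
  let ?M = "CARD('m)" and ?N = "CARD('n)"
  \<comment> \<open>The coordinates of the candidate point of the graph as functions of u, where u 0
    is the parameter of the line and the other entries are the candidate value.\<close>
  define \<phi> where "\<phi> i = (if i < ?M then \<lambda>u. x $ from_nat_into UNIV i + v $ from_nat_into UNIV i * u 0
    else (\<lambda>u :: nat \<Rightarrow> real. u (1 + (i - ?M))))" for i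
  define W where "W u = (\<Sum>i<?N. w $ from_nat_into UNIV i * u (1 + i))" for u :: "nat \<Rightarrow> real"
  define P where "P u \<longleftrightarrow> (\<lambda>i. if i < ?M + ?N then \<phi> i u else 0) \<in> graph_in_Rn f U \<and> \<not> W u < d + c * u 0" for u
  have "definable_fun (1 + ?N) W"
    unfolding W_def by (intro definable_fun_sum definable_fun_mult definable_fun_const definable_fun_coord) simp
  moreover have "definable_fun (1 + ?N) (\<lambda>u. d + c * u 0)"
    by (intro definable_fun_add definable_fun_mult definable_fun_const definable_fun_coord) simp
  moreover have "definable_fun (1 + ?N) (\<phi> i)" if "i < ?M + ?N" for i
  proof (cases "i < ?M")
    case True
    then show ?thesis unfolding \<phi>_def if_P[OF True]
      by (intro definable_fun_add definable_fun_mult definable_fun_const definable_fun_coord) simp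
  next
    case False
    then show ?thesis unfolding \<phi>_def if_not_P[OF False] using that by (intro definable_fun_coord) simp
  qed
  ultimately show "{u\<in>Rn (1 + ?N). P u} \<in> S (1 + ?N)"
    unfolding P_def by (intro definable_conj definable_not definable_less definable_preimage gr) auto
  fix s assume s: "s \<in> Rn 1"
  show "x + s 0 *\<^sub>R v \<in> U \<and> d \<le> w \<bullet> f (x + s 0 *\<^sub>R v) - c * s 0 \<longleftrightarrow> (\<exists>u\<in>Rn (1 + ?N). truncate 1 u = s \<and> P u)"
  proof
    assume A: "x + s 0 *\<^sub>R v \<in> U \<and> d \<le> w \<bullet> f (x + s 0 *\<^sub>R v) - c * s 0"
    define y where "y = x + s 0 *\<^sub>R v"
    define u where "u i = (if i = 0 then s 0 else if i < 1 + ?N then f y $ from_nat_into UNIV (i - 1) else 0)" for i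
    have "u \<in> Rn (1 + ?N)" by (auto simp: u_def topspace_Euclidean_space)
    moreover have "truncate 1 u = s" using s by (auto simp: u_def truncate_def topspace_Euclidean_space)
    moreover have "(\<lambda>i. if i < ?M + ?N then \<phi> i u else 0) = graph_point f y"
      by (rule ext) (auto simp: graph_point_def \<phi>_def u_def y_def mult.commute)
    moreover have "W u = w \<bullet> f y" by (simp add: W_def u_def inner_coords)
    ultimately show "\<exists>u\<in>Rn (1 + ?N). truncate 1 u = s \<and> P u"
      using A by (intro bexI[of _ u]) (auto simp: P_def graph_in_Rn_eq y_def u_def)
  next
    assume "\<exists>u\<in>Rn (1 + ?N). truncate 1 u = s \<and> P u"
    then obtain u y where u: "truncate 1 u = s" "(\<lambda>i. if i < ?M + ?N then \<phi> i u else 0) = graph_point f y" "y \<in> U"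
      "\<not> W u < d + c * u 0" unfolding P_def graph_in_Rn_eq by blast
    have us: "u 0 = s 0" using fun_cong[OF u(1), of 0] by (simp add: truncate_def)
    have e: "\<phi> i u = graph_point f y i" if "i < ?M + ?N" for i using fun_cong[OF u(2), of i] that by simp
    have y: "y = x + s 0 *\<^sub>R v"
    proof (rule vec_eq_coords)
      fix i assume i: "i < ?M"
      then show "y $ from_nat_into UNIV i = (x + s 0 *\<^sub>R v) $ from_nat_into UNIV i"
        using e[of i] by (simp add: \<phi>_def graph_point_def us mult.commute)
    qed
    have "W u = w \<bullet> f y"
      unfolding W_def inner_coords
    proof (intro sum.cong refl)
      fix i assume "i \<in> {..<?N}"
      then show "w $ from_nat_into UNIV i * u (1 + i) = w $ from_nat_into UNIV i * f y $ from_nat_into UNIV i"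
        using e[of "?M + i"] by (simp add: \<phi>_def graph_point_def)
    qed
    then show "x + s 0 *\<^sub>R v \<in> U \<and> d \<le> w \<bullet> f (x + s 0 *\<^sub>R v) - c * s 0"
      using u(3,4) y us by simp
  qed
qed

end

text \<open>An interval with points arbitrarily close to t on the right contains a whole right
  interval at t; any other member of F can be ignored after shrinking \<eta>.\<close>

lemma finite_intervals_right_germ:
  fixes t :: real
  assumes "finite F" "\<forall>I\<in>F. is_interval I"
  shows "\<exists>\<eta>>0. (\<forall>s. t < s \<longrightarrow> s < t + \<eta> \<longrightarrow> s \<in> \<Union>F) \<or> (\<forall>s. t < s \<longrightarrow> s < t + \<eta> \<longrightarrow> s \<notin> \<Union>F)"
  using assms
proof (induction F rule: finite_induct)
  case empty
  then show ?case by (intro exI[of _ 1]) auto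
next
  case (insert I F)
  then obtain \<eta> where \<eta>: "\<eta> > 0" "(\<forall>s. t < s \<longrightarrow> s < t + \<eta> \<longrightarrow> s \<in> \<Union>F) \<or> (\<forall>s. t < s \<longrightarrow> s < t + \<eta> \<longrightarrow> s \<notin> \<Union>F)"
    by auto
  show ?case
  proof (cases "\<exists>\<mu>>0. \<forall>s. t < s \<longrightarrow> s < t + \<mu> \<longrightarrow> s \<notin> I")
    case True
    then obtain \<mu> where "\<mu> > 0" "\<forall>s. t < s \<longrightarrow> s < t + \<mu> \<longrightarrow> s \<notin> I" by blast
    then show ?thesis using \<eta> by (intro exI[of _ "min \<eta> \<mu>"]) auto
  next
    case False
    then have near: "\<exists>s. t < s \<and> s < t + \<mu> \<and> s \<in> I" if "\<mu> > 0" for \<mu> using that by blast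
    obtain s1 where s1: "t < s1" "s1 \<in> I" using near[of 1] by auto
    have "s \<in> I" if "t < s" "s < s1" for s
    proof -
      obtain s0 where "t < s0" "s0 < s" "s0 \<in> I" using near[of "s - t"] \<open>t < s\<close> by force
      moreover have "is_interval I" using insert.prems by simp
      ultimately show ?thesis using mem_is_interval_1_I[of I s0 s1 s] s1 that by simp
    qed
    then show ?thesis using s1 by (intro exI[of _ "s1 - t"]) auto
  qed
qed

text \<open>The parameters s with x + s v in U and h t \<le> h s form a definable subset of the
  line, hence a finite union of intervals, and this contains or misses a right interval at
  t.\<close>

lemma o_minimal_line_signed_at:
  fixes f :: "real^'m \<Rightarrow> real^'n"
  assumes S: "o_minimal_structure S" and gr: "graph_in_Rn f U \<in> S (CARD('m) + CARD('n))"
    and "open U" and x: "x + t *\<^sub>R v \<in> U"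
  shows "signed_at (\<lambda>s. w \<bullet> f (x + s *\<^sub>R v) - c * s) t"
proof -
  interpret o_minimal_structure S by (rule S)
  define h where "h s = w \<bullet> f (x + s *\<^sub>R v) - c * s" for s
  define E where "E = {s\<in>Rn 1. x + s 0 *\<^sub>R v \<in> U \<and> h t \<le> w \<bullet> f (x + s 0 *\<^sub>R v) - c * s 0}"
  have "E \<in> S 1" unfolding E_def by (rule definable_line_superlevel[OF gr])
  then obtain F where F: "finite F" "\<forall>I\<in>F. is_interval I" "(\<lambda>x. x 0) ` E = \<Union>F" unfolding o_minimal by blast
  have E: "s \<in> \<Union>F \<longleftrightarrow> x + s *\<^sub>R v \<in> U \<and> h t \<le> h s" for s
  proof
    assume "x + s *\<^sub>R v \<in> U \<and> h t \<le> h s"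
    then have "(\<lambda>i. if i = 0 then s else 0) \<in> E" by (auto simp: E_def h_def topspace_Euclidean_space)
    then show "s \<in> \<Union>F" unfolding F(3)[symmetric] by (rule image_eqI[rotated]) simp
  qed (auto simp: F(3)[symmetric] E_def h_def)
  \<comment> \<open>Near t the line stays in U, so that missing the set means h s < h t.\<close>
  have "open {s. x + s *\<^sub>R v \<in> U}"
    using open_vimage[OF \<open>open U\<close>, of "\<lambda>s. x + s *\<^sub>R v"] by (simp add: vimage_def continuous_intros)
  then obtain \<mu> where \<mu>: "\<mu> > 0" "\<And>s. \<bar>s - t\<bar> < \<mu> \<Longrightarrow> x + s *\<^sub>R v \<in> U"
    using x unfolding open_dist dist_real_def by blast
  obtain \<eta> where \<eta>: "\<eta> > 0" "(\<forall>s. t < s \<longrightarrow> s < t + \<eta> \<longrightarrow> s \<in> \<Union>F) \<or> (\<forall>s. t < s \<longrightarrow> s < t + \<eta> \<longrightarrow> s \<notin> \<Union>F)"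
    using finite_intervals_right_germ[OF F(1,2)] by blast
  have "signed_at h t"
    using \<eta>(2)
  proof
    assume "\<forall>s. t < s \<longrightarrow> s < t + \<eta> \<longrightarrow> s \<in> \<Union>F"
    then show ?thesis unfolding signed_at_def E using \<eta>(1) by blast
  next
    assume no: "\<forall>s. t < s \<longrightarrow> s < t + \<eta> \<longrightarrow> s \<notin> \<Union>F"
    have "h s \<le> h t" if "t < s" "s < t + min \<eta> \<mu>" for s
    proof -
      have "s < t + \<eta>" "\<bar>s - t\<bar> < \<mu>" using that by auto
      then show ?thesis using no[rule_format, OF \<open>t < s\<close>] \<mu>(2)[of s] unfolding E by auto
    qed
    then show ?thesis
      unfolding signed_at_def using \<eta>(1) \<mu>(1) by (intro disjI2 exI[of _ "min \<eta> \<mu>"]) auto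
  qed
  then show ?thesis unfolding h_def .
qed

section \<open>Maps that are regular on lines\<close>

lemma Rats_between:
  fixes x y :: real
  assumes "x < y"
  obtains q where "q \<in> \<rat>" "x < q" "q < y"
  using Rats_dense_in_real[OF assms] by blast

lemma closed_cover_ball:
  fixes a :: "'a::euclidean_space"
  assumes "r > 0" "countable \<F>" "\<And>T. T \<in> \<F> \<Longrightarrow> closed T" "cball a r \<subseteq> \<Union>\<F>"
  obtains T b s where "T \<in> \<F>" "s > 0" "ball b s \<subseteq> T" "ball b s \<subseteq> ball a r"
proof -
  obtain T x e where T: "T \<in> \<F>" "x \<in> cball a r" "e > 0" "cball a r \<inter> ball x e \<subseteq> T"
    by (rule closed_cover_contains_ball[OF closed_cball _ assms(2-4)]) (use assms(1) in auto)
  have "x \<in> closure (ball a r)" using T(2) assms(1) by (simp add: closure_ball)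
  then obtain b where b: "b \<in> ball a r" "dist b x < e" using T(3) by (auto simp: closure_approachable)
  then have "b \<in> ball a r \<inter> ball x e" by (simp add: dist_commute)
  then obtain s where "s > 0" "ball b s \<subseteq> ball a r \<inter> ball x e"
    using openE[of "ball a r \<inter> ball x e" b] by (metis open_Int open_ball)
  moreover from this have "ball b s \<subseteq> T" using T(4) ball_subset_cball[of a r] by blast
  ultimately show ?thesis using that T(1) by blast
qed

text \<open>The estimate for all pairs in the ball, not only against the centre, makes the condition
  open and allows L to be compared with derivatives at nearby points.\<close>

definition almost_linear :: "('a::real_normed_vector \<Rightarrow> 'b::real_normed_vector) \<Rightarrow> real \<Rightarrow> 'a \<Rightarrow> bool" where
  "almost_linear f \<epsilon> a \<longleftrightarrow> (\<exists>r>0. \<exists>L. bounded_linear L \<and>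
    (\<forall>x\<in>ball a r. \<forall>y\<in>ball a r. norm (f y - f x - L (y - x)) \<le> \<epsilon> * norm (y - x)))"

lemma open_almost_linear: "open {a. almost_linear f \<epsilon> a}"
  unfolding open_contains_ball
proof safe
  fix a assume "almost_linear f \<epsilon> a"
  then obtain r L where r: "r > 0" "bounded_linear L"
    "\<forall>x\<in>ball a r. \<forall>y\<in>ball a r. norm (f y - f x - L (y - x)) \<le> \<epsilon> * norm (y - x)"
    unfolding almost_linear_def by blast
  have "almost_linear f \<epsilon> b" if b: "b \<in> ball a r" for b
  proof -
    obtain s where s: "s > 0" "ball b s \<subseteq> ball a r" by (rule openE[OF open_ball b])
    then show ?thesis unfolding almost_linear_def using r by (intro exI[of _ s] conjI exI[of _ L]) auto
  qed
  then show "\<exists>e>0. ball a e \<subseteq> {a. almost_linear f \<epsilon> a}" using r(1) by blast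
qed

text \<open>Two approximations with errors 1/(m + 1) and 1/(n + 1) on a common ball differ by at
  most the sum of these errors, so the maps \<open>L n\<close> converge pointwise; the limit is the
  derivative.\<close>

lemma almost_linear_imp_differentiable:
  fixes f :: "'a::real_normed_vector \<Rightarrow> 'b::euclidean_space"
  assumes "\<And>n. almost_linear f (1 / Suc n) a"
  shows "f differentiable (at a)"
proof -
  obtain r L where r: "\<And>n. r n > 0" and L: "\<And>n. bounded_linear (L n)"
    and est: "\<And>n x y. x \<in> ball a (r n) \<Longrightarrow> y \<in> ball a (r n) \<Longrightarrow> norm (f y - f x - L n (y - x)) \<le> 1 / Suc n * norm (y - x)"
    using assms unfolding almost_linear_def by metis
  have close: "norm (L m v - L n v) \<le> (1 / Suc m + 1 / Suc n) * norm v" for m n v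
  proof (cases "v = 0")
    case True
    then show ?thesis using linear_0[OF bounded_linear.linear[OF L]] by simp
  next
    case False
    define s where "s = min (r m) (r n) / (2 * norm v)"
    have s: "s > 0" using r[of m] r[of n] False by (simp add: s_def)
    have "norm (s *\<^sub>R v) = s * norm v" using s by simp
    then have sv: "norm (s *\<^sub>R v) = min (r m) (r n) / 2" using False by (simp add: s_def)
    have mem: "a \<in> ball a (r k)" "a + s *\<^sub>R v \<in> ball a (r k)" if "k = m \<or> k = n" for k
      using sv r[of m] r[of n] that by (auto simp: dist_norm)
    have 1: "norm (f (a + s *\<^sub>R v) - f a - L k (s *\<^sub>R v)) \<le> 1 / Suc k * norm (s *\<^sub>R v)" if "k = m \<or> k = n" for k
      using est[OF mem[OF that]] by simp
    have "norm (L m (s *\<^sub>R v) - L n (s *\<^sub>R v)) \<le> 1 / Suc m * norm (s *\<^sub>R v) + 1 / Suc n * norm (s *\<^sub>R v)"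
      using norm_diff_triangle_le[of "f (a + s *\<^sub>R v) - f a" "L m (s *\<^sub>R v)" _ "L n (s *\<^sub>R v)"] 1[of m] 1[of n]
      by (smt (verit) norm_minus_commute norm_triangle_sub norm_diff_triangle_le)
    also have "L m (s *\<^sub>R v) - L n (s *\<^sub>R v) = s *\<^sub>R (L m v - L n v)"
      by (simp add: linear_scale[OF bounded_linear.linear[OF L]] scaleR_diff_right)
    finally have "s * norm (L m v - L n v) \<le> s * ((1 / Suc m + 1 / Suc n) * norm v)"
      using s by (simp add: ring_distribs mult_ac)
    then show ?thesis using s by simp
  qed
  have "Cauchy (\<lambda>n. L n v)" for v
  proof (rule metric_CauchyI)
    fix e :: real assume "e > 0"
    obtain N where N: "1 / Suc N < e / (2 * (norm v + 1))" using nat_approx_posE[of "e / (2 * (norm v + 1))"] \<open>e > 0\<close>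
      by (auto simp: add_nonneg_pos)
    have pos: "norm v + 1 > 0" by (simp add: add_nonneg_pos)
    have "dist (L m v) (L n v) < e" if "m \<ge> N" "n \<ge> N" for m n
    proof -
      have "1 / Suc m \<le> 1 / Suc N" "1 / Suc n \<le> 1 / Suc N" using that by (auto simp: divide_simps)
      then have "(1 / Suc m + 1 / Suc n) * norm v \<le> (2 * (1 / Suc N)) * norm v" by (intro mult_right_mono) auto
      also have "\<dots> \<le> (2 * (1 / Suc N)) * (norm v + 1)" by (intro mult_left_mono) auto
      also have "\<dots> < (2 * (e / (2 * (norm v + 1)))) * (norm v + 1)"
        using N pos by (intro mult_strict_right_mono) auto
      also have "\<dots> = e"
      proof -
        have "2 * (e / (2 * X)) * X = e" if "X > 0" for X :: real using that by simp
        from this[OF pos] show ?thesis .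
      qed
      finally show ?thesis using close[of m v n] by (simp add: dist_norm)
    qed
    then show "\<exists>M. \<forall>m\<ge>M. \<forall>n\<ge>M. dist (L m v) (L n v) < e" by blast
  qed
  then have "\<exists>l. (\<lambda>n. L n v) \<longlonglongrightarrow> l" for v using Cauchy_convergent_iff convergent_def by blast
  then obtain M where M: "\<And>v. (\<lambda>n. L n v) \<longlonglongrightarrow> M v" by metis
  have dist_M: "norm (L n v - M v) \<le> 1 / Suc n * norm v" for n v
  proof -
    have "(\<lambda>m. norm (L n v - L m v)) \<longlonglongrightarrow> norm (L n v - M v)" by (intro tendsto_intros M)
    moreover have "(\<lambda>m. (1 / Suc n + 1 / Suc m) * norm v) \<longlonglongrightarrow> (1 / Suc n + 0) * norm v"
      by (intro tendsto_intros LIMSEQ_Suc[OF lim_1_over_n])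
    ultimately show ?thesis using LIMSEQ_le[of "\<lambda>m. norm (L n v - L m v)"] close[of n v] by force
  qed
  have "linear M"
  proof
    fix x y :: 'a and c :: real
    have "(\<lambda>n. L n x + L n y) \<longlonglongrightarrow> M x + M y" by (intro tendsto_intros M)
    then show "M (x + y) = M x + M y"
      using LIMSEQ_unique[OF M[of "x + y"]] by (simp add: linear_add[OF bounded_linear.linear[OF L]])
    have "(\<lambda>n. c *\<^sub>R L n x) \<longlonglongrightarrow> c *\<^sub>R M x" by (intro tendsto_intros M)
    then show "M (c *\<^sub>R x) = c *\<^sub>R M x"
      using LIMSEQ_unique[OF M[of "c *\<^sub>R x"]] by (simp add: linear_scale[OF bounded_linear.linear[OF L]])
  qed
  moreover have "norm (M v) \<le> norm v * (onorm (L 0) + 1)" for v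
  proof -
    have "norm (M v) \<le> norm (L 0 v) + norm (L 0 v - M v)" using norm_triangle_sub norm_minus_commute by metis
    also have "\<dots> \<le> onorm (L 0) * norm v + norm v" using onorm[OF L[of 0], of v] dist_M[of 0 v] by simp
    finally show ?thesis by (simp add: algebra_simps)
  qed
  ultimately have "bounded_linear M"
    by (intro bounded_linear_intro[of M "onorm (L 0) + 1"]) (auto simp: linear_add linear_scale)
  moreover have "\<exists>d>0. \<forall>y. norm (y - a) < d \<longrightarrow> norm (f y - f a - M (y - a)) \<le> e * norm (y - a)" if "e > 0" for e
  proof -
    obtain n where n: "1 / Suc n < e / 2" using nat_approx_posE[of "e / 2"] \<open>e > 0\<close> by auto
    have "norm (f y - f a - M (y - a)) \<le> e * norm (y - a)" if y: "norm (y - a) < r n" for y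
    proof -
      have "norm (f y - f a - L n (y - a)) \<le> 1 / Suc n * norm (y - a)"
        using est[of a n y] r[of n] y by (simp add: dist_norm norm_minus_commute)
      moreover have "norm (f y - f a - M (y - a)) \<le> norm (f y - f a - L n (y - a)) + norm (L n (y - a) - M (y - a))"
        using norm_triangle_ineq[of "f y - f a - L n (y - a)" "L n (y - a) - M (y - a)"] by simp
      ultimately have "norm (f y - f a - M (y - a)) \<le> (2 * (1 / Suc n)) * norm (y - a)"
        using dist_M[of n "y - a"] by simp
      also have "\<dots> \<le> e * norm (y - a)" using n by (intro mult_right_mono) auto
      finally show ?thesis .
    qed
    then show ?thesis using r[of n] by blast
  qed
  ultimately have "(f has_derivative M) (at a)" by (simp add: has_derivative_at_alt)
  then show ?thesis unfolding differentiable_def by blast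
qed

text \<open>Both linear maps are compared with the increment of f from d along a short multiple of
  v; the multiple cancels by homogeneity, and the error of differentiation is arbitrarily
  small.\<close>

lemma almost_linear_derivative_close:
  assumes d: "d \<in> ball a r" and f': "(f has_derivative f') (at d)" and L: "bounded_linear L"
    and est: "\<And>x y. x \<in> ball a r \<Longrightarrow> y \<in> ball a r \<Longrightarrow> norm (f y - f x - L (y - x)) \<le> \<epsilon> * norm (y - x)"
  shows "norm (f' v - L v) \<le> \<epsilon> * norm v"
proof (rule field_le_epsilon)
  fix e0 :: real assume "e0 > 0"
  define e where "e = e0 / (norm v + 1)"
  have pos: "norm v + 1 > 0" by (simp add: add_nonneg_pos)
  have e: "e > 0" "e * norm v \<le> e0"
  proof -
    show "e > 0" using \<open>e0 > 0\<close> pos by (simp add: e_def)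
    then have "e * norm v \<le> e * (norm v + 1)" by (intro mult_left_mono) auto
    then show "e * norm v \<le> e0" using pos by (simp add: e_def)
  qed
  show "norm (f' v - L v) \<le> \<epsilon> * norm v + e0"
  proof (cases "v = 0")
    case True
    then show ?thesis using \<open>e0 > 0\<close> linear_0[OF bounded_linear.linear[OF L]] linear_0[OF has_derivative_linear[OF f']] by simp
  next
    case False
    obtain \<delta> where \<delta>: "\<delta> > 0" "\<And>y. norm (y - d) < \<delta> \<Longrightarrow> norm (f y - f d - f' (y - d)) \<le> e * norm (y - d)"
      using f' e(1) unfolding has_derivative_at_alt by blast
    obtain r2 where r2: "r2 > 0" "ball d r2 \<subseteq> ball a r" by (rule openE[OF open_ball d])
    define s where "s = min \<delta> r2 / (2 * norm v)"
    have s: "s > 0" using \<delta>(1) r2(1) False by (simp add: s_def)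
    have "norm (s *\<^sub>R v) = s * norm v" using s by simp
    then have sv: "norm (s *\<^sub>R v) = min \<delta> r2 / 2" using False by (simp add: s_def)
    have 1: "norm (f (d + s *\<^sub>R v) - f d - f' (s *\<^sub>R v)) \<le> e * norm (s *\<^sub>R v)"
      using \<delta>(2)[of "d + s *\<^sub>R v"] sv \<delta>(1) r2(1) by auto
    have "d + s *\<^sub>R v \<in> ball d r2" using sv \<delta>(1) r2(1) by (auto simp: dist_norm)
    then have 2: "norm (f (d + s *\<^sub>R v) - f d - L (s *\<^sub>R v)) \<le> \<epsilon> * norm (s *\<^sub>R v)"
      using est[of d "d + s *\<^sub>R v"] d r2(2) by auto
    have "f' (s *\<^sub>R v) - L (s *\<^sub>R v) = (f (d + s *\<^sub>R v) - f d - L (s *\<^sub>R v)) - (f (d + s *\<^sub>R v) - f d - f' (s *\<^sub>R v))"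
      by simp
    then have "norm (f' (s *\<^sub>R v) - L (s *\<^sub>R v)) \<le> \<epsilon> * norm (s *\<^sub>R v) + e * norm (s *\<^sub>R v)"
      using norm_triangle_ineq4[of "f (d + s *\<^sub>R v) - f d - L (s *\<^sub>R v)" "f (d + s *\<^sub>R v) - f d - f' (s *\<^sub>R v)"] 1 2 by simp
    moreover have "f' (s *\<^sub>R v) - L (s *\<^sub>R v) = s *\<^sub>R (f' v - L v)"
      by (simp add: linear_scale[OF bounded_linear.linear[OF L]] linear_scale[OF has_derivative_linear[OF f']] scaleR_diff_right)
    ultimately have "norm (s *\<^sub>R (f' v - L v)) \<le> \<epsilon> * norm (s *\<^sub>R v) + e * norm (s *\<^sub>R v)" by metis
    then have "s * norm (f' v - L v) \<le> s * (\<epsilon> * norm v + e * norm v)" using s by (simp add: ring_distribs mult_ac)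
    then have "norm (f' v - L v) \<le> \<epsilon> * norm v + e * norm v" using s by simp
    then show ?thesis using e(2) by simp
  qed
qed

section \<open>Density of near linearity and of differentiability\<close>

locale regular_on_lines =
  fixes f :: "'a::euclidean_space \<Rightarrow> 'b::euclidean_space" and U :: "'a set"
  assumes open_U: "open U" and cont_f: "continuous_on U f"
    and reg: "\<And>x v w a b. (\<And>t. a < t \<Longrightarrow> t < b \<Longrightarrow> x + t *\<^sub>R v \<in> U) \<Longrightarrow>
      regular_on a b (\<lambda>t. w \<bullet> f (x + t *\<^sub>R v))"
begin

text \<open>The interval and the slope of near affinity along e may be taken rational at the cost of
  part of the error, so countably many closed sets of base points cover a ball. By Baire one choice
  works for all base points of some smaller ball.\<close>

lemma coordinate_almost_affine:
  assumes r0: "r0 > 0" "ball a r0 \<subseteq> U" and e: "norm e = 1" and \<epsilon>: "\<epsilon> > 0"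
  obtains b \<rho> c where "\<rho> > 0" "ball b \<rho> \<subseteq> ball a r0"
    "\<And>x h. x \<in> ball b \<rho> \<Longrightarrow> x + h *\<^sub>R e \<in> ball b \<rho> \<Longrightarrow> \<bar>w \<bullet> f (x + h *\<^sub>R e) - w \<bullet> f x - c * h\<bar> \<le> \<epsilon> * \<bar>h\<bar>"
proof -
  \<comment> \<open>Base points within r0/4 of a and parameters below r0/2 keep x + t e in the ball
    of radius r0.\<close>
  define S where "S = cball a (r0 / 4)"
  have mem: "x + t *\<^sub>R e \<in> ball a r0" if "x \<in> S" "0 \<le> t" "t < r0 / 2" for x t
  proof -
    have "dist a (x + t *\<^sub>R e) \<le> dist a x + norm (t *\<^sub>R e)"
      using dist_triangle[of a "x + t *\<^sub>R e" x] by (simp add: dist_norm)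
    then show ?thesis using that e r0 by (simp add: S_def)
  qed
  define T where "T p q c = {x\<in>S. \<forall>s t. p \<le> s \<longrightarrow> s < t \<longrightarrow> t \<le> q \<longrightarrow>
    \<bar>w \<bullet> f (x + t *\<^sub>R e) - w \<bullet> f (x + s *\<^sub>R e) - c * (t - s)\<bar> \<le> \<epsilon> * (t - s)}" for p q c
  define I where "I = {(p :: real, q :: real, c :: real). p \<in> \<rat> \<and> q \<in> \<rat> \<and> c \<in> \<rat> \<and> 0 < p \<and> p < q \<and> q < r0 / 2}"
  have "I \<subseteq> \<rat> \<times> \<rat> \<times> \<rat>" by (auto simp: I_def)
  then have "countable I" by (rule countable_subset) (intro countable_SIGMA countable_rat)
  have closed_T: "closed (T p q c)" if "0 < p" "q < r0 / 2" for p q c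
  proof -
    have cont: "continuous_on S (\<lambda>x. f (x + t *\<^sub>R e))" if "0 \<le> t" "t < r0 / 2" for t
      by (rule continuous_on_compose2[OF cont_f]) (use mem[OF _ that] r0 in \<open>auto intro!: continuous_intros\<close>)
    have "closed (S \<inter> (\<lambda>x. w \<bullet> f (x + t *\<^sub>R e) - w \<bullet> f (x + s *\<^sub>R e) - c * (t - s)) -` {- (\<epsilon> * (t - s))..\<epsilon> * (t - s)})"
      if "p \<le> s" "s < t" "t \<le> q" for s t
      by (intro continuous_closed_preimage continuous_intros cont) (use that \<open>0 < p\<close> \<open>q < r0 / 2\<close> in \<open>auto simp: S_def\<close>)
    then have "closed (S \<inter> (\<Inter>(s, t)\<in>{(s, t). p \<le> s \<and> s < t \<and> t \<le> q}.
      S \<inter> (\<lambda>x. w \<bullet> f (x + t *\<^sub>R e) - w \<bullet> f (x + s *\<^sub>R e) - c * (t - s)) -` {- (\<epsilon> * (t - s))..\<epsilon> * (t - s)}))"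
      by (intro closed_Int closed_INT) (auto simp: S_def)
    also have "(S \<inter> (\<Inter>(s, t)\<in>{(s, t). p \<le> s \<and> s < t \<and> t \<le> q}.
      S \<inter> (\<lambda>x. w \<bullet> f (x + t *\<^sub>R e) - w \<bullet> f (x + s *\<^sub>R e) - c * (t - s)) -` {- (\<epsilon> * (t - s))..\<epsilon> * (t - s)})) = T p q c"
    proof -
      have "z \<in> {- y..y} \<longleftrightarrow> \<bar>z\<bar> \<le> y" for z y :: real by (simp add: abs_le_iff minus_le_iff conj_commute)
      then show ?thesis unfolding T_def vimage_def by blast
    qed
    finally show ?thesis .
  qed
  have cover: "S \<subseteq> \<Union>((\<lambda>(p, q, c). T p q c) ` I)"
  proof
    fix x assume x: "x \<in> S"
    have "regular_on 0 (r0 / 2) (\<lambda>t. w \<bullet> f (x + t *\<^sub>R e))"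
      by (rule reg) (use mem[OF x] r0(2) in auto)
    \<comment> \<open>Half of \<epsilon> is reserved for rounding the slope to a rational
      number.\<close>
    then obtain p q c where pq: "0 < p" "p < q" "q < r0 / 2" and c: "\<And>s t. p \<le> s \<Longrightarrow> s < t \<Longrightarrow> t \<le> q \<Longrightarrow>
        \<bar>w \<bullet> f (x + t *\<^sub>R e) - w \<bullet> f (x + s *\<^sub>R e) - c * (t - s)\<bar> \<le> \<epsilon> / 2 * (t - s)"
      using regular_almost_affine[of 0 "r0 / 2" "\<lambda>t. w \<bullet> f (x + t *\<^sub>R e)" "\<epsilon> / 2"] r0(1) \<epsilon> by auto
    obtain p' where p': "p' \<in> \<rat>" "p < p'" "p' < q" by (rule Rats_between[OF pq(2)])
    obtain q' where q': "q' \<in> \<rat>" "p' < q'" "q' < q" by (rule Rats_between[OF p'(3)])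
    obtain c' where c': "c' \<in> \<rat>" "c < c'" "c' < c + \<epsilon> / 2" by (rule Rats_between[of c "c + \<epsilon> / 2"]) (use \<epsilon> in auto)
    have "x \<in> T p' q' c'"
      unfolding T_def
    proof (intro CollectI conjI allI impI x)
      fix s t assume st: "p' \<le> s" "s < t" "t \<le> q'"
      have "\<bar>w \<bullet> f (x + t *\<^sub>R e) - w \<bullet> f (x + s *\<^sub>R e) - c * (t - s)\<bar> \<le> \<epsilon> / 2 * (t - s)"
        by (rule c) (use st p' q' in auto)
      moreover have "\<bar>c - c'\<bar> * (t - s) \<le> \<epsilon> / 2 * (t - s)" using c' st by (intro mult_right_mono) auto
      then have "\<bar>(c - c') * (t - s)\<bar> \<le> \<epsilon> / 2 * (t - s)" using st by (simp add: abs_mult)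
      ultimately have "\<bar>(w \<bullet> f (x + t *\<^sub>R e) - w \<bullet> f (x + s *\<^sub>R e) - c * (t - s)) + (c - c') * (t - s)\<bar>
          \<le> \<epsilon> / 2 * (t - s) + \<epsilon> / 2 * (t - s)" by linarith
      then show "\<bar>w \<bullet> f (x + t *\<^sub>R e) - w \<bullet> f (x + s *\<^sub>R e) - c' * (t - s)\<bar> \<le> \<epsilon> * (t - s)"
        by (simp add: algebra_simps)
    qed
    moreover have "(p', q', c') \<in> I" using p' q' c' pq by (auto simp: I_def)
    ultimately show "x \<in> \<Union>((\<lambda>(p, q, c). T p q c) ` I)" by force
  qed
  obtain A b2 e2 where A: "A \<in> (\<lambda>(p, q, c). T p q c) ` I" "e2 > 0" "ball b2 e2 \<subseteq> A" "ball b2 e2 \<subseteq> ball a (r0 / 4)"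
  proof (rule closed_cover_ball[of "r0 / 4" "(\<lambda>(p, q, c). T p q c) ` I" a])
    show "countable ((\<lambda>(p, q, c). T p q c) ` I)" using \<open>countable I\<close> by (rule countable_image)
    show "closed A" if "A \<in> (\<lambda>(p, q, c). T p q c) ` I" for A
      using that closed_T by (auto simp: I_def)
    show "cball a (r0 / 4) \<subseteq> \<Union>((\<lambda>(p, q, c). T p q c) ` I)" using cover by (simp add: S_def)
  qed (use r0 in auto)
  then obtain p q c where pqc: "(p, q, c) \<in> I" "A = T p q c" by auto
  then have pq: "0 < p" "p < q" "q < r0 / 2" by (auto simp: I_def)
  define s0 where "s0 = (p + q) / 2"
  \<comment> \<open>The ball of base points is moved along e to the middle of the common parameter
    interval, which leaves room for h of either sign.\<close>
  define b where "b = b2 + s0 *\<^sub>R e"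
  define \<rho> where "\<rho> = min (min e2 ((q - p) / 4)) (r0 / 8)"
  have \<rho>: "\<rho> > 0" "\<rho> \<le> e2" "\<rho> \<le> (q - p) / 4" "\<rho> \<le> r0 / 8" using A(2) pq r0(1) by (auto simp: \<rho>_def min_def)
  show ?thesis
  proof (rule that[OF \<rho>(1), of b c])
    have "b2 \<in> ball b2 e2" using A(2) by simp
    then have "b2 \<in> ball a (r0 / 4)" using A(4) by blast
    then have b2: "dist a b2 < r0 / 4" by simp
    show "ball b \<rho> \<subseteq> ball a r0"
    proof
      fix y assume "y \<in> ball b \<rho>"
      then have "dist b y < r0 / 8" using \<rho> by simp
      moreover have "dist b2 b = s0" using e pq by (simp add: b_def s0_def dist_norm)
      moreover have "dist a y \<le> dist a b2 + dist b2 b + dist b y"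
        using dist_triangle[of a y b2] dist_triangle[of b2 y b] by linarith
      moreover have "s0 < r0 / 2" using pq by (simp add: s0_def)
      ultimately have "dist a y < r0" using b2 r0(1) by linarith
      then show "y \<in> ball a r0" by simp
    qed
    fix x h assume x: "x \<in> ball b \<rho>" "x + h *\<^sub>R e \<in> ball b \<rho>"
    define y where "y = x - s0 *\<^sub>R e"
    have "dist b2 y = dist b x" by (simp add: y_def b_def dist_norm algebra_simps)
    then have "y \<in> ball b2 e2" using x \<rho> by simp
    then have yT: "y \<in> T p q c" using A(3) pqc(2) by blast
    have xy: "x = y + s0 *\<^sub>R e" "x + h *\<^sub>R e = y + (s0 + h) *\<^sub>R e" by (simp_all add: y_def algebra_simps)
    have "\<bar>h\<bar> = dist x (x + h *\<^sub>R e)" using e by (simp add: dist_norm)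
    also have "\<dots> \<le> dist b x + dist b (x + h *\<^sub>R e)" by (metis dist_commute dist_triangle2)
    also have "\<dots> < (q - p) / 2" using x \<rho> by simp
    finally have h: "\<bar>h\<bar> < (q - p) / 2" .
    have *: "\<bar>w \<bullet> f (y + t *\<^sub>R e) - w \<bullet> f (y + s *\<^sub>R e) - c * (t - s)\<bar> \<le> \<epsilon> * (t - s)"
      if "p \<le> s" "s < t" "t \<le> q" for s t using yT that unfolding T_def by blast
    consider "h = 0" | "h > 0" | "h < 0" by linarith
    then show "\<bar>w \<bullet> f (x + h *\<^sub>R e) - w \<bullet> f x - c * h\<bar> \<le> \<epsilon> * \<bar>h\<bar>"
    proof cases
      case 1
      then show ?thesis by simp
    next
      case 2
      have "p \<le> s0" "s0 < s0 + h" "s0 + h \<le> q" using 2 h pq by (auto simp: s0_def field_simps)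
      from *[OF this] show ?thesis unfolding xy(2) unfolding xy(1) using 2 by simp
    next
      case 3
      have "p \<le> s0 + h" "s0 + h < s0" "s0 \<le> q" using 3 h pq by (auto simp: s0_def abs_if field_simps)
      from *[OF this] show ?thesis unfolding xy(2) unfolding xy(1) using 3 by (simp add: abs_le_iff algebra_simps)
    qed
  qed
qed

text \<open>Pairs are treated one after the other, each in a ball inside the previous one.\<close>

lemma coordinates_almost_affine:
  assumes "finite P" "\<And>e w. (e, w) \<in> P \<Longrightarrow> norm e = 1" and r0: "r0 > 0" "ball a r0 \<subseteq> U" and \<epsilon>: "\<epsilon> > 0"
  shows "\<exists>b \<rho> c. \<rho> > 0 \<and> ball b \<rho> \<subseteq> ball a r0 \<and> (\<forall>(e, w)\<in>P. \<forall>x h. x \<in> ball b \<rho> \<longrightarrow> x + h *\<^sub>R e \<in> ball b \<rho> \<longrightarrow>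
    \<bar>w \<bullet> f (x + h *\<^sub>R e) - w \<bullet> f x - c e w * h\<bar> \<le> \<epsilon> * \<bar>h\<bar>)"
  using assms(1,2)
proof (induction P rule: finite_induct)
  case empty
  then show ?case using r0 by auto
next
  case (insert X P)
  obtain e0 w0 where X: "X = (e0, w0)" by (cases X)
  obtain b \<rho> c where IH: "\<rho> > 0" "ball b \<rho> \<subseteq> ball a r0"
    "\<And>e w x h. (e, w) \<in> P \<Longrightarrow> x \<in> ball b \<rho> \<Longrightarrow> x + h *\<^sub>R e \<in> ball b \<rho> \<Longrightarrow>
      \<bar>w \<bullet> f (x + h *\<^sub>R e) - w \<bullet> f x - c e w * h\<bar> \<le> \<epsilon> * \<bar>h\<bar>"
    using insert.IH insert.prems by fast
  have "ball b \<rho> \<subseteq> U" "norm e0 = 1" using IH(2) r0 insert.prems X by auto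
  then obtain b' \<rho>' c' where N: "\<rho>' > 0" "ball b' \<rho>' \<subseteq> ball b \<rho>"
    "\<And>x h. x \<in> ball b' \<rho>' \<Longrightarrow> x + h *\<^sub>R e0 \<in> ball b' \<rho>' \<Longrightarrow> \<bar>w0 \<bullet> f (x + h *\<^sub>R e0) - w0 \<bullet> f x - c' * h\<bar> \<le> \<epsilon> * \<bar>h\<bar>"
    using coordinate_almost_affine[OF IH(1) _ _ \<epsilon>] by metis
  define c2 where "c2 e w = (if e = e0 \<and> w = w0 then c' else c e w)" for e w
  show ?case
  proof (intro exI[of _ b'] exI[of _ \<rho>'] exI[of _ c2] conjI)
    show "\<forall>(e, w)\<in>insert X P. \<forall>x h. x \<in> ball b' \<rho>' \<longrightarrow> x + h *\<^sub>R e \<in> ball b' \<rho>' \<longrightarrow>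
      \<bar>w \<bullet> f (x + h *\<^sub>R e) - w \<bullet> f x - c2 e w * h\<bar> \<le> \<epsilon> * \<bar>h\<bar>"
    proof clarify
      fix e w x h assume ew: "(e, w) \<in> insert X P" and x: "x \<in> ball b' \<rho>'" "x + h *\<^sub>R e \<in> ball b' \<rho>'"
      show "\<bar>w \<bullet> f (x + h *\<^sub>R e) - w \<bullet> f x - c2 e w * h\<bar> \<le> \<epsilon> * \<bar>h\<bar>"
      proof (cases "e = e0 \<and> w = w0")
        case True
        then show ?thesis using N(3)[of x h] x by (simp add: c2_def)
      next
        case False
        then have "(e, w) \<in> P" using ew X by auto
        moreover have "x \<in> ball b \<rho>" "x + h *\<^sub>R e \<in> ball b \<rho>" using x N(2) by auto
        ultimately show ?thesis using IH(3) unfolding c2_def if_not_P[OF False] by blast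
      qed
    qed
  qed (use N IH in auto)
qed

text \<open>Pass from x to y one coordinate at a time through the points \<open>z E\<close>; L is
  assembled from the slopes of the components of f along the basis vectors.\<close>

lemma almost_linear_dense:
  assumes r0: "r0 > 0" "ball a r0 \<subseteq> U" and \<epsilon>: "\<epsilon> > 0"
  obtains b where "b \<in> ball a r0" "almost_linear f \<epsilon> b"
proof -
  \<comment> \<open>One factor pays for the sum over the components of the value, the other for the
    sum of |d . e| \<le> |d| over the basis vectors e.\<close>
  define \<epsilon>' where "\<epsilon>' = \<epsilon> / (real DIM('b) * real DIM('a))"
  have \<epsilon>': "\<epsilon>' > 0" using \<epsilon> by (simp add: \<epsilon>'_def)
  have "\<exists>b \<rho> c. \<rho> > 0 \<and> ball b \<rho> \<subseteq> ball a r0 \<and> (\<forall>(e, w)\<in>Basis \<times> Basis. \<forall>x h. x \<in> ball b \<rho> \<longrightarrow>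
      x + h *\<^sub>R e \<in> ball b \<rho> \<longrightarrow> \<bar>w \<bullet> f (x + h *\<^sub>R e) - w \<bullet> f x - c e w * h\<bar> \<le> \<epsilon>' * \<bar>h\<bar>)"
    by (rule coordinates_almost_affine) (use r0 \<epsilon>' in auto)
  then obtain b \<rho> c where b: "\<rho> > 0" "ball b \<rho> \<subseteq> ball a r0"
    and aff': "\<forall>(e, w)\<in>Basis \<times> Basis. \<forall>x h. x \<in> ball b \<rho> \<longrightarrow> x + h *\<^sub>R e \<in> ball b \<rho> \<longrightarrow>
      \<bar>w \<bullet> f (x + h *\<^sub>R e) - w \<bullet> f x - c e w * h\<bar> \<le> \<epsilon>' * \<bar>h\<bar>" by blast
  have aff: "\<bar>w \<bullet> f (x + h *\<^sub>R e) - w \<bullet> f x - c e w * h\<bar> \<le> \<epsilon>' * \<bar>h\<bar>"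
    if "e \<in> Basis" "w \<in> Basis" "x \<in> ball b \<rho>" "x + h *\<^sub>R e \<in> ball b \<rho>" for e w x h
    using aff' that by blast
  define L where "L z = (\<Sum>w\<in>Basis. (\<Sum>e\<in>Basis. c e w * (z \<bullet> e)) *\<^sub>R w)" for z :: 'a
  have "bounded_linear L" unfolding L_def
    by (intro bounded_linear_sum bounded_linear_compose[OF bounded_linear_scaleR_left]
      bounded_linear_const_mult bounded_linear_inner_left)
  \<comment> \<open>In the ball of radius \<rho>/3 displacements are below 2\<rho>/3, so all
    intermediate points stay within \<rho> of b.\<close>
  moreover have "norm (f y - f x - L (y - x)) \<le> \<epsilon> * norm (y - x)" if x: "x \<in> ball b (\<rho> / 3)" and y: "y \<in> ball b (\<rho> / 3)" for x y
  proof -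
    define d where "d = y - x"
    have "norm d = dist y x" by (simp add: d_def dist_norm)
    moreover have "dist y x \<le> dist b y + dist b x" by (rule dist_triangle3)
    moreover have "dist b x < \<rho> / 3" "dist b y < \<rho> / 3" using x y by auto
    ultimately have d: "norm d < 2 * \<rho> / 3" by linarith
    define z where "z E = x + (\<Sum>e\<in>E. (d \<bullet> e) *\<^sub>R e)" for E
    have z: "z E \<in> ball b \<rho>" if "E \<subseteq> Basis" for E
    proof -
      have "norm (\<Sum>e\<in>E. (d \<bullet> e) *\<^sub>R e) \<le> norm d"
      proof (rule norm_le_componentwise)
        fix k :: 'a assume k: "k \<in> Basis"
        have "finite E" by (rule finite_subset[OF that finite_Basis])
        then have "(\<Sum>e\<in>E. (d \<bullet> e) *\<^sub>R e) \<bullet> k = (\<Sum>e\<in>E. if e = k then d \<bullet> k else 0)"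
          unfolding inner_sum_left using that k by (intro sum.cong) (auto simp: inner_Basis)
        also have "\<dots> = (if k \<in> E then d \<bullet> k else 0)" using \<open>finite E\<close> by simp
        finally show "\<bar>(\<Sum>e\<in>E. (d \<bullet> e) *\<^sub>R e) \<bullet> k\<bar> \<le> \<bar>d \<bullet> k\<bar>" by simp
      qed
      moreover have "dist b (z E) \<le> dist b x + norm (\<Sum>e\<in>E. (d \<bullet> e) *\<^sub>R e)"
        using dist_triangle[of b "z E" x] by (simp add: z_def dist_norm)
      moreover have "dist b x < \<rho> / 3" using x by simp
      ultimately have "dist b (z E) < \<rho>" using d by linarith
      then show ?thesis by simp
    qed
    have comp: "\<bar>w \<bullet> f (z E) - w \<bullet> f x - (\<Sum>e\<in>E. c e w * (d \<bullet> e))\<bar> \<le> \<epsilon>' * (\<Sum>e\<in>E. \<bar>d \<bullet> e\<bar>)"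
      if w: "w \<in> Basis" and E: "E \<subseteq> Basis" for w E
      using finite_subset[OF E finite_Basis] E
    proof (induction E rule: finite_induct)
      case empty
      then show ?case by (simp add: z_def)
    next
      case (insert e E)
      have ze: "z (insert e E) = z E + (d \<bullet> e) *\<^sub>R e" using insert.hyps by (simp add: z_def)
      have "insert e E \<subseteq> Basis" "E \<subseteq> Basis" "e \<in> Basis" using insert.prems by auto
      note m = z[OF this(1)] z[OF this(2)] this(3)
      have "\<bar>w \<bullet> f (z (insert e E)) - w \<bullet> f (z E) - c e w * (d \<bullet> e)\<bar> \<le> \<epsilon>' * \<bar>d \<bullet> e\<bar>"
        unfolding ze by (rule aff[OF m(3) w m(2) m(1)[unfolded ze]])
      moreover have "\<bar>w \<bullet> f (z E) - w \<bullet> f x - (\<Sum>e\<in>E. c e w * (d \<bullet> e))\<bar> \<le> \<epsilon>' * (\<Sum>e\<in>E. \<bar>d \<bullet> e\<bar>)"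
        using insert by simp
      ultimately show ?case using insert.hyps by (simp add: distrib_left)
    qed
    have zB: "z Basis = y" by (simp add: z_def euclidean_representation d_def)
    have "norm (f y - f x - L d) \<le> (\<Sum>w\<in>Basis. \<bar>(f y - f x - L d) \<bullet> w\<bar>)" by (rule norm_le_l1)
    also have "\<dots> \<le> (\<Sum>w\<in>(Basis :: 'b set). \<epsilon>' * (\<Sum>e\<in>(Basis :: 'a set). \<bar>d \<bullet> e\<bar>))"
    proof (intro sum_mono)
      fix w :: 'b assume w: "w \<in> Basis"
      have "L d \<bullet> w = (\<Sum>e\<in>Basis. c e w * (d \<bullet> e))"
        unfolding L_def inner_sum_left using w by (simp add: inner_Basis if_distrib sum.If_cases cong: if_cong)
      then show "\<bar>(f y - f x - L d) \<bullet> w\<bar> \<le> \<epsilon>' * (\<Sum>e\<in>(Basis :: 'a set). \<bar>d \<bullet> e\<bar>)"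
        using comp[OF w order_refl]
        by (simp add: zB inner_diff_left inner_commute[of "f y" w] inner_commute[of "f x" w])
    qed
    also have "\<dots> \<le> (\<Sum>w\<in>(Basis :: 'b set). \<epsilon>' * (\<Sum>e\<in>(Basis :: 'a set). norm d))"
      by (intro sum_mono mult_left_mono Basis_le_norm) (use \<epsilon>' in auto)
    also have "\<dots> = \<epsilon> * norm d" by (simp add: \<epsilon>'_def)
    finally show ?thesis by (simp add: d_def)
  qed
  ultimately have "almost_linear f \<epsilon> b"
    unfolding almost_linear_def using b(1) by (intro exI[of _ "\<rho> / 3"] conjI exI[of _ L]) auto
  moreover have "b \<in> ball a r0" by (rule subsetD[OF b(2)]) (use b(1) in simp)
  ultimately show ?thesis using that by blast
qed

text \<open>For each n the points of near linearity with error 1/(n + 1) form a set that is open,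
  and dense in U; by Baire these sets have a common point in the ball.\<close>

lemma differentiable_dense:
  assumes r0: "r0 > 0" "ball a r0 \<subseteq> U"
  obtains d where "d \<in> ball a r0" "f differentiable (at d)"
proof -
  define \<F> where "\<F> = range (\<lambda>n. - {d. almost_linear f (1 / real (Suc n)) d})"
  have "\<not> cball a (r0 / 2) \<subseteq> \<Union>\<F>"
  proof
    assume "cball a (r0 / 2) \<subseteq> \<Union>\<F>"
    moreover have "closed T" if "T \<in> \<F>" for T using that open_almost_linear by (auto simp: \<F>_def)
    moreover have "countable \<F>" by (simp add: \<F>_def)
    ultimately obtain T b s where T: "T \<in> \<F>" "s > 0" "ball b s \<subseteq> T" "ball b s \<subseteq> ball a (r0 / 2)"
      using closed_cover_ball[of "r0 / 2" \<F> a] r0(1) by (metis half_gt_zero)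
    then obtain n where n: "T = - {d. almost_linear f (1 / real (Suc n)) d}" by (auto simp: \<F>_def)
    have "ball b s \<subseteq> U" using T(4) r0 by (force simp: subset_iff)
    moreover have "1 / real (Suc n) > 0" by simp
    ultimately obtain d where "d \<in> ball b s" "almost_linear f (1 / real (Suc n)) d"
      by (rule almost_linear_dense[OF T(2)])
    then show False using T(3) n by blast
  qed
  then obtain d where "d \<in> cball a (r0 / 2)" "d \<notin> \<Union>\<F>" by blast
  then have "\<And>n. almost_linear f (1 / Suc n) d" "d \<in> ball a r0" using r0(1) by (auto simp: \<F>_def)
  then show ?thesis using almost_linear_imp_differentiable that by blast
qed

text \<open>For p < q the base points whose line avoids near linearity during (p, q) form a closed
  set. It contains no ball inside the given one, because the translate of such a ball by (p + q)/2
  times v lies in U and contains near linear points. Baire over all rational p and q gives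
  y.\<close>

lemma almost_linear_dense_on_line:
  assumes r: "r > 0" "\<And>y t. y \<in> ball x r \<Longrightarrow> 0 < t \<Longrightarrow> t < 1 \<Longrightarrow> y + t *\<^sub>R v \<in> U" and \<epsilon>: "\<epsilon> > 0"
  obtains y where "y \<in> ball x r" "\<And>p q. 0 < p \<Longrightarrow> p < q \<Longrightarrow> q < 1 \<Longrightarrow> \<exists>t. p < t \<and> t < q \<and> almost_linear f \<epsilon> (y + t *\<^sub>R v)"
proof -
  define T where "T p q = {y. \<forall>t. p < t \<longrightarrow> t < q \<longrightarrow> \<not> almost_linear f \<epsilon> (y + t *\<^sub>R v)}" for p q
  define I where "I = {(p :: real, q :: real). p \<in> \<rat> \<and> q \<in> \<rat> \<and> 0 < p \<and> p < q \<and> q < 1}"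
  have "I \<subseteq> \<rat> \<times> \<rat>" by (auto simp: I_def)
  then have "countable I" by (rule countable_subset) (intro countable_SIGMA countable_rat)
  have closed_T: "closed (T p q)" for p q
  proof -
    have "closed ((\<lambda>y. y + t *\<^sub>R v) -` (- {d. almost_linear f \<epsilon> d}))" for t
      by (intro continuous_closed_vimage) (use open_almost_linear in \<open>auto intro!: continuous_intros\<close>)
    then have "closed (\<Inter>t\<in>{p<..<q}. (\<lambda>y. y + t *\<^sub>R v) -` (- {d. almost_linear f \<epsilon> d}))"
      by (intro closed_INT) auto
    also have "(\<Inter>t\<in>{p<..<q}. (\<lambda>y. y + t *\<^sub>R v) -` (- {d. almost_linear f \<epsilon> d})) = T p q"
      by (auto simp: T_def)
    finally show ?thesis .
  qed
  have "\<not> cball x (r / 2) \<subseteq> \<Union>((\<lambda>(p, q). T p q) ` I)"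
  proof
    assume c: "cball x (r / 2) \<subseteq> \<Union>((\<lambda>(p, q). T p q) ` I)"
    obtain A b s where A: "A \<in> (\<lambda>(p, q). T p q) ` I" "s > 0" "ball b s \<subseteq> A" "ball b s \<subseteq> ball x (r / 2)"
      by (rule closed_cover_ball[OF _ _ _ c]) (use r(1) closed_T \<open>countable I\<close> in auto)
    then obtain p q where pq: "A = T p q" "0 < p" "p < q" "q < 1" by (auto simp: I_def)
    define t where "t = (p + q) / 2"
    have t: "p < t" "t < q" "0 < t" "t < 1" using pq by (auto simp: t_def)
    have "ball (b + t *\<^sub>R v) s \<subseteq> U"
    proof
      fix u assume "u \<in> ball (b + t *\<^sub>R v) s"
      then have "u - t *\<^sub>R v \<in> ball b s" by (simp add: dist_norm algebra_simps)
      then have "u - t *\<^sub>R v \<in> ball x r" using A(4) r(1) by force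
      then show "u \<in> U" using r(2)[OF _ t(3,4)] by fastforce
    qed
    then obtain u where u: "u \<in> ball (b + t *\<^sub>R v) s" "almost_linear f \<epsilon> u"
      by (rule almost_linear_dense[OF A(2) _ \<epsilon>])
    have "u - t *\<^sub>R v \<in> ball b s" using u(1) by (simp add: dist_norm algebra_simps)
    then have "u - t *\<^sub>R v \<in> T p q" using A(3) pq(1) by blast
    then show False using t u(2) by (auto simp: T_def)
  qed
  then obtain y where y: "y \<in> cball x (r / 2)" "y \<notin> \<Union>((\<lambda>(p, q). T p q) ` I)" by blast
  show ?thesis
  proof (rule that[of y])
    show "y \<in> ball x r" using y(1) r(1) by simp
    fix p q :: real assume pq: "0 < p" "p < q" "q < 1"
    obtain p' where p': "p' \<in> \<rat>" "p < p'" "p' < q" by (rule Rats_between[OF pq(2)])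
    obtain q' where q': "q' \<in> \<rat>" "p' < q'" "q' < q" by (rule Rats_between[OF p'(3)])
    have "(p', q') \<in> I" using p' q' pq by (auto simp: I_def)
    then have "y \<notin> T p' q'" using y(2) by blast
    then obtain t where "p' < t" "t < q'" "almost_linear f \<epsilon> (y + t *\<^sub>R v)" by (auto simp: T_def)
    then show "\<exists>t. p < t \<and> t < q \<and> almost_linear f \<epsilon> (y + t *\<^sub>R v)" using p' q' by (intro exI[of _ t]) auto
  qed
qed

text \<open>If the inequality failed at x, it would fail for all base points near x, among them a
  generic one y. On the line through y the function g s - c s increases locally at a dense set of
  parameters: there f is nearly affine with linear part L, and L is close to a derivative of f at a
  nearby point d, possibly off the line, where the lower bound \<mu> holds. The gap between c and
  \<mu> absorbs the errors.\<close>

lemma increment_lower_bound: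
  assumes "convex U" and x: "x \<in> U" "x + v \<in> U" and w: "norm w = 1"
    and low: "\<And>d f'. d \<in> U \<Longrightarrow> (f has_derivative f') (at d) \<Longrightarrow> w \<bullet> f' v \<ge> \<mu>"
    and c: "c < \<mu>"
  shows "w \<bullet> (f (x + v) - f x) \<ge> c"
proof (rule ccontr)
  assume no: "\<not> w \<bullet> (f (x + v) - f x) \<ge> c"
  define F where "F y = w \<bullet> (f (y + v) - f y)" for y
  have "isCont F x"
  proof -
    have "isCont f x" "isCont f (x + v)"
      using cont_f open_U x by (auto simp: continuous_on_eq_continuous_at)
    then show ?thesis unfolding F_def by (intro continuous_intros isCont_o2[of x "\<lambda>y. y + v" f]) auto
  qed
  then have "(F \<longlongrightarrow> F x) (nhds x)"
    unfolding isCont_def tendsto_at_iff_tendsto_nhds .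
  then have "\<forall>\<^sub>F y in nhds x. F y < c"
    by (rule order_tendstoD(2)) (use no in \<open>simp add: F_def\<close>)
  then obtain r1 where r1: "r1 > 0" "\<And>y. y \<in> ball x r1 \<Longrightarrow> w \<bullet> (f (y + v) - f y) < c"
    unfolding eventually_nhds_metric F_def by (auto simp: dist_commute)
  obtain r2 where r2: "r2 > 0" "ball x r2 \<subseteq> U" by (rule openE[OF open_U x(1)])
  obtain r3 where r3: "r3 > 0" "ball (x + v) r3 \<subseteq> U" by (rule openE[OF open_U x(2)])
  define r where "r = min r1 (min r2 r3)"
  have r: "r > 0" "r \<le> r1" "r \<le> r2" "r \<le> r3" using r1 r2 r3 by (auto simp: r_def)
  have line: "y + t *\<^sub>R v \<in> U" if y: "y \<in> ball x r" and t: "0 \<le> t" "t \<le> 1" for y t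
  proof -
    have "y \<in> U" using y r2 r(3) by auto
    moreover have "y + v \<in> ball (x + v) r3" using y r(4) by (simp add: dist_norm)
    then have "y + v \<in> U" using r3 by blast
    ultimately have "(1 - t) *\<^sub>R y + t *\<^sub>R (y + v) \<in> U" using t \<open>convex U\<close> by (intro convexD) auto
    then show ?thesis by (simp add: algebra_simps)
  qed
  \<comment> \<open>Two errors \<epsilon> |v| occur, one between L and a derivative, one between L
    and the increments of f; together they are at most half of \<mu> - c.\<close>
  define \<epsilon> where "\<epsilon> = (\<mu> - c) / (4 * (norm v + 1))"
  have pos: "norm v + 1 > 0" by (simp add: add_nonneg_pos)
  have \<epsilon>: "\<epsilon> > 0" using c pos by (simp add: \<epsilon>_def)
  have "\<epsilon> * norm v \<le> \<epsilon> * (norm v + 1)" using \<epsilon> by (intro mult_left_mono) auto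
  also have "\<dots> = (\<mu> - c) / 4"
  proof -
    have "(\<mu> - c) / (4 * X) * X = (\<mu> - c) / 4" if "X > 0" for X :: real using that by simp
    from this[OF pos] show ?thesis unfolding \<epsilon>_def .
  qed
  finally have \<epsilon>v: "\<epsilon> * norm v \<le> (\<mu> - c) / 4" .
  obtain y where y: "y \<in> ball x r" and dense: "\<And>p q. 0 < p \<Longrightarrow> p < q \<Longrightarrow> q < 1 \<Longrightarrow> \<exists>t. p < t \<and> t < q \<and> almost_linear f \<epsilon> (y + t *\<^sub>R v)"
    by (rule almost_linear_dense_on_line[OF r(1) line \<epsilon>]) auto
  define g where "g t = w \<bullet> f (y + t *\<^sub>R v)" for t
  have inc: "loc_increasing (\<lambda>s. g s - c * s) t" if t: "0 < t" "t < 1" and al: "almost_linear f \<epsilon> (y + t *\<^sub>R v)" for t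
  proof -
    define a where "a = y + t *\<^sub>R v"
    obtain r4 L where r4: "r4 > 0" and L: "bounded_linear L"
      and est: "\<And>x y. x \<in> ball a r4 \<Longrightarrow> y \<in> ball a r4 \<Longrightarrow> norm (f y - f x - L (y - x)) \<le> \<epsilon> * norm (y - x)"
      using al unfolding almost_linear_def a_def by blast
    have "a \<in> U" unfolding a_def by (rule line[OF y]) (use t in auto)
    then obtain r5 where r5: "r5 > 0" "ball a r5 \<subseteq> U" by (rule openE[OF open_U])
    have "ball a (min r4 r5) \<subseteq> U" using r5 by auto
    then obtain d where d: "d \<in> ball a (min r4 r5)" "f differentiable (at d)"
      using differentiable_dense[of "min r4 r5" a] r4 r5(1) by (metis min_less_iff_conj)
    then obtain f' where f': "(f has_derivative f') (at d)" unfolding differentiable_def by blast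
    have "d \<in> U" using d r5 by auto
    have cl: "norm (f' v - L v) \<le> \<epsilon> * norm v"
      by (rule almost_linear_derivative_close[OF _ f' L est, of a r4]) (use d in auto)
    have inner_le: "\<bar>w \<bullet> z\<bar> \<le> norm z" for z using Cauchy_Schwarz_ineq2[of w z] w by simp
    have "\<mu> \<le> w \<bullet> f' v" by (rule low[OF \<open>d \<in> U\<close> f'])
    also have "\<dots> = w \<bullet> L v + w \<bullet> (f' v - L v)" by (simp add: inner_diff_right)
    also have "\<dots> \<le> w \<bullet> L v + \<epsilon> * norm v" using inner_le[of "f' v - L v"] cl by linarith
    finally have wL: "w \<bullet> L v \<ge> \<mu> - \<epsilon> * norm v" by simp
    define \<eta> where "\<eta> = r4 / (norm v + 1)"
    have \<eta>: "\<eta> > 0" using r4 pos by (simp add: \<eta>_def)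
    have near: "y + s *\<^sub>R v \<in> ball a r4" if "\<bar>s - t\<bar> < \<eta>" for s
    proof -
      have "y + s *\<^sub>R v - a = (s - t) *\<^sub>R v" by (simp add: a_def algebra_simps)
      then have "dist a (y + s *\<^sub>R v) = \<bar>s - t\<bar> * norm v" by (metis dist_commute dist_norm norm_scaleR)
      also have "\<dots> \<le> \<bar>s - t\<bar> * (norm v + 1)" by (intro mult_left_mono) auto
      also have "\<dots> < \<eta> * (norm v + 1)" using that pos by (intro mult_strict_right_mono) auto
      also have "\<dots> = r4" using pos by (simp add: \<eta>_def)
      finally show ?thesis by simp
    qed
    show ?thesis
      unfolding loc_increasing_def
    proof (intro exI[of _ \<eta>] conjI allI impI \<eta>)
      fix s s' assume s: "t - \<eta> < s" "s < s'" "s' < t + \<eta>"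
      have "\<bar>s - t\<bar> < \<eta>" "\<bar>s' - t\<bar> < \<eta>" using s by auto
      note m = near[OF this(1)] near[OF this(2)]
      have df: "(y + s' *\<^sub>R v) - (y + s *\<^sub>R v) = (s' - s) *\<^sub>R v" by (simp add: algebra_simps)
      define z where "z = f (y + s' *\<^sub>R v) - f (y + s *\<^sub>R v) - L ((s' - s) *\<^sub>R v)"
      have "norm z \<le> \<epsilon> * norm ((s' - s) *\<^sub>R v)" unfolding z_def using est[OF m] unfolding df .
      then have z: "\<bar>w \<bullet> z\<bar> \<le> (s' - s) * (\<epsilon> * norm v)" using inner_le[of z] s by (simp add: mult.left_commute[of \<epsilon>])
      have "g s' - g s = (s' - s) * (w \<bullet> L v) + w \<bullet> z"
        by (simp add: g_def z_def inner_diff_right linear_scale[OF bounded_linear.linear[OF L]])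
      also have "\<dots> \<ge> (s' - s) * (\<mu> - \<epsilon> * norm v) - (s' - s) * (\<epsilon> * norm v)"
        using z mult_left_mono[OF wL, of "s' - s"] s by linarith
      also have "(s' - s) * (\<mu> - \<epsilon> * norm v) - (s' - s) * (\<epsilon> * norm v) = (s' - s) * (\<mu> - 2 * (\<epsilon> * norm v))"
        by (simp add: algebra_simps)
      finally have "g s' - g s \<ge> (s' - s) * (\<mu> - 2 * (\<epsilon> * norm v))" .
      moreover have "(s' - s) * (\<mu> - 2 * (\<epsilon> * norm v)) > (s' - s) * c"
        using s \<epsilon>v c by (intro mult_strict_left_mono) auto
      ultimately show "g s - c * s < g s' - c * s'" by (simp add: algebra_simps)
    qed
  qed
  have regg: "regular_on 0 1 g" unfolding g_def by (rule reg) (use line[OF y] in auto)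
  have mid: "g p - c * p \<le> g q - c * q" if "0 < p" "p < q" "q < 1" for p q
  proof (rule regular_increasing[OF regg _ that])
    show "\<exists>t. p < t \<and> t < q \<and> loc_increasing (\<lambda>s. g s - c * s) t" if "0 < p" "p < q" "q < 1" for p q
      using dense[OF that] inc that by (meson less_trans)
  qed
  have cont: "continuous_on {0..1} (\<lambda>s. g s - c * s)"
    unfolding g_def
    by (intro continuous_intros continuous_on_compose2[OF cont_f]) (use line[OF y] in auto)
  have "g 0 - c * 0 \<le> g (1/2) - c * (1/2)"
  proof (rule continuous_le_on_closure[of "{0<..<1/2}" "\<lambda>s. g s - c * s"])
    show "continuous_on (closure {0<..<1/2}) (\<lambda>s. g s - c * s)"
      by (rule continuous_on_subset[OF cont]) auto
    show "g s - c * s \<le> g (1/2) - c * (1/2)" if "s \<in> {0<..<1/2}" for s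
      by (rule mid) (use that in auto)
  qed auto
  moreover have "g (1/2) - c * (1/2) \<le> g 1 - c * 1"
  proof (rule continuous_ge_on_closure[of "{1/2<..<1}" "\<lambda>s. g s - c * s"])
    show "continuous_on (closure {1/2<..<1}) (\<lambda>s. g s - c * s)"
      by (rule continuous_on_subset[OF cont]) auto
    show "g (1/2) - c * (1/2) \<le> g s - c * s" if "s \<in> {1/2<..<1}" for s
      by (rule mid) (use that in auto)
  qed auto
  ultimately have "w \<bullet> (f (y + v) - f y) \<ge> c" by (simp add: g_def inner_diff_right)
  moreover have "y \<in> ball x r1" using y r(2) by simp
  ultimately show False using r1(2) by fastforce
qed

end

section \<open>The expansion estimate\<close>

lemma tame_regular_on_lines:
  fixes f :: "real^'m \<Rightarrow> real^'n"
  assumes "open U" "continuous_on U f" "tame f U"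
  shows "regular_on_lines f U"
proof
  fix x v :: "real^'m" and w :: "real^'n" and a b :: real
  assume line: "\<And>t. a < t \<Longrightarrow> t < b \<Longrightarrow> x + t *\<^sub>R v \<in> U"
  have "continuous_on {a<..<b} (\<lambda>t. w \<bullet> f (x + t *\<^sub>R v))"
    by (intro continuous_intros continuous_on_compose2[OF assms(2)]) (use line in auto)
  moreover have "(\<forall>c t. a < t \<longrightarrow> t < b \<longrightarrow> signed_at (\<lambda>s. w \<bullet> f (x + s *\<^sub>R v) - c * s) t) \<or>
     (\<exists>C. countable C \<and> (\<forall>t. a < t \<longrightarrow> t < b \<longrightarrow> t \<notin> C \<longrightarrow> C1_at (\<lambda>t. w \<bullet> f (x + t *\<^sub>R v)) t))"
    using assms(3) unfolding tame_def
  proof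
    assume "subanalytic (CARD('m) + CARD('n)) (graph_in_Rn f U)"
    from subanalytic_line_C1_at[OF this assms(1,2)] line show ?thesis by meson
  next
    assume "\<exists>S. o_minimal_structure S \<and> graph_in_Rn f U \<in> S (CARD('m) + CARD('n))"
    then obtain S where "o_minimal_structure S" "graph_in_Rn f U \<in> S (CARD('m) + CARD('n))" by blast
    from o_minimal_line_signed_at[OF this assms(1) line] show ?thesis by blast
  qed
  ultimately show "regular_on a b (\<lambda>t. w \<bullet> f (x + t *\<^sub>R v))" unfolding regular_on_def by blast
qed (use assms in auto)

text \<open>\<open>A\<close> minus the rank-one map \<open>u \<mapsto> (v \<bullet> u / \<bar>v\<bar>\<^sup>2) A v\<close> annihilates \<open>v\<close>.\<close>

lemma norm_ge_infdist_singular: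
  fixes A :: "(real^'m) \<Rightarrow>\<^sub>L (real^'n)"
  shows "infdist A singular_maps * norm v \<le> norm (blinfun_apply A v)"
proof (cases "v = 0")
  case False
  define R :: "(real^'m) \<Rightarrow>\<^sub>L (real^'n)" where "R = Blinfun (\<lambda>u. (v \<bullet> u / (norm v)\<^sup>2) *\<^sub>R blinfun_apply A v)"
  have "bounded_linear (\<lambda>u. (v \<bullet> u / (norm v)\<^sup>2) *\<^sub>R blinfun_apply A v)"
    by (intro bounded_linear_scaleR_const bounded_linear_divide[THEN bounded_linear_compose] bounded_linear_inner_right)
  then have R: "blinfun_apply R u = (v \<bullet> u / (norm v)\<^sup>2) *\<^sub>R blinfun_apply A v" for u
    unfolding R_def by (simp add: bounded_linear_Blinfun_apply)
  have "blinfun_apply (A - R) v = blinfun_apply (A - R) 0"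
    using False by (simp add: minus_blinfun.rep_eq R power2_norm_eq_inner)
  then have "A - R \<in> singular_maps" unfolding singular_maps_def using False by (metis CollectI injD)
  then have "infdist A singular_maps \<le> dist A (A - R)" by (rule infdist_le)
  also have "\<dots> = norm R" by (simp add: dist_norm)
  also have "\<dots> \<le> norm (blinfun_apply A v) / norm v"
  proof (rule norm_blinfun_bound)
    fix u
    have "norm (blinfun_apply R u) = \<bar>v \<bullet> u\<bar> / (norm v)\<^sup>2 * norm (blinfun_apply A v)" by (simp add: R)
    also have "\<dots> \<le> (norm v * norm u) / (norm v)\<^sup>2 * norm (blinfun_apply A v)"
      by (intro mult_right_mono divide_right_mono Cauchy_Schwarz_ineq2) auto
    also have "\<dots> = norm (blinfun_apply A v) / norm v * norm u" by (simp add: power2_eq_square)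
    finally show "norm (blinfun_apply R u) \<le> norm (blinfun_apply A v) / norm v * norm u" .
  qed simp
  finally show ?thesis using False by (simp add: pos_le_divide_eq)
qed simp

text \<open>w is the direction of the point p of the closure nearest to 0: by convexity S lies in
  the half space p . s \<ge> |p|^2, and |p| \<ge> \<mu>.\<close>

lemma convex_separating_direction:
  fixes S :: "'a::euclidean_space set"
  assumes "convex S" "S \<noteq> {}" "\<mu> > 0" "\<And>s. s \<in> S \<Longrightarrow> norm s \<ge> \<mu>"
  obtains w where "norm w = 1" "\<And>s. s \<in> S \<Longrightarrow> w \<bullet> s \<ge> \<mu>"
proof -
  define C where "C = closure S"
  have C: "convex C" "closed C" "C \<noteq> {}" using assms(1,2) by (auto simp: C_def convex_closure)
  have nC: "norm s \<ge> \<mu>" if "s \<in> C" for s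
  proof -
    have "closed {s :: 'a. norm s \<ge> \<mu>}" by (intro closed_Collect_le continuous_intros)
    then have "C \<subseteq> {s. norm s \<ge> \<mu>}" unfolding C_def using assms(4) by (intro closure_minimal) auto
    then show ?thesis using that by blast
  qed
  define p where "p = closest_point C 0"
  have p: "p \<in> C" unfolding p_def using C by (intro closest_point_in_set)
  have np: "norm p \<ge> \<mu>" by (rule nC[OF p])
  then have "norm p > 0" using assms(3) by linarith
  show ?thesis
  proof (rule that[of "p /\<^sub>R norm p"])
    show "norm (p /\<^sub>R norm p) = 1" using \<open>norm p > 0\<close> by simp
    fix s assume "s \<in> S"
    then have "s \<in> C" unfolding C_def using closure_subset by blast
    from closest_point_dot[OF C(1,2) this, of 0] have "p \<bullet> s \<ge> p \<bullet> p"
      by (simp add: p_def[symmetric] inner_diff_right)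
    then have "(p \<bullet> s) / norm p \<ge> (p \<bullet> p) / norm p" using \<open>norm p > 0\<close> by (intro divide_right_mono) auto
    moreover have "(p \<bullet> p) / norm p = norm p"
      using \<open>norm p > 0\<close> by (simp add: power2_norm_eq_inner[symmetric] power2_eq_square)
    ultimately show "(p /\<^sub>R norm p) \<bullet> s \<ge> \<mu>" using np by (simp add: divide_inverse mult.commute)
  qed
qed

theorem theorem3p2:
  fixes f :: "real^'m \<Rightarrow> real^'n" and U :: "(real^'m) set" and \<delta> :: real
  assumes "CARD('m) \<le> CARD('n)"
    and "convex U" and "open U"
    and "continuous_on U f" and "tame f U"
    and "\<delta> > 0"
    and "\<forall>A\<in>co f U. infdist A singular_maps \<ge> \<delta>"
  shows "(\<forall>x\<in>U. \<forall>x'\<in>U. norm (f x' - f x) \<ge> \<delta> * norm (x' - x)) \<and>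
    inj_on f U \<and>
    (CARD('m) = CARD('n) \<longrightarrow>
      open (f ` U) \<and>
      homeomorphism U (f ` U) f (inv_into U f) \<and>
      (1 / \<delta>)-lipschitz_on (f ` U) (inv_into U f))"
proof -
  interpret regular_on_lines f U by (rule tame_regular_on_lines[OF assms(3-5)])
  have expand: "norm (f x' - f x) \<ge> \<delta> * norm (x' - x)" if x: "x \<in> U" "x' \<in> U" for x x'
  proof (cases "x' = x")
    case False
    define v where "v = x' - x"
    define \<mu> where "\<mu> = \<delta> * norm v"
    have \<mu>: "\<mu> > 0" using False \<open>\<delta> > 0\<close> by (simp add: \<mu>_def v_def)
    define S where "S = (\<lambda>A. blinfun_apply A v) ` co f U"
    have "convex S" unfolding S_def co_def
      by (intro convex_linear_image convex_convex_hull bounded_linear.linear bounded_linear_intros)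
    have deriv: "Blinfun f' \<in> co f U" if "d \<in> U" "(f has_derivative f') (at d)" for d f'
    proof -
      have "frechet_derivative f (at d) = f'" using frechet_derivative_at[OF that(2)] by simp
      moreover have "d \<in> U - nondiff_points f U" using that by (auto simp: nondiff_points_def differentiable_def)
      ultimately have "Blinfun f' \<in> derivatives f U" unfolding derivatives_def by (metis image_eqI)
      then show ?thesis unfolding co_def by (rule hull_inc)
    qed
    \<comment> \<open>A single point of differentiability makes the hull nonempty, as the separation
      requires.\<close>
    obtain r where "r > 0" "ball x r \<subseteq> U" by (rule openE[OF open_U x(1)])
    then obtain d where "d \<in> U" "f differentiable (at d)" using differentiable_dense by (metis subsetD)
    then have "S \<noteq> {}" unfolding S_def differentiable_def using deriv by blast
    have nS: "norm s \<ge> \<mu>" if "s \<in> S" for s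
    proof -
      obtain A where A: "A \<in> co f U" "s = blinfun_apply A v" using \<open>s \<in> S\<close> by (auto simp: S_def)
      have "\<mu> \<le> infdist A singular_maps * norm v"
        unfolding \<mu>_def using assms(7) A(1) by (intro mult_right_mono) auto
      also have "\<dots> \<le> norm s" unfolding A(2) by (rule norm_ge_infdist_singular)
      finally show ?thesis .
    qed
    obtain w where w: "norm w = 1" "\<And>s. s \<in> S \<Longrightarrow> w \<bullet> s \<ge> \<mu>"
      by (rule convex_separating_direction[OF \<open>convex S\<close> \<open>S \<noteq> {}\<close> \<mu> nS]) auto
    have "\<mu> \<le> w \<bullet> (f x' - f x)"
    proof (rule dense_le)
      fix c assume c: "c < \<mu>"
      have xv: "x + v = x'" by (simp add: v_def)
      have "w \<bullet> (f (x + v) - f x) \<ge> c"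
      proof (rule increment_lower_bound[OF assms(2) x(1) _ w(1) _ c])
        fix d f' assume d: "d \<in> U" "(f has_derivative f') (at d)"
        then have "blinfun_apply (Blinfun f') v \<in> S" unfolding S_def using deriv by blast
        moreover have "blinfun_apply (Blinfun f') = f'"
          by (rule bounded_linear_Blinfun_apply[OF has_derivative_bounded_linear[OF d(2)]])
        ultimately show "w \<bullet> f' v \<ge> \<mu>" using w(2) by simp
      qed (use x xv in simp)
      then show "c \<le> w \<bullet> (f x' - f x)" unfolding xv .
    qed
    also have "\<dots> \<le> norm (f x' - f x)" using Cauchy_Schwarz_ineq2[of w "f x' - f x"] w(1) by simp
    finally show ?thesis by (simp add: \<mu>_def v_def)
  qed simp
  have inj: "inj_on f U"
  proof (rule inj_onI)
    fix x x' assume "x \<in> U" "x' \<in> U" "f x = f x'"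
    then have "\<delta> * norm (x' - x) \<le> 0" using expand[of x x'] by simp
    then show "x = x'" using \<open>\<delta> > 0\<close> by (simp add: mult_le_0_iff)
  qed
  have "open (f ` U) \<and> homeomorphism U (f ` U) f (inv_into U f) \<and> (1 / \<delta>)-lipschitz_on (f ` U) (inv_into U f)"
    if eq: "CARD('m) = CARD('n)"
  proof (intro conjI)
    have dim: "DIM(real^'n) \<le> DIM(real^'m)" using eq by simp
    show "open (f ` U)" by (rule invariance_of_domain_gen[OF open_U cont_f inj dim])
    have "continuous_on (f ` U) (inv_into U f)"
      by (rule continuous_on_inverse_open[OF open_U cont_f dim]) (simp add: inj)
    then show "homeomorphism U (f ` U) f (inv_into U f)"
      unfolding homeomorphism_def using cont_f inj by (auto simp: image_image)
    show "(1 / \<delta>)-lipschitz_on (f ` U) (inv_into U f)"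
    proof (rule lipschitz_onI)
      fix y y' assume "y \<in> f ` U" "y' \<in> f ` U"
      then obtain x x' where x: "x \<in> U" "x' \<in> U" "y = f x" "y' = f x'" by blast
      have "\<delta> * dist x x' \<le> dist y y'" using expand[OF x(2,1)] x(3,4) by (simp add: dist_norm)
      then show "dist (inv_into U f y) (inv_into U f y') \<le> 1 / \<delta> * dist y y'"
        using x inj \<open>\<delta> > 0\<close> by (simp add: field_simps)
    qed (use \<open>\<delta> > 0\<close> in simp)
  qed
  then show ?thesis using expand inj by blast
qed

end
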